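(* Let $F$ be a field, $\Gamma=(V,E,s,r)$ a finite directed graph with frame $W_1,\dots,W_k$, and $\gamma$ a regular specialization of $\Gamma$. Then each ideal $I(W_i)$, $1\le i\le k$, of $\widehat L(\Gamma)$ is a topologically graded simple algebra.
   Context: Graphs. $\Gamma=(V,E,s,r)$ is a finite directed graph: $V$ (nonempty) and $E$ are finite sets of vertices and edges, $s,r:E\to V$ are the source and range maps. A sink is a vertex $v$ with $s^{-1}(v)=\emptyset$. A path of length $l(p)=n\ge1$ is a sequence $p=e_1\cdots e_n$ of edges with $r(e_i)=s(e_{i+1})$; $s(p)=s(e_1)$, $r(p)=r(e_n)$; vertices are paths of length $0$. $Path(\Gamma)$ is the set of all paths. A vertex $w$ is a descendant of $v$ if there is a path (possibly of length $0$) from $v$ to $w$. A nonempty $W\subseteq V$ is hereditary if it contains all descendants of its elements. The frame of $\Gamma$ is the list $W_1,\dots,W_k$ of all distinct minimal hereditary subsets of $V$. Leavitt path algebra. $L(\Gamma)$ is the $F$-algebra with generators $v\in V$, $e,e^*$ ($e\in E$) and relations $v_iv_j=\delta_{ij}v_i$; $s(e)e=er(e)=e$, $r(e)e^*=e^*s(e)=e^*$; $e^*f=\delta_{e,f}r(e)$; $v=\sum_{s(e)=v}ee^*$ for every non-sink $v$. It has an involution $*$ with $v\mapsto v$, $e\mapsto e^*$, $e^*\mapsto e$, and is $\mathbb Z$-graded by $\deg v=0$, $\deg e=1$, $\deg e^*=-1$; $L(\Gamma)_i$ is the component of degree $i$. Specialization. A specialization is a map $\gamma:V\setminus\{\text{sinks}\}\to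 E$ with $s(\gamma(v))=v$; edges in its image are called special; a path of length $\ge1$ is special if all its edges are special. For $p=e_1\cdots e_n$, $sd(p)$ is the largest $j$ such that the last $j$ edges of $p$ are all special ($sd(p)=0$ if $e_n$ is not special or if $p$ is a vertex). $\gamma$ is regular if (1) there are finitely many special paths with all vertices lying in $V\setminus\bigcup_{i=1}^kW_i$, and (2) for each $i$ the undirected graph $(W_i,\tilde\gamma_{W_i})$, with vertex set $W_i$ and edges the special edges with source in $W_i$ (whose ranges then also lie in $W_i$) with directions forgotten, is connected. Topology. For nonnegative reals $n,s,d$ let $V_{n,s,d}\subseteq L(\Gamma)$ be the $F$-span of all $pq^*$ with $p,q\in Path(\Gamma)$, $l(p)+l(q)\ge n$, $sd(p)+sd(q)\le s$, $|l(p)-l(q)|\le d$. For $k\ge1$ let $V_k=\sum\{V_{n,s,d}\mid n\ge k(s+d+1)\}$. The subspaces $V_k$ form a basis of neighborhoods of $0$ of a Hausdorff algebra topology on $L(\Gamma)$; $\overline{L(\Gamma)}$ is the completion, $\overline{L(\Gamma)_i}$ the closure of $L(\Gamma)_i$ in it, and $\widehat L(\Gamma)=\sum_{i\in\mathbb Z}\overline{L(\Gamma)_i}$, a graded topological algebra with the induced topology and with components $\overline{L(\Gamma)_i}$. For a hereditary $W$, $I(W)$ is the closed two-sided ideal of $\widehat L(\Gamma)$ generated by $W$. A graded topological algebra $A$ is topologically graded simple if $A\cdot A\ne 0$ and the only closed graded two-sided ideals of $A$ are $0$ and $A$. *)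

theory Defs
  imports
    "Graph_Theory.Graph_Theory"
    "HOL-Analysis.Analysis"
    "HOL-Algebra.Algebraic_Closure_Type"
    "HOL-Library.Poly_Mapping"
begin

section \<open>Topological algebras over a field\<close>

text \<open>
  An associative algebra over the field \<open>'f\<close> is a record of type \<open>('f, 'a) module\<close>. Algebras
  are not assumed to be unital, and the record field \<open>one\<close> plays no role below.
\<close>

definition assoc_algebra :: "('f::field, 'a) module \<Rightarrow> bool" where
  "assoc_algebra A \<longleftrightarrow>
     module ring_of_type_algebra A \<and>
     (\<forall>x\<in>carrier A. \<forall>y\<in>carrier A. x \<otimes>\<^bsub>A\<^esub> y \<in> carrier A) \<and>
     (\<forall>x\<in>carrier A. \<forall>y\<in>carrier A. \<forall>z\<in>carrier A.
        (x \<otimes>\<^bsub>A\<^esub> y) \<otimes>\<^bsub>A\<^esub> z = x \<otimes>\<^bsub>A\<^esub> (y \<otimes>\<^bsub>A\<^esub> z) \<and>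
        (x \<oplus>\<^bsub>A\<^esub> y) \<otimes>\<^bsub>A\<^esub> z = (x \<otimes>\<^bsub>A\<^esub> z) \<oplus>\<^bsub>A\<^esub> (y \<otimes>\<^bsub>A\<^esub> z) \<and>
        z \<otimes>\<^bsub>A\<^esub> (x \<oplus>\<^bsub>A\<^esub> y) = (z \<otimes>\<^bsub>A\<^esub> x) \<oplus>\<^bsub>A\<^esub> (z \<otimes>\<^bsub>A\<^esub> y)) \<and>
     (\<forall>c. \<forall>x\<in>carrier A. \<forall>y\<in>carrier A.
        (c \<odot>\<^bsub>A\<^esub> x) \<otimes>\<^bsub>A\<^esub> y = c \<odot>\<^bsub>A\<^esub> (x \<otimes>\<^bsub>A\<^esub> y) \<and>
        x \<otimes>\<^bsub>A\<^esub> (c \<odot>\<^bsub>A\<^esub> y) = c \<odot>\<^bsub>A\<^esub> (x \<otimes>\<^bsub>A\<^esub> y))"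

definition lin_subspace :: "('f::field, 'a) module \<Rightarrow> 'a set \<Rightarrow> bool" where
  "lin_subspace A U \<longleftrightarrow> submodule U ring_of_type_algebra A"

definition two_sided_ideal :: "('f::field, 'a) module \<Rightarrow> 'a set \<Rightarrow> bool" where
  "two_sided_ideal A J \<longleftrightarrow>
     lin_subspace A J \<and> (\<forall>a\<in>carrier A. \<forall>x\<in>J. a \<otimes>\<^bsub>A\<^esub> x \<in> J \<and> x \<otimes>\<^bsub>A\<^esub> a \<in> J)"

definition quot_algebra :: "('f::field, 'a) module \<Rightarrow> 'a set \<Rightarrow> ('f, 'a set) module" where
  "quot_algebra A J =
     ring.extend (A Quot J) (module.fields (\<lambda>c K. \<Union>x\<in>K. J +>\<^bsub>A\<^esub> (c \<odot>\<^bsub>A\<^esub> x)))"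

definition homogeneous_parts ::
    "('f::field, 'a) module \<Rightarrow> (int \<Rightarrow> 'a set) \<Rightarrow> 'a \<Rightarrow> (int \<Rightarrow> 'a) \<Rightarrow> bool" where
  "homogeneous_parts A C x f \<longleftrightarrow>
     (\<forall>i. f i \<in> C i) \<and> finite {i. f i \<noteq> \<zero>\<^bsub>A\<^esub>} \<and> x = finsum A f {i. f i \<noteq> \<zero>\<^bsub>A\<^esub>}"

definition component_sum :: "('f::field, 'a) module \<Rightarrow> (int \<Rightarrow> 'a set) \<Rightarrow> 'a set" where
  "component_sum A C = {x. \<exists>f. homogeneous_parts A C x f}"

definition graded_algebra :: "('f::field, 'a) module \<Rightarrow> (int \<Rightarrow> 'a set) \<Rightarrow> bool" where
  "graded_algebra A C \<longleftrightarrow>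
     assoc_algebra A \<and> (\<forall>i. lin_subspace A (C i)) \<and>
     (\<forall>x\<in>carrier A. \<exists>!f. homogeneous_parts A C x f) \<and>
     (\<forall>i j. \<forall>x\<in>C i. \<forall>y\<in>C j. x \<otimes>\<^bsub>A\<^esub> y \<in> C (i + j))"

text \<open>The ground field carries the discrete topology.\<close>

definition topological_algebra :: "('f::field, 'a) module \<Rightarrow> 'a topology \<Rightarrow> bool" where
  "topological_algebra A T \<longleftrightarrow>
     assoc_algebra A \<and> topspace T = carrier A \<and>
     continuous_map (prod_topology T T) T (\<lambda>(x, y). x \<oplus>\<^bsub>A\<^esub> y) \<and>
     continuous_map (prod_topology T T) T (\<lambda>(x, y). x \<otimes>\<^bsub>A\<^esub> y) \<and>
     (\<forall>c. continuous_map T T (\<lambda>x. c \<odot>\<^bsub>A\<^esub> x))"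

definition topologically_graded_simple ::
    "('f::field, 'a) module \<Rightarrow> 'a topology \<Rightarrow> (int \<Rightarrow> 'a set) \<Rightarrow> bool" where
  "topologically_graded_simple A T C \<longleftrightarrow>
     topological_algebra A T \<and> graded_algebra A C \<and>
     (\<exists>x\<in>carrier A. \<exists>y\<in>carrier A. x \<otimes>\<^bsub>A\<^esub> y \<noteq> \<zero>\<^bsub>A\<^esub>) \<and>
     (\<forall>J. two_sided_ideal A J \<and> J = component_sum A (\<lambda>i. J \<inter> C i) \<and> closedin T J
          \<longrightarrow> J = {\<zero>\<^bsub>A\<^esub>} \<or> J = carrier A)"

section \<open>Completion of an algebra with a linear topology\<close>

text \<open>
  Let \<open>B\<close> be a family of subspaces of \<open>A\<close> that is a countable basis of neighbourhoods of \<open>0\<close> of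
  an algebra topology on \<open>A\<close>. As \<open>B\<close> is countable, the completion consists of the Cauchy
  sequences modulo the null sequences.
\<close>

definition cauchy_algebra :: "('f::field, 'a) module \<Rightarrow> 'a set set \<Rightarrow> ('f, nat \<Rightarrow> 'a) module" where
  "cauchy_algebra A B =
     \<lparr>carrier = {x. (\<forall>n. x n \<in> carrier A) \<and>
                    (\<forall>U\<in>B. \<exists>N. \<forall>m\<ge>N. \<forall>n\<ge>N. x m \<ominus>\<^bsub>A\<^esub> x n \<in> U)},
      mult = \<lambda>x y n. x n \<otimes>\<^bsub>A\<^esub> y n,
      one = \<lambda>n. \<one>\<^bsub>A\<^esub>,
      zero = \<lambda>n. \<zero>\<^bsub>A\<^esub>,
      add = \<lambda>x y n. x n \<oplus>\<^bsub>A\<^esub> y n,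
      smult = \<lambda>c x n. c \<odot>\<^bsub>A\<^esub> x n\<rparr>"

definition null_sequences :: "('f::field, 'a) module \<Rightarrow> 'a set set \<Rightarrow> (nat \<Rightarrow> 'a) set" where
  "null_sequences A B =
     {x \<in> carrier (cauchy_algebra A B). \<forall>U\<in>B. \<forall>\<^sub>F n in sequentially. x n \<in> U}"

definition completion ::
    "('f::field, 'a) module \<Rightarrow> 'a set set \<Rightarrow> ('f, (nat \<Rightarrow> 'a) set) module" where
  "completion A B = quot_algebra (cauchy_algebra A B) (null_sequences A B)"

definition cauchy_class ::
    "('f::field, 'a) module \<Rightarrow> 'a set set \<Rightarrow> (nat \<Rightarrow> 'a) \<Rightarrow> (nat \<Rightarrow> 'a) set" where
  "cauchy_class A B x = null_sequences A B +>\<^bsub>cauchy_algebra A B\<^esub> x"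

definition completion_embed ::
    "('f::field, 'a) module \<Rightarrow> 'a set set \<Rightarrow> 'a \<Rightarrow> (nat \<Rightarrow> 'a) set" where
  "completion_embed A B a = cauchy_class A B (\<lambda>n. a)"

text \<open>
  The closures in the completion of the subspaces in \<open>B\<close> form a basis of neighbourhoods of \<open>0\<close>. A
  subspace \<open>U\<close> in \<open>B\<close> is open, so its closure consists of the classes of those Cauchy sequences
  that are eventually in \<open>U\<close>. The cosets of these closures form a basis of the topology.
\<close>

definition completion_nhds ::
    "('f::field, 'a) module \<Rightarrow> 'a set set \<Rightarrow> (nat \<Rightarrow> 'a) set set set" where
  "completion_nhds A B =
     (\<lambda>U. cauchy_class A B `
        {x \<in> carrier (cauchy_algebra A B). \<forall>\<^sub>F n in sequentially. x n \<in> U}) ` B"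

definition completion_topology ::
    "('f::field, 'a) module \<Rightarrow> 'a set set \<Rightarrow> (nat \<Rightarrow> 'a) set topology" where
  "completion_topology A B =
     topology_generated_by
       {U +>\<^bsub>completion A B\<^esub> z | U z. U \<in> completion_nhds A B \<and> z \<in> carrier (completion A B)}"

section \<open>Graphs and specializations\<close>

text \<open>A path is a pair of its source and the list of its edges; vertices are the pairs \<open>(v, [])\<close>.\<close>

definition paths :: "('v, 'e) pre_digraph \<Rightarrow> ('v \<times> 'e list) set" where
  "paths G = {(u, p). \<exists>v. pre_digraph.awalk G u p v}"

abbreviation path_length :: "'v \<times> 'e list \<Rightarrow> nat" where
  "path_length p \<equiv> length (snd p)"

definition sink :: "('v, 'e) pre_digraph \<Rightarrow> 'v \<Rightarrow> bool" where
  "sink G v \<longleftrightarrow> v \<in> verts G \<and> out_arcs G v = {}"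

definition hereditary :: "('v, 'e) pre_digraph \<Rightarrow> 'v set \<Rightarrow> bool" where
  "hereditary G W \<longleftrightarrow>
     W \<noteq> {} \<and> W \<subseteq> verts G \<and> (\<forall>v\<in>W. \<forall>w. v \<rightarrow>\<^sup>*\<^bsub>G\<^esub> w \<longrightarrow> w \<in> W)"

definition frame :: "('v, 'e) pre_digraph \<Rightarrow> 'v set list \<Rightarrow> bool" where
  "frame G Ws \<longleftrightarrow>
     distinct Ws \<and> set Ws = {W. hereditary G W \<and> \<not> (\<exists>W'. hereditary G W' \<and> W' \<subset> W)}"

definition specialization :: "('v, 'e) pre_digraph \<Rightarrow> ('v \<Rightarrow> 'e) \<Rightarrow> bool" where
  "specialization G \<gamma> \<longleftrightarrow> (\<forall>v\<in>verts G. \<not> sink G v \<longrightarrow> \<gamma> v \<in> out_arcs G v)"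

definition special_arcs :: "('v, 'e) pre_digraph \<Rightarrow> ('v \<Rightarrow> 'e) \<Rightarrow> 'e set" where
  "special_arcs G \<gamma> = \<gamma> ` {v \<in> verts G. \<not> sink G v}"

definition special_paths :: "('v, 'e) pre_digraph \<Rightarrow> ('v \<Rightarrow> 'e) \<Rightarrow> ('v \<times> 'e list) set" where
  "special_paths G \<gamma> = {(u, p) \<in> paths G. p \<noteq> [] \<and> set p \<subseteq> special_arcs G \<gamma>}"

definition sd :: "('v, 'e) pre_digraph \<Rightarrow> ('v \<Rightarrow> 'e) \<Rightarrow> 'v \<times> 'e list \<Rightarrow> nat" where
  "sd G \<gamma> p = length (takeWhile (\<lambda>e. e \<in> special_arcs G \<gamma>) (rev (snd p)))"

definition special_subgraph ::
    "('v, 'e) pre_digraph \<Rightarrow> ('v \<Rightarrow> 'e) \<Rightarrow> 'v set \<Rightarrow> ('v, 'e) pre_digraph" where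
  "special_subgraph G \<gamma> W =
     \<lparr>verts = W, arcs = {e \<in> special_arcs G \<gamma>. tail G e \<in> W}, tail = tail G, head = head G\<rparr>"

text \<open>The constant \<open>Digraph_Component.connected\<close> disregards the directions of the edges.\<close>

definition regular_specialization ::
    "('v, 'e) pre_digraph \<Rightarrow> 'v set list \<Rightarrow> ('v \<Rightarrow> 'e) \<Rightarrow> bool" where
  "regular_specialization G Ws \<gamma> \<longleftrightarrow>
     specialization G \<gamma> \<and>
     finite {(u, p) \<in> special_paths G \<gamma>.
               set (pre_digraph.awalk_verts G u p) \<subseteq> verts G - \<Union>(set Ws)} \<and>
     (\<forall>W\<in>set Ws. Digraph_Component.connected (special_subgraph G \<gamma> W))"

section \<open>Leavitt path algebras\<close>

text \<open>
  Words form a monoid under concatenation, which makes \<open>'g list \<Rightarrow>\<^sub>0 'f\<close> the free unital algebra on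
  \<open>'g\<close>. Leavitt path algebras are presented as not necessarily unital algebras, so the empty word is
  excluded from the free algebra below.
\<close>

instantiation list :: (type) monoid_add
begin

definition zero_list :: "'a list" where
  "zero_list = []"

definition plus_list :: "'a list \<Rightarrow> 'a list \<Rightarrow> 'a list" where
  "plus_list = append"

instance
  by standard (simp_all add: zero_list_def plus_list_def)

end

definition free_algebra :: "'g set \<Rightarrow> ('f::field, 'g list \<Rightarrow>\<^sub>0 'f) module" where
  "free_algebra S =
     \<lparr>carrier = {x. Poly_Mapping.keys x \<subseteq> lists S - {[]}},
      mult = (*), one = 1, zero = 0, add = (+),
      smult = \<lambda>c. Poly_Mapping.map ((*) c)\<rparr>"

datatype ('v, 'e) generator = Vert 'v | Edge 'e | Ghost 'e

definition generators :: "('v, 'e) pre_digraph \<Rightarrow> ('v, 'e) generator set" where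
  "generators G = Vert ` verts G \<union> Edge ` arcs G \<union> Ghost ` arcs G"

abbreviation monomial :: "'g list \<Rightarrow> ('g list \<Rightarrow>\<^sub>0 'f::field)" where
  "monomial w \<equiv> Poly_Mapping.single w 1"

abbreviation gvert :: "'v \<Rightarrow> (('v, 'e) generator list \<Rightarrow>\<^sub>0 'f::field)" where
  "gvert v \<equiv> monomial [Vert v]"

abbreviation gedge :: "'e \<Rightarrow> (('v, 'e) generator list \<Rightarrow>\<^sub>0 'f::field)" where
  "gedge e \<equiv> monomial [Edge e]"

abbreviation gghost :: "'e \<Rightarrow> (('v, 'e) generator list \<Rightarrow>\<^sub>0 'f::field)" where
  "gghost e \<equiv> monomial [Ghost e]"

definition leavitt_relations ::
    "('v, 'e) pre_digraph \<Rightarrow> (('v, 'e) generator list \<Rightarrow>\<^sub>0 'f::field) set" where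
  "leavitt_relations G =
     {gvert v * gvert w - (if v = w then gvert v else 0) | v w. v \<in> verts G \<and> w \<in> verts G} \<union>
     (\<Union>e\<in>arcs G.
        {gvert (tail G e) * gedge e - gedge e, gedge e * gvert (head G e) - gedge e,
         gvert (head G e) * gghost e - gghost e, gghost e * gvert (tail G e) - gghost e}) \<union>
     {gghost e * gedge f - (if e = f then gvert (head G e) else 0) | e f.
        e \<in> arcs G \<and> f \<in> arcs G} \<union>
     {gvert v - (\<Sum>e\<in>out_arcs G v. gedge e * gghost e) | v. v \<in> verts G \<and> \<not> sink G v}"

definition leavitt_ideal ::
    "('v, 'e) pre_digraph \<Rightarrow> (('v, 'e) generator list \<Rightarrow>\<^sub>0 'f::field) set" where
  "leavitt_ideal G = two_sided_ideal (free_algebra (generators G)) hull leavitt_relations G"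

definition leavitt ::
    "('v, 'e) pre_digraph \<Rightarrow> ('f::field, (('v, 'e) generator list \<Rightarrow>\<^sub>0 'f) set) module" where
  "leavitt G = quot_algebra (free_algebra (generators G)) (leavitt_ideal G)"

definition leavitt_class ::
    "('v, 'e) pre_digraph \<Rightarrow> (('v, 'e) generator list \<Rightarrow>\<^sub>0 'f::field)
      \<Rightarrow> (('v, 'e) generator list \<Rightarrow>\<^sub>0 'f) set" where
  "leavitt_class G x = leavitt_ideal G +>\<^bsub>free_algebra (generators G)\<^esub> x"

fun generator_degree :: "('v, 'e) generator \<Rightarrow> int" where
  "generator_degree (Vert v) = 0"
| "generator_degree (Edge e) = 1"
| "generator_degree (Ghost e) = -1"

definition leavitt_component ::
    "('v, 'e) pre_digraph \<Rightarrow> int \<Rightarrow> (('v, 'e) generator list \<Rightarrow>\<^sub>0 'f::field) set set" where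
  "leavitt_component G i =
     leavitt_class G `
       {x \<in> carrier (free_algebra (generators G)).
          \<forall>w\<in>Poly_Mapping.keys x. sum_list (map generator_degree w) = i}"

fun generator_star :: "('v, 'e) generator \<Rightarrow> ('v, 'e) generator" where
  "generator_star (Vert v) = Vert v"
| "generator_star (Edge e) = Ghost e"
| "generator_star (Ghost e) = Edge e"

definition path_word :: "'v \<times> 'e list \<Rightarrow> ('v, 'e) generator list" where
  "path_word p = (if snd p = [] then [Vert (fst p)] else map Edge (snd p))"

text \<open>The involution reverses the order of the factors of a word.\<close>

definition path_star_word :: "'v \<times> 'e list \<Rightarrow> ('v, 'e) generator list" where
  "path_star_word p = rev (map generator_star (path_word p))"

definition leavitt_nsd ::
    "('v, 'e) pre_digraph \<Rightarrow> ('v \<Rightarrow> 'e) \<Rightarrow> real \<Rightarrow> real \<Rightarrow> real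
      \<Rightarrow> (('v, 'e) generator list \<Rightarrow>\<^sub>0 'f::field) set set" where
  "leavitt_nsd G \<gamma> n s d =
     lin_subspace (leavitt G) hull
       {leavitt_class G (monomial (path_word p)) \<otimes>\<^bsub>leavitt G\<^esub>
          leavitt_class G (monomial (path_star_word q)) | p q.
          p \<in> paths G \<and> q \<in> paths G \<and>
          real (path_length p) + real (path_length q) \<ge> n \<and>
          real (sd G \<gamma> p) + real (sd G \<gamma> q) \<le> s \<and>
          \<bar>real (path_length p) - real (path_length q)\<bar> \<le> d}"

definition leavitt_nhd ::
    "('v, 'e) pre_digraph \<Rightarrow> ('v \<Rightarrow> 'e) \<Rightarrow> nat
      \<Rightarrow> (('v, 'e) generator list \<Rightarrow>\<^sub>0 'f::field) set set" where
  "leavitt_nhd G \<gamma> k =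
     lin_subspace (leavitt G) hull
       \<Union>{leavitt_nsd G \<gamma> n s d | n s d.
            n \<ge> 0 \<and> s \<ge> 0 \<and> d \<ge> 0 \<and> n \<ge> real k * (s + d + 1)}"

definition leavitt_nhds ::
    "('v, 'e) pre_digraph \<Rightarrow> ('v \<Rightarrow> 'e)
      \<Rightarrow> (('v, 'e) generator list \<Rightarrow>\<^sub>0 'f::field) set set set" where
  "leavitt_nhds G \<gamma> = leavitt_nhd G \<gamma> ` {k. k \<ge> 1}"

section \<open>The graded completion and its ideals\<close>

type_synonym ('f, 'v, 'e) leavitt_completion =
  "(nat \<Rightarrow> (('v, 'e) generator list \<Rightarrow>\<^sub>0 'f) set) set"

definition leavitt_embed ::
    "('v, 'e) pre_digraph \<Rightarrow> ('v \<Rightarrow> 'e) \<Rightarrow> (('v, 'e) generator list \<Rightarrow>\<^sub>0 'f::field) set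
      \<Rightarrow> ('f, 'v, 'e) leavitt_completion" where
  "leavitt_embed G \<gamma> = completion_embed (leavitt G) (leavitt_nhds G \<gamma>)"

definition leavitt_hat_component ::
    "('v, 'e) pre_digraph \<Rightarrow> ('v \<Rightarrow> 'e) \<Rightarrow> int
      \<Rightarrow> ('f::field, 'v, 'e) leavitt_completion set" where
  "leavitt_hat_component G \<gamma> i =
     completion_topology (leavitt G) (leavitt_nhds G \<gamma>)
       closure_of (leavitt_embed G \<gamma> ` leavitt_component G i)"

definition leavitt_hat ::
    "('v, 'e) pre_digraph \<Rightarrow> ('v \<Rightarrow> 'e)
      \<Rightarrow> ('f::field, ('f, 'v, 'e) leavitt_completion) module" where
  "leavitt_hat G \<gamma> =
     (let L = completion (leavitt G) (leavitt_nhds G \<gamma>)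
      in L\<lparr>carrier := component_sum L (leavitt_hat_component G \<gamma>)\<rparr>)"

definition leavitt_hat_topology ::
    "('v, 'e) pre_digraph \<Rightarrow> ('v \<Rightarrow> 'e)
      \<Rightarrow> ('f::field, 'v, 'e) leavitt_completion topology" where
  "leavitt_hat_topology G \<gamma> =
     subtopology (completion_topology (leavitt G) (leavitt_nhds G \<gamma>))
       (carrier (leavitt_hat G \<gamma>))"

definition leavitt_hat_ideal ::
    "('v, 'e) pre_digraph \<Rightarrow> ('v \<Rightarrow> 'e) \<Rightarrow> 'v set
      \<Rightarrow> ('f::field, 'v, 'e) leavitt_completion set" where
  "leavitt_hat_ideal G \<gamma> W =
     (\<lambda>J. two_sided_ideal (leavitt_hat G \<gamma>) J \<and> closedin (leavitt_hat_topology G \<gamma>) J)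
       hull ((\<lambda>w. leavitt_embed G \<gamma> (leavitt_class G (gvert w))) ` W)"

end

theory Submission
  imports Defs "HOL-Library.Function_Algebras"
begin

text \<open>
  Elements of the completion are represented by Cauchy sequences in the free algebra. The Leavitt path
  algebra acts on the space spanned by the paths (infinite or ending at a sink) that are eventually
  special, and this action extends to the completion: a deep product \<open>p q\<^sup>*\<close> kills a given
  eventually special path, since otherwise \<open>q\<close> would be its initial segment and \<open>sd q\<close> would be large.
  For such a path with special tail starting at \<open>u\<close>, the idempotents \<open>z\<^sub>n z\<^sub>n\<^sup>*\<close> given by the initial
  segments \<open>z\<^sub>n\<close> of the tail converge to an idempotent \<open>b(u)\<close>, and every vertex is the convergent sum
  of the \<open>p b(r(p)) p\<^sup>*\<close> over the paths \<open>p\<close> from it that do not end in a special edge. Hence the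
  action is faithful on homogeneous elements. If \<open>a \<noteq> 0\<close> is a homogeneous element of an ideal \<open>J\<close> of
  \<open>I(W)\<close>, then some matrix coefficient of \<open>a\<close> is nonzero, and compressing \<open>a\<close> between the two
  corresponding idempotents gives \<open>b(u) \<in> J\<close> for some \<open>u \<in> W\<close>. As the special edges connect \<open>W\<close>, two
  special tails starting in \<open>W\<close> eventually meet, so \<open>J\<close> contains \<open>b(u)\<close> for all \<open>u \<in> W\<close>, and by the
  above sums all vertices in \<open>W\<close>.
\<close>

section \<open>Presentations of algebras\<close>

text \<open>The Leavitt path algebra is never given a basis: calculations are congruences modulo the
  relations, equality in the completion is membership of a difference in \<open>nulls\<close>, and
  every nonvanishing statement comes from the representation. In n \<ge> k(s + d + 1) the summand d
  controls the length that is lost when two deep products are multiplied. The main obstacle is that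
  special tails may be infinite and must be cut at some level n. Compressing a deep element by the
  idempotents of cut paths keeps it deep, with bounds independent of n, so the cut can be chosen
  after an approximation has been fixed. Homogeneity enters because an element of degree d carries
  the cut at level n to the cut at level n + d for all its words at once. That the compression ends
  at a vertex of W has its own reason: elements of I(W) annihilate the paths whose tail never enters
  W. Moreover an ideal of I(W) may only be multiplied by I(W), so the outer factors of the
  compression are arranged to have a vertex of W as one-sided unit.\<close>

locale scaled_ring =
  fixes sc :: "'f::field \<Rightarrow> 'p::ring \<Rightarrow> 'p"
  assumes sc_add_right: "sc c (x + y) = sc c x + sc c y"
    and sc_add_left: "sc (a + b) x = sc a x + sc b x"
    and sc_assoc: "sc (a * b) x = sc a (sc b x)"
    and sc_one [simp]: "sc 1 x = x"
    and sc_mult_left [simp]: "sc c x * y = sc c (x * y)"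
    and sc_mult_right [simp]: "x * sc c y = sc c (x * y)"
begin

lemma sc_zero_right [simp]: "sc c 0 = 0"
  using sc_add_right[of c 0 0] by simp

lemma sc_zero_left [simp]: "sc 0 x = 0"
  using sc_add_left[of 0 0 x] by simp

lemma sc_uminus_left: "sc (- c) x = - sc c x"
proof -
  have "sc (- c) x + sc c x = 0" using sc_add_left[of "- c" c x] by simp
  then show ?thesis by (simp add: eq_neg_iff_add_eq_0)
qed

lemma sc_uminus_right: "sc c (- x) = - sc c x"
proof -
  have "sc c (- x) + sc c x = 0" using sc_add_right[of c "- x" x] by simp
  then show ?thesis by (simp add: eq_neg_iff_add_eq_0)
qed

lemma sc_diff_right: "sc c (x - y) = sc c x - sc c y"
  using sc_add_right[of c x "- y"] by (simp add: sc_uminus_right)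

lemma sc_sum_right: "sc c (sum f A) = (\<Sum>a\<in>A. sc c (f a))"
  by (induction A rule: infinite_finite_induct) (simp_all add: sc_add_right)

definition subsp :: "'p set \<Rightarrow> bool" where
  "subsp U \<longleftrightarrow> 0 \<in> U \<and> (\<forall>x\<in>U. \<forall>y\<in>U. x + y \<in> U) \<and> (\<forall>c. \<forall>x\<in>U. sc c x \<in> U)"

definition subalg :: "'p set \<Rightarrow> bool" where
  "subalg S \<longleftrightarrow> subsp S \<and> (\<forall>x\<in>S. \<forall>y\<in>S. x * y \<in> S)"

definition ideal_in :: "'p set \<Rightarrow> 'p set \<Rightarrow> bool" where
  "ideal_in S J \<longleftrightarrow> subsp J \<and> J \<subseteq> S \<and> (\<forall>a\<in>S. \<forall>x\<in>J. a * x \<in> J \<and> x * a \<in> J)"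

lemma subspD:
  assumes "subsp U"
  shows "0 \<in> U" "\<And>x y. x \<in> U \<Longrightarrow> y \<in> U \<Longrightarrow> x + y \<in> U" "\<And>c x. x \<in> U \<Longrightarrow> sc c x \<in> U"
    "\<And>x. x \<in> U \<Longrightarrow> - x \<in> U" "\<And>x y. x \<in> U \<Longrightarrow> y \<in> U \<Longrightarrow> x - y \<in> U"
proof -
  show "0 \<in> U" "\<And>x y. x \<in> U \<Longrightarrow> y \<in> U \<Longrightarrow> x + y \<in> U" and sc: "\<And>c x. x \<in> U \<Longrightarrow> sc c x \<in> U"
    using assms by (auto simp: subsp_def)
  show neg: "- x \<in> U" if "x \<in> U" for x using sc[OF that, of "- 1"] by (simp add: sc_uminus_left)
  show "x - y \<in> U" if "x \<in> U" "y \<in> U" for x y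
    using assms that neg[of y] unfolding subsp_def by (metis diff_conv_add_uminus)
qed

lemma subsp_sum:
  assumes "subsp U" "\<And>a. a \<in> A \<Longrightarrow> f a \<in> U" shows "sum f A \<in> U"
  using assms(2) by (induction A rule: infinite_finite_induct) (auto intro: subspD[OF assms(1)])

lemma subsp_diff_iff:
  assumes "subsp U" "x - y \<in> U" shows "x \<in> U \<longleftrightarrow> y \<in> U"
  using subspD(2)[OF assms(1), of "x - y" y] subspD(5)[OF assms(1), of x "x - y"] assms(2) by auto

end

text \<open>Algebra records are reached through a map from a subalgebra of a type-class ring, so
  that all computation happens with the class operations. A quotient keeps \<open>S\<close> and
  changes only \<open>\<phi>\<close>; Cauchy sequences replace the ring by its sequences with
  pointwise operations; a subalgebra shrinks \<open>S\<close>. Every algebra in the proof arises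
  from the free algebra by these three moves.\<close>

locale presentation = scaled_ring sc for sc :: "'f::field \<Rightarrow> 'p::ring \<Rightarrow> 'p" +
  fixes S :: "'p set" and A :: "('f, 'a) module" and \<phi> :: "'p \<Rightarrow> 'a"
  assumes subalg: "subalg S"
    and carrier_eq: "carrier A = \<phi> ` S"
    and pres_zero: "\<zero>\<^bsub>A\<^esub> = \<phi> 0"
    and pres_add: "x \<in> S \<Longrightarrow> y \<in> S \<Longrightarrow> \<phi> x \<oplus>\<^bsub>A\<^esub> \<phi> y = \<phi> (x + y)"
    and pres_mult: "x \<in> S \<Longrightarrow> y \<in> S \<Longrightarrow> \<phi> x \<otimes>\<^bsub>A\<^esub> \<phi> y = \<phi> (x * y)"
    and pres_smult: "x \<in> S \<Longrightarrow> c \<odot>\<^bsub>A\<^esub> \<phi> x = \<phi> (sc c x)"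
begin

lemma subsp_S: "subsp S" and S_mult: "x \<in> S \<Longrightarrow> y \<in> S \<Longrightarrow> x * y \<in> S"
  using subalg by (auto simp: subalg_def)

lemmas S_closed = subspD[OF subsp_S] S_mult

lemma pres_in_carrier [simp]: "x \<in> S \<Longrightarrow> \<phi> x \<in> carrier A"
  by (simp add: carrier_eq)

lemma carrierE: assumes "a \<in> carrier A" obtains x where "x \<in> S" "a = \<phi> x"
  using assms by (auto simp: carrier_eq)

lemma field_cring: "cring (ring_of_type_algebra :: 'f ring)"
  by (meson cring_from_type_algebra)

lemma abelian_group: "abelian_group A"
proof (rule abelian_groupI)
  show "\<exists>y\<in>carrier A. y \<oplus>\<^bsub>A\<^esub> x = \<zero>\<^bsub>A\<^esub>" if "x \<in> carrier A" for x
  proof -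
    obtain z where z: "z \<in> S" "x = \<phi> z" using \<open>x \<in> carrier A\<close> by (rule carrierE)
    then have "\<phi> (- z) \<oplus>\<^bsub>A\<^esub> x = \<zero>\<^bsub>A\<^esub>" by (simp add: pres_add S_closed pres_zero)
    then show ?thesis using z by (intro bexI[of _ "\<phi> (- z)"]) (auto simp: S_closed)
  qed
qed (auto simp: carrier_eq pres_add pres_zero S_closed algebra_simps)

sublocale M: abelian_group A by (rule abelian_group)

lemma pres_module: "Module.module ring_of_type_algebra A"
proof (rule moduleI)
  show "cring (ring_of_type_algebra :: 'f ring)" by (rule field_cring)
  show "abelian_group A" by (rule abelian_group)
qed (auto simp: carrier_eq pres_add pres_smult S_closed ring_of_type_algebra_def
    sc_add_left sc_add_right sc_assoc)

lemma pres_assoc_algebra: "assoc_algebra A"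
  unfolding assoc_algebra_def
proof (intro conjI)
  show "Module.module ring_of_type_algebra A" by (rule pres_module)
qed (auto simp: carrier_eq pres_add pres_smult pres_mult S_closed distrib_left distrib_right
    mult.assoc)

lemma pres_a_inv: "x \<in> S \<Longrightarrow> \<ominus>\<^bsub>A\<^esub> \<phi> x = \<phi> (- x)"
  by (intro M.minus_equality) (auto simp: pres_add pres_zero S_closed)

lemma pres_minus: "x \<in> S \<Longrightarrow> y \<in> S \<Longrightarrow> \<phi> x \<ominus>\<^bsub>A\<^esub> \<phi> y = \<phi> (x - y)"
  by (simp add: a_minus_def pres_a_inv pres_add S_closed)

lemma pres_finsum:
  assumes "finite D" "\<And>i. i \<in> D \<Longrightarrow> f i \<in> S"
  shows "finsum A (\<lambda>i. \<phi> (f i)) D = \<phi> (sum f D)"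
  using assms
proof (induction D)
  case (insert i D)
  then show ?case
    by (subst M.finsum_insert) (auto simp: pres_add subsp_sum[OF subsp_S])
qed (simp add: pres_zero)

definition pre :: "'a set \<Rightarrow> 'p set" where
  "pre U = {x \<in> S. \<phi> x \<in> U}"

lemma pre_sub: "pre U \<subseteq> S" by (auto simp: pre_def)

lemma image_pre: "U \<subseteq> carrier A \<Longrightarrow> \<phi> ` pre U = U"
  by (auto simp: pre_def carrier_eq)

lemma pre_mono_iff: "U \<subseteq> carrier A \<Longrightarrow> pre U \<subseteq> pre V \<longleftrightarrow> U \<subseteq> V"
  by (auto simp: pre_def carrier_eq)

lemma lin_subspace_iff: "lin_subspace A U \<longleftrightarrow> U \<subseteq> carrier A \<and> subsp (pre U)"
proof -
  interpret mo: Module.module ring_of_type_algebra A by (rule pres_module)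
  have UNIV: "carrier (ring_of_type_algebra :: 'f ring) = UNIV"
    by (simp add: ring_of_type_algebra_def)
  show ?thesis
  proof
    assume L: "lin_subspace A U"
    then have sm: "submodule U ring_of_type_algebra A" by (simp add: lin_subspace_def)
    note E = mo.submoduleE[OF sm]
    have "\<zero>\<^bsub>A\<^esub> \<in> U" using sm submodule.axioms(1) subgroup.one_closed by fastforce
    then show "U \<subseteq> carrier A \<and> subsp (pre U)"
      using E by (auto simp: subsp_def pre_def S_closed pres_zero UNIV
          simp flip: pres_add pres_smult)
  next
    assume R: "U \<subseteq> carrier A \<and> subsp (pre U)"
    then have sp: "subsp (pre U)" and sub: "U \<subseteq> carrier A" by auto
    note P = subspD[OF sp]
    have ob: "\<exists>x\<in>pre U. a = \<phi> x" if "a \<in> U" for a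
      using that sub image_pre[OF sub] by blast
    show "lin_subspace A U" unfolding lin_subspace_def
    proof (rule mo.submoduleI[OF sub])
      show "\<zero>\<^bsub>A\<^esub> \<in> U" using P(1) by (simp add: pres_zero pre_def)
      show "\<ominus>\<^bsub>A\<^esub> a \<in> U" if "a \<in> U" for a
        using ob[OF that] P(4) by (auto simp: pres_a_inv pre_def)
      show "a \<oplus>\<^bsub>A\<^esub> b \<in> U" if "a \<in> U" "b \<in> U" for a b
        using ob[OF that(1)] ob[OF that(2)] P(2) by (auto simp: pres_add pre_def)
      show "c \<odot>\<^bsub>A\<^esub> a \<in> U" if "a \<in> U" for a c
        using ob[OF that] P(3) by (auto simp: pres_smult pre_def)
    qed
  qed
qed

lemma two_sided_ideal_iff: "two_sided_ideal A J \<longleftrightarrow> J \<subseteq> carrier A \<and> ideal_in S (pre J)"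
proof -
  have "(\<forall>a\<in>carrier A. \<forall>x\<in>J. a \<otimes>\<^bsub>A\<^esub> x \<in> J \<and> x \<otimes>\<^bsub>A\<^esub> a \<in> J) \<longleftrightarrow>
    (\<forall>a\<in>S. \<forall>x\<in>pre J. a * x \<in> pre J \<and> x * a \<in> pre J)" if "J \<subseteq> carrier A"
  proof -
    have "(\<forall>a\<in>carrier A. \<forall>x\<in>J. a \<otimes>\<^bsub>A\<^esub> x \<in> J \<and> x \<otimes>\<^bsub>A\<^esub> a \<in> J) \<longleftrightarrow>
      (\<forall>a\<in>S. \<forall>x\<in>pre J. \<phi> a \<otimes>\<^bsub>A\<^esub> \<phi> x \<in> J \<and> \<phi> x \<otimes>\<^bsub>A\<^esub> \<phi> a \<in> J)"
      unfolding carrier_eq using ball_simps(9)[of \<phi> "pre J"] image_pre[OF that] by simp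
    also have "\<dots> \<longleftrightarrow> (\<forall>a\<in>S. \<forall>x\<in>pre J. a * x \<in> pre J \<and> x * a \<in> pre J)"
      by (auto simp: pre_def pres_mult S_closed)
    finally show ?thesis .
  qed
  then show ?thesis
    unfolding two_sided_ideal_def lin_subspace_iff ideal_in_def using pre_sub by blast
qed

lemma coset_eq:
  assumes "J \<subseteq> carrier A" "x \<in> S"
  shows "J +>\<^bsub>A\<^esub> \<phi> x = \<phi> ` {z \<in> S. z - x \<in> pre J}"
proof -
  have "J +>\<^bsub>A\<^esub> \<phi> x = (\<lambda>h. h \<oplus>\<^bsub>A\<^esub> \<phi> x) ` \<phi> ` pre J"
    using image_pre[OF assms(1)] by (auto simp: a_r_coset_def')
  also have "\<dots> = (\<lambda>h. \<phi> (h + x)) ` pre J"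
    using assms(2) by (simp add: image_image) (auto simp: pre_def pres_add intro!: image_cong)
  also have "\<dots> = \<phi> ` (\<lambda>h. h + x) ` pre J" by (simp add: image_image)
  also have "(\<lambda>h. h + x) ` pre J = {z \<in> S. z - x \<in> pre J}"
    using assms(2) by (auto simp: pre_def S_closed image_iff) (metis S_closed(5) diff_add_cancel[symmetric])
  finally show ?thesis .
qed

lemma coset_eq_iff:
  assumes "lin_subspace A J" "x \<in> S" "y \<in> S"
  shows "J +>\<^bsub>A\<^esub> \<phi> x = J +>\<^bsub>A\<^esub> \<phi> y \<longleftrightarrow> x - y \<in> pre J"
proof -
  have J: "J \<subseteq> carrier A" and sp: "subsp (pre J)" using assms(1) by (auto simp: lin_subspace_iff)
  note P = subspD[OF sp]
  show ?thesis
  proof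
    assume "J +>\<^bsub>A\<^esub> \<phi> x = J +>\<^bsub>A\<^esub> \<phi> y"
    then have "\<phi> x \<in> J +>\<^bsub>A\<^esub> \<phi> y" using P(1) assms(2) by (auto simp: coset_eq[OF J])
    then obtain z where z: "\<phi> x = \<phi> z" "z \<in> S" "z - y \<in> pre J"
      using assms(3) by (auto simp: coset_eq[OF J])
    have "\<phi> (x - y) = \<phi> x \<ominus>\<^bsub>A\<^esub> \<phi> y" using assms by (simp add: pres_minus)
    also have "\<dots> = \<phi> (z - y)" using z assms by (simp add: pres_minus)
    finally show "x - y \<in> pre J" using z assms by (auto simp: pre_def S_closed)
  next
    assume d: "x - y \<in> pre J"
    have "z - x \<in> pre J \<longleftrightarrow> z - y \<in> pre J" for z
      by (rule subsp_diff_iff[OF sp]) (use P(4)[OF d] in simp)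
    then show "J +>\<^bsub>A\<^esub> \<phi> x = J +>\<^bsub>A\<^esub> \<phi> y" using assms by (simp add: coset_eq[OF J])
  qed
qed

text \<open>Product and scalar multiple in the quotient record are unions over all representatives
  of the factors. Since the preimage of \<open>J\<close> is an ideal, every choice yields the same
  coset, and \<open>mem\<close> shows that there is a choice at all.\<close>

lemma presentation_quot:
  assumes "two_sided_ideal A J"
  shows "presentation sc S (quot_algebra A J) (\<lambda>x. J +>\<^bsub>A\<^esub> \<phi> x)"
proof -
  let ?q = "\<lambda>x. J +>\<^bsub>A\<^esub> \<phi> x"
  have lin: "lin_subspace A J" and J: "J \<subseteq> carrier A" and id: "ideal_in S (pre J)"
    using assms assms[unfolded two_sided_ideal_iff] by (simp_all add: two_sided_ideal_def)
  have sp: "subsp (pre J)" using id by (simp add: ideal_in_def)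
  note P = subspD[OF sp]
  note ceq = coset_eq[OF J]
  have mem: "x \<in> S \<Longrightarrow> \<phi> x \<in> ?q x" for x using P(1) by (auto simp: ceq)
  have cong: "?q x = ?q y" if "x \<in> S" "y \<in> S" "x - y \<in> pre J" for x y
    using coset_eq_iff[OF lin] that by blast
  have mI: "a * x \<in> pre J" "x * a \<in> pre J" if "a \<in> S" "x \<in> pre J" for a x
    using id that by (auto simp: ideal_in_def)
  have defs: "carrier (quot_algebra A J) = ?q ` S" "\<zero>\<^bsub>quot_algebra A J\<^esub> = J"
    "mult (quot_algebra A J) = rcoset_mult A J" "add (quot_algebra A J) = set_add A"
    "smult (quot_algebra A J) = (\<lambda>c K. \<Union>x\<in>K. J +>\<^bsub>A\<^esub> (c \<odot>\<^bsub>A\<^esub> x))"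
    by (auto simp: quot_algebra_def ring.defs module.defs FactRing_def A_RCOSETS_def'
        simp flip: carrier_eq) (auto simp: carrier_eq)
  show ?thesis
  proof
    show "subalg S" by (rule subalg)
    show "carrier (quot_algebra A J) = ?q ` S" by (simp add: defs)
    have "{z \<in> S. z \<in> pre J} = pre J" using pre_sub by auto
    then have "?q 0 = J" using image_pre[OF J] by (simp add: ceq S_closed)
    then show "\<zero>\<^bsub>quot_algebra A J\<^esub> = ?q 0" by (simp add: defs)
    fix x y assume xy: "x \<in> S" "y \<in> S"
    show "?q x \<oplus>\<^bsub>quot_algebra A J\<^esub> ?q y = ?q (x + y)"
    proof -
      have "?q x \<oplus>\<^bsub>quot_algebra A J\<^esub> ?q y =
        {\<phi> z \<oplus>\<^bsub>A\<^esub> \<phi> w | z w. z \<in> S \<and> z - x \<in> pre J \<and> w \<in> S \<and> w - y \<in> pre J}"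
        using xy by (auto simp: defs set_add_def' ceq)
      also have "\<dots> = \<phi> ` {z + w | z w. z \<in> S \<and> z - x \<in> pre J \<and> w \<in> S \<and> w - y \<in> pre J}"
        by (auto simp: pres_add image_iff) (metis pres_add)+
      also have "{z + w | z w. z \<in> S \<and> z - x \<in> pre J \<and> w \<in> S \<and> w - y \<in> pre J} =
         {z \<in> S. z - (x + y) \<in> pre J}"
      proof (intro subset_antisym subsetI)
        fix t assume "t \<in> {z + w | z w. z \<in> S \<and> z - x \<in> pre J \<and> w \<in> S \<and> w - y \<in> pre J}"
        then obtain z w where zw: "t = z + w" "z \<in> S" "z - x \<in> pre J" "w \<in> S" "w - y \<in> pre J" by auto
        have "t - (x + y) = (z - x) + (w - y)" using zw by simp
        then have "t - (x + y) \<in> pre J" using P(2)[OF zw(3,5)] by (metis (no_types))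
        then show "t \<in> {z \<in> S. z - (x + y) \<in> pre J}" using zw by (simp add: S_closed)
      next
        fix t assume t: "t \<in> {z \<in> S. z - (x + y) \<in> pre J}"
        have "t = (t - y) + y" "t - y \<in> S" "t - y - x \<in> pre J" "y \<in> S" "y - y \<in> pre J"
          using t xy P(1) by (auto simp: S_closed algebra_simps)
        then show "t \<in> {z + w | z w. z \<in> S \<and> z - x \<in> pre J \<and> w \<in> S \<and> w - y \<in> pre J}"
          by blast
      qed
      finally show ?thesis using xy by (simp add: ceq S_closed)
    qed
    show "?q x \<otimes>\<^bsub>quot_algebra A J\<^esub> ?q y = ?q (x * y)"
    proof -
      have *: "J +>\<^bsub>A\<^esub> (a \<otimes>\<^bsub>A\<^esub> b) = ?q (x * y)" if "a \<in> ?q x" "b \<in> ?q y" for a b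
      proof -
        obtain z w where zw: "a = \<phi> z" "z \<in> S" "z - x \<in> pre J" "b = \<phi> w" "w \<in> S" "w - y \<in> pre J"
          using \<open>a \<in> ?q x\<close> \<open>b \<in> ?q y\<close> xy by (auto simp: ceq)
        have "z * w - x * y = (z - x) * w + x * (w - y)" by (simp add: algebra_simps)
        then have "z * w - x * y \<in> pre J"
          using P(2)[OF mI(2)[of w "z - x"] mI(1)[of x "w - y"]] zw xy by simp
        then show ?thesis using zw xy cong[of "z * w" "x * y"] by (simp add: pres_mult S_closed)
      qed
      have "?q x \<otimes>\<^bsub>quot_algebra A J\<^esub> ?q y = (\<Union>a\<in>?q x. \<Union>b\<in>?q y. J +>\<^bsub>A\<^esub> (a \<otimes>\<^bsub>A\<^esub> b))"
        by (simp add: defs rcoset_mult_def)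
      also have "\<dots> = (\<Union>a\<in>?q x. \<Union>b\<in>?q y. ?q (x * y))" using * by simp
      also have "\<dots> = ?q (x * y)" using mem xy by auto
      finally show ?thesis .
    qed
    show "c \<odot>\<^bsub>quot_algebra A J\<^esub> ?q x = ?q (sc c x)" for c
    proof -
      have *: "J +>\<^bsub>A\<^esub> (c \<odot>\<^bsub>A\<^esub> a) = ?q (sc c x)" if "a \<in> ?q x" for a
      proof -
        obtain z where z: "a = \<phi> z" "z \<in> S" "z - x \<in> pre J"
          using \<open>a \<in> ?q x\<close> xy by (auto simp: ceq)
        have "sc c z - sc c x \<in> pre J" using z P(3)[of "z - x" c] by (simp add: sc_diff_right)
        then show ?thesis using z xy cong[of "sc c z" "sc c x"] by (simp add: pres_smult S_closed)
      qed
      have "c \<odot>\<^bsub>quot_algebra A J\<^esub> ?q x = (\<Union>a\<in>?q x. ?q (sc c x))" by (simp add: defs *)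
      also have "\<dots> = ?q (sc c x)" using mem xy by auto
      finally show ?thesis .
    qed
  qed
qed

lemma presentation_restrict:
  assumes "subalg T" "T \<subseteq> S"
  shows "presentation sc T (A\<lparr>carrier := \<phi> ` T\<rparr>) \<phi>"
  using assms by unfold_locales (auto simp: pres_zero pres_add pres_mult pres_smult subset_iff)

text \<open>If \<open>U\<close> left the carrier, no subspace would contain it, and the hull, an
  intersection over the empty family, would be the whole type. Under the assumption the carrier
  itself belongs to the family.\<close>

lemma lin_subspace_hull:
  assumes "U \<subseteq> carrier A"
  shows "lin_subspace A (lin_subspace A hull U)"
proof -
  let ?F = "{W. lin_subspace A W \<and> U \<subseteq> W}"
  have carrier: "carrier A \<in> ?F"
    using assms subsp_S by (auto simp: lin_subspace_iff pre_def carrier_eq intro!: subsp_S cong: conj_cong)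
  have sub: "lin_subspace A hull U \<subseteq> carrier A" unfolding hull_def using carrier by blast
  have D: "subsp (pre W)" if "W \<in> ?F" for W using that by (auto simp: lin_subspace_iff)
  have mem: "x \<in> pre (lin_subspace A hull U) \<longleftrightarrow> (\<forall>W\<in>?F. x \<in> pre W)" for x
    using carrier by (auto simp: hull_def pre_def)
  have "subsp (pre (lin_subspace A hull U))"
    unfolding subsp_def
  proof (intro conjI ballI allI)
    show "0 \<in> pre (lin_subspace A hull U)" unfolding mem using subspD(1)[OF D] by blast
    show "x + y \<in> pre (lin_subspace A hull U)"
      if "x \<in> pre (lin_subspace A hull U)" "y \<in> pre (lin_subspace A hull U)" for x y
      using that subspD(2)[OF D] unfolding mem by simp
    show "sc c x \<in> pre (lin_subspace A hull U)" if "x \<in> pre (lin_subspace A hull U)" for c x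
      using that subspD(3)[OF D] unfolding mem by simp
  qed
  then show ?thesis using sub by (simp add: lin_subspace_iff)
qed

text \<open>Induction principle for spans: a hull is bounded by treating its generators. The set
  \<open>K\<close> lives in the presenting ring, where the later estimates are made.\<close>

lemma lin_subspace_hull_image:
  assumes K: "subsp K" "K \<subseteq> S" and U: "U \<subseteq> \<phi> ` K"
  shows "lin_subspace A hull U \<subseteq> \<phi> ` K"
proof (rule hull_minimal[OF U])
  show "lin_subspace A (\<phi> ` K)"
    unfolding lin_subspace_iff subsp_def
  proof (intro conjI ballI allI)
    show "\<phi> ` K \<subseteq> carrier A" using K by (auto simp: carrier_eq)
    show "0 \<in> pre (\<phi> ` K)" using subspD(1)[OF K(1)] by (auto simp: pre_def S_closed)
    fix x assume "x \<in> pre (\<phi> ` K)"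
    then obtain a where x: "x \<in> S" "a \<in> K" "\<phi> x = \<phi> a" by (auto simp: pre_def)
    have "\<phi> (sc c x) = \<phi> (sc c a)" for c using x K(2) pres_smult[of x c] pres_smult[of a c] by auto
    then show "sc c x \<in> pre (\<phi> ` K)" for c
      using x subspD(3)[OF K(1)] by (auto simp: pre_def S_closed)
    fix y assume "y \<in> pre (\<phi> ` K)"
    then obtain b where y: "y \<in> S" "b \<in> K" "\<phi> y = \<phi> b" by (auto simp: pre_def)
    have "\<phi> (x + y) = \<phi> (a + b)" using x y K(2) pres_add[of x y] pres_add[of a b] by auto
    then show "x + y \<in> pre (\<phi> ` K)" using x y subspD(2)[OF K(1)] by (auto simp: pre_def S_closed)
  qed
qed

end

section \<open>Completions of presented algebras\<close>

lemma sum_fun_apply: "sum f D n = (\<Sum>i\<in>D. f i n)"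
  by (induction D rule: infinite_finite_induct) auto

text \<open>\<open>V_mult\<close> is continuity of the product at the pair of zeros,
  \<open>V_mult_elem\<close> its continuity at a pair with one zero entry; bilinearity then gives
  continuity everywhere.\<close>

locale filtered_presentation = presentation sc S A \<phi>
  for sc :: "'f::field \<Rightarrow> 'p::ring \<Rightarrow> 'p" and S and A :: "('f, 'a) module" and \<phi> +
  fixes V :: "nat \<Rightarrow> 'a set"
  assumes V_subspace: "lin_subspace A (V k)"
    and V_antimono: "k \<le> l \<Longrightarrow> V l \<subseteq> V k"
    and V_mult: "\<exists>l. \<forall>x\<in>pre (V l). \<forall>y\<in>pre (V l). x * y \<in> pre (V k)"
    and V_mult_elem: "a \<in> S \<Longrightarrow> \<exists>l. \<forall>x\<in>pre (V l). a * x \<in> pre (V k) \<and> x * a \<in> pre (V k)"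
begin

definition nb :: "nat \<Rightarrow> 'p set" where "nb k = pre (V k)"

text \<open>Index 0 is left out to agree with \<open>leavitt_nhds\<close>. The sets
  \<open>nb\<close> keep it: by antimonotonicity the Cauchy and null conditions at index 1 imply
  those at index 0.\<close>

definition base :: "'a set set" where "base = V ` {k. 1 \<le> k}"

lemma nb_subsp: "subsp (nb k)"
  using V_subspace by (auto simp: nb_def lin_subspace_iff pre_def)

lemmas nb_closed = subspD[OF nb_subsp]

lemma nb_antimono: "k \<le> l \<Longrightarrow> x \<in> nb l \<Longrightarrow> x \<in> nb k"
  using V_antimono by (auto simp: nb_def pre_def)

lemma nb_mult: "\<exists>l\<ge>k. \<forall>x\<in>nb l. \<forall>y\<in>nb l. x * y \<in> nb k"
proof -
  obtain l where "\<forall>x\<in>nb l. \<forall>y\<in>nb l. x * y \<in> nb k" using V_mult[of k] unfolding nb_def by blast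
  then have "\<forall>x\<in>nb (max k l). \<forall>y\<in>nb (max k l). x * y \<in> nb k"
    using nb_antimono[of l "max k l"] by auto
  then show ?thesis by (intro exI[of _ "max k l"]) auto
qed

lemma nb_mult_elem:
  assumes "a \<in> S" shows "\<exists>l\<ge>k. \<forall>x\<in>nb l. a * x \<in> nb k \<and> x * a \<in> nb k"
proof -
  obtain l where "\<forall>x\<in>nb l. a * x \<in> nb k \<and> x * a \<in> nb k"
    using V_mult_elem[OF assms, of k] unfolding nb_def by blast
  then have "\<forall>x\<in>nb (max k l). a * x \<in> nb k \<and> x * a \<in> nb k"
    using nb_antimono[of l "max k l"] by auto
  then show ?thesis by (intro exI[of _ "max k l"]) auto
qed

lemma base_all_iff: "(\<forall>U\<in>base. P U) \<longleftrightarrow> (\<forall>k\<ge>1. P (V k))"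
  by (auto simp: base_def)

abbreviation ssc :: "'f \<Rightarrow> (nat \<Rightarrow> 'p) \<Rightarrow> nat \<Rightarrow> 'p" where "ssc c x \<equiv> \<lambda>n. sc c (x n)"

sublocale seq: scaled_ring ssc
  by unfold_locales (auto simp: sc_add_left sc_add_right sc_assoc fun_eq_iff)

section \<open>Cauchy sequences and null sequences\<close>

definition small :: "nat \<Rightarrow> (nat \<Rightarrow> 'p) \<Rightarrow> bool" where
  "small k x \<longleftrightarrow> (\<forall>\<^sub>F n in sequentially. x n \<in> nb k)"

definition cauchys :: "(nat \<Rightarrow> 'p) set" where
  "cauchys = {x. (\<forall>n. x n \<in> S) \<and> (\<forall>k. \<exists>M. \<forall>m\<ge>M. \<forall>n\<ge>M. x m - x n \<in> nb k)}"

definition nulls :: "(nat \<Rightarrow> 'p) set" where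
  "nulls = {x \<in> cauchys. \<forall>k. small k x}"

lemma small_zero: "small k 0" by (simp add: small_def nb_closed)

lemma small_add: "small k x \<Longrightarrow> small k y \<Longrightarrow> small k (x + y)"
  unfolding small_def by (erule (1) eventually_elim2) (simp add: nb_closed)

lemma small_uminus: "small k x \<Longrightarrow> small k (- x)"
  unfolding small_def by (erule eventually_mono) (simp add: nb_closed)

lemma small_ssc: "small k x \<Longrightarrow> small k (ssc c x)"
  unfolding small_def by (erule eventually_mono) (simp add: nb_closed)

lemma small_antimono: "k \<le> l \<Longrightarrow> small l x \<Longrightarrow> small k x"
  unfolding small_def by (erule eventually_mono) (auto intro: nb_antimono)

lemma small_minus_commute: "small k (x - y) \<Longrightarrow> small k (y - x)"
  using small_uminus[of k "x - y"] by simp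

lemma small_trans: "small k (x - y) \<Longrightarrow> small k (y - z) \<Longrightarrow> small k (x - z)"
  using small_add[of k "x - y" "y - z"] by simp

lemma cauchys_in_S: "x \<in> cauchys \<Longrightarrow> x n \<in> S" by (simp add: cauchys_def)

lemma cauchysD: "x \<in> cauchys \<Longrightarrow> \<exists>M. \<forall>m\<ge>M. \<forall>n\<ge>M. x m - x n \<in> nb k"
  by (simp add: cauchys_def)

lemma cauchy_const: "a \<in> S \<Longrightarrow> (\<lambda>n. a) \<in> cauchys"
  by (simp add: cauchys_def nb_closed)

lemma cauchy_small_const:
  assumes "x \<in> cauchys" obtains M where "\<And>m. m \<ge> M \<Longrightarrow> small k (x - (\<lambda>n. x m))"
proof -
  obtain M where "\<forall>m\<ge>M. \<forall>n\<ge>M. x m - x n \<in> nb k" using cauchysD[OF assms] by blast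
  then show ?thesis by (intro that[of M]) (auto simp: small_def eventually_sequentially)
qed

text \<open>A Cauchy sequence is a constant plus an arbitrarily small sequence, so both factors can be
  controlled at once.\<close>

lemma cauchy_small_mult:
  assumes "a \<in> cauchys"
  shows "\<exists>l\<ge>k. \<forall>x. small l x \<longrightarrow> small k (a * x) \<and> small k (x * a)"
proof -
  obtain l1 where l1: "l1 \<ge> k" "\<forall>x\<in>nb l1. \<forall>y\<in>nb l1. x * y \<in> nb k" using nb_mult by blast
  obtain M where "\<And>m. m \<ge> M \<Longrightarrow> small l1 (a - (\<lambda>n. a m))" using cauchy_small_const[OF assms] by blast
  then have M: "\<forall>\<^sub>F n in sequentially. a n - a M \<in> nb l1" by (auto simp: small_def)
  obtain l2 where l2: "l2 \<ge> l1" "\<forall>x\<in>nb l2. a M * x \<in> nb k \<and> x * a M \<in> nb k"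
    using nb_mult_elem[OF cauchys_in_S[OF assms]] nb_antimono[OF l1(1)] by blast
  have *: "a n * y \<in> nb k \<and> y * a n \<in> nb k" if "a n - a M \<in> nb l1" "y \<in> nb l2" for n y
  proof -
    have y: "y \<in> nb l1" using that(2) nb_antimono[OF l2(1)] by blast
    have "a n * y = (a n - a M) * y + a M * y" "y * a n = y * (a n - a M) + y * a M"
      by (simp_all add: algebra_simps)
    then show ?thesis using l1(2) l2(2) y that by (auto intro!: nb_closed(2))
  qed
  have "small k (a * x) \<and> small k (x * a)" if "small l2 x" for x
    using eventually_conj[OF M that[unfolded small_def]] *
    by (auto simp: small_def elim!: eventually_mono)
  moreover have "l2 \<ge> k" using l1 l2 by simp
  ultimately show ?thesis by blast
qed

text \<open>Neighbourhoods are subgroups, so comparing all late terms with one fixed term already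
  compares them with each other. The fixed index \<open>M\<close> may lie outside the tail on which
  the comparison holds.\<close>

lemma cauchyI:
  assumes "\<And>n. x n \<in> S" "\<And>k. \<exists>M. small k (x - (\<lambda>n. x M))"
  shows "x \<in> cauchys"
  unfolding cauchys_def
proof (intro CollectI conjI allI)
  fix k
  obtain M where "small k (x - (\<lambda>n. x M))" using assms(2) by blast
  then obtain M' where M': "\<forall>n\<ge>M'. x n - x M \<in> nb k"
    by (auto simp: small_def eventually_sequentially)
  have "x m - x n \<in> nb k" if "m \<ge> M'" "n \<ge> M'" for m n
    using nb_closed(5)[OF M'[rule_format, OF that(1)] M'[rule_format, OF that(2)]] by simp
  then show "\<exists>M. \<forall>m\<ge>M. \<forall>n\<ge>M. x m - x n \<in> nb k" by blast
qed (simp add: assms)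

lemma cauchy_add: assumes "x \<in> cauchys" "y \<in> cauchys" shows "x + y \<in> cauchys"
proof (rule cauchyI)
  fix k
  obtain M where M: "\<And>m. m \<ge> M \<Longrightarrow> small k (x - (\<lambda>n. x m))" using cauchy_small_const[OF assms(1)] by blast
  obtain M' where M': "\<And>m. m \<ge> M' \<Longrightarrow> small k (y - (\<lambda>n. y m))" using cauchy_small_const[OF assms(2)] by blast
  let ?m = "max M M'"
  have "small k ((x - (\<lambda>n. x ?m)) + (y - (\<lambda>n. y ?m)))" by (intro small_add M M') auto
  also have "(x - (\<lambda>n. x ?m)) + (y - (\<lambda>n. y ?m)) = (x + y) - (\<lambda>n. (x + y) ?m)"
    by (simp add: fun_eq_iff)
  finally show "\<exists>m. small k ((x + y) - (\<lambda>n. (x + y) m))" by blast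
qed (use assms in \<open>simp add: cauchys_in_S S_closed\<close>)

lemma cauchy_ssc: assumes "x \<in> cauchys" shows "ssc c x \<in> cauchys"
proof (rule cauchyI)
  fix k
  obtain M where M: "\<And>m. m \<ge> M \<Longrightarrow> small k (x - (\<lambda>n. x m))" using cauchy_small_const[OF assms(1)] by blast
  have "small k (ssc c (x - (\<lambda>n. x M)))" by (intro small_ssc M) auto
  also have "ssc c (x - (\<lambda>n. x M)) = ssc c x - (\<lambda>n. ssc c x M)"
    by (simp add: fun_eq_iff sc_diff_right)
  finally show "\<exists>m. small k (ssc c x - (\<lambda>n. ssc c x m))" by blast
qed (use assms in \<open>simp add: cauchys_in_S S_closed\<close>)

lemma cauchy_mult: assumes "x \<in> cauchys" "y \<in> cauchys" shows "x * y \<in> cauchys"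
proof (rule cauchyI)
  fix k
  obtain l where l: "\<forall>z. small l z \<longrightarrow> small k (x * z) \<and> small k (z * x)"
    using cauchy_small_mult[OF assms(1), of k] by blast
  obtain M where M: "\<And>m. m \<ge> M \<Longrightarrow> small l (y - (\<lambda>n. y m))" using cauchy_small_const[OF assms(2)] by blast
  obtain l' where l': "\<forall>z. small l' z \<longrightarrow> small k ((\<lambda>n. y M) * z) \<and> small k (z * (\<lambda>n. y M))"
    using cauchy_small_mult[OF cauchy_const[OF cauchys_in_S[OF assms(2)]], of k M] by blast
  obtain M' where M': "\<And>m. m \<ge> M' \<Longrightarrow> small l' (x - (\<lambda>n. x m))" using cauchy_small_const[OF assms(1)] by blast
  have s1: "small k (x * y - (\<lambda>n. x n * y M))"
    using spec[OF l, of "y - (\<lambda>n. y M)"] M[of M] by (simp add: small_def right_diff_distrib)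
  have s2: "small k ((\<lambda>n. x n * y M) - (\<lambda>n. x m * y M))"
    if "m \<ge> M'" for m using spec[OF l', of "x - (\<lambda>n. x m)"] M'[OF that] by (simp add: small_def left_diff_distrib)
  \<comment> \<open>The chain x y, x y_M, x_m y_M, x_m y_m is closed by an index m that serves
    twice: it lies beyond \<open>M'\<close>, and the first comparison holds at m itself.\<close>
  have ev: "\<forall>\<^sub>F m in sequentially. x m * y m - x m * y M \<in> nb k"
    using s1 by (simp add: small_def)
  then obtain m where m: "m \<ge> M'" "x m * y m - x m * y M \<in> nb k"
    unfolding eventually_sequentially by (metis max.cobounded1 max.cobounded2)
  have s3: "small k ((\<lambda>n. x m * y M) - (\<lambda>n. x m * y m))"
    using nb_closed(4)[OF m(2)] by (simp add: small_def)
  have "small k (x * y - (\<lambda>n. (x * y) m))"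
    using small_trans[OF small_trans[OF s1 s2[OF m(1)]] s3] by simp
  then show "\<exists>m. small k (x * y - (\<lambda>n. (x * y) m))" by blast
qed (use assms in \<open>simp add: cauchys_in_S S_closed\<close>)

lemma cauchys_subsp: "seq.subsp cauchys"
  unfolding seq.subsp_def using cauchy_const[OF S_closed(1)]
  by (auto simp: cauchy_add cauchy_ssc zero_fun_def)

lemma cauchys_subalg: "seq.subalg cauchys"
  unfolding seq.subalg_def using cauchys_subsp by (simp add: cauchy_mult)

lemma nulls_ideal: "seq.ideal_in cauchys nulls"
proof -
  have "a * x \<in> nulls \<and> x * a \<in> nulls" if a: "a \<in> cauchys" and x: "x \<in> nulls" for a x
  proof -
    have "small k (a * x) \<and> small k (x * a)" for k
    proof -
      obtain l where "\<forall>z. small l z \<longrightarrow> small k (a * z) \<and> small k (z * a)"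
        using cauchy_small_mult[OF a, of k] by blast
      then show ?thesis using x by (simp add: nulls_def)
    qed
    then show ?thesis using a x by (simp add: nulls_def cauchy_mult)
  qed
  moreover have "seq.subsp nulls" unfolding seq.subsp_def
    using seq.subspD[OF cauchys_subsp] by (auto simp: nulls_def small_zero small_add small_ssc)
  ultimately show ?thesis by (auto simp: seq.ideal_in_def nulls_def)
qed

lemma nulls_subsp: "seq.subsp nulls" and nulls_sub: "nulls \<subseteq> cauchys"
  using nulls_ideal by (auto simp: seq.ideal_in_def)

lemmas cauchys_closed = seq.subspD[OF cauchys_subsp] cauchy_mult
lemmas nulls_closed = seq.subspD[OF nulls_subsp]

lemma nulls_mult: "a \<in> cauchys \<Longrightarrow> x \<in> nulls \<Longrightarrow> a * x \<in> nulls"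
  "a \<in> cauchys \<Longrightarrow> x \<in> nulls \<Longrightarrow> x * a \<in> nulls"
  using nulls_ideal by (auto simp: seq.ideal_in_def)

lemma nulls_small: "x \<in> nulls \<Longrightarrow> small k x" by (simp add: nulls_def)

lemma V_eventually_iff:
  assumes "\<And>n. x n \<in> S"
  shows "(\<forall>k\<ge>1. \<forall>\<^sub>F n in sequentially. \<phi> (x n) \<in> V k) \<longleftrightarrow> (\<forall>k. small k x)"
proof -
  have "(\<forall>\<^sub>F n in sequentially. \<phi> (x n) \<in> V k) \<longleftrightarrow> small k x" for k
    using assms by (simp add: small_def nb_def pre_def)
  moreover have "small k x" if "\<forall>k\<ge>1. small k x" for k
    using that small_antimono[of k "Suc k" x] by simp
  ultimately show ?thesis by blast
qed

section \<open>The completion as a quotient of Cauchy sequences\<close>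

definition \<psi> :: "(nat \<Rightarrow> 'p) \<Rightarrow> nat \<Rightarrow> 'a" where "\<psi> x = (\<lambda>n. \<phi> (x n))"

lemma cauchys_iff:
  assumes "\<And>n. x n \<in> S" shows "x \<in> cauchys \<longleftrightarrow> \<psi> x \<in> carrier (cauchy_algebra A base)"
proof -
  have *: "x m - x n \<in> nb k \<longleftrightarrow> \<phi> (x m) \<ominus>\<^bsub>A\<^esub> \<phi> (x n) \<in> V k" for m n k
    using assms by (simp add: pres_minus nb_def pre_def S_closed)
  have "(\<forall>k. \<exists>M. \<forall>m\<ge>M. \<forall>n\<ge>M. x m - x n \<in> nb k) \<longleftrightarrow> (\<forall>k\<ge>1. \<exists>M. \<forall>m\<ge>M. \<forall>n\<ge>M. x m - x n \<in> nb k)"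
    (is "(\<forall>k. ?C k) \<longleftrightarrow> (\<forall>k\<ge>1. ?C k)")
  proof -
    have "?C k" if "\<forall>k\<ge>1. ?C k" for k
    proof -
      have "?C (Suc k)" using that by simp
      then show ?thesis using nb_antimono[of k "Suc k"] by (meson le_SucI order_refl)
    qed
    then show ?thesis by blast
  qed
  then show ?thesis
    using assms by (simp add: cauchys_def cauchy_algebra_def \<psi>_def base_all_iff *)
qed

lemma cauchy_presentation: "presentation ssc cauchys (cauchy_algebra A base) \<psi>"
proof
  show "seq.subalg cauchys" by (rule cauchys_subalg)
  show "carrier (cauchy_algebra A base) = \<psi> ` cauchys"
  proof (intro subset_antisym subsetI)
    fix y assume y: "y \<in> carrier (cauchy_algebra A base)"
    \<comment> \<open>Representatives in \<open>S\<close> are chosen entry by entry; as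
      \<open>nb k\<close> is the preimage of \<open>V k\<close>, any such choice is again
      Cauchy.\<close>
    then have "\<forall>n. \<exists>x\<in>S. y n = \<phi> x" by (auto simp: cauchy_algebra_def carrier_eq)
    then obtain x where x: "\<And>n. x n \<in> S" "\<And>n. y n = \<phi> (x n)" by metis
    then have "y = \<psi> x" by (simp add: \<psi>_def fun_eq_iff)
    then show "y \<in> \<psi> ` cauchys" using cauchys_iff[of x] x(1) y by blast
  next
    fix y assume "y \<in> \<psi> ` cauchys"
    then show "y \<in> carrier (cauchy_algebra A base)" using cauchys_iff cauchys_in_S by blast
  qed
qed (simp_all add: cauchy_algebra_def \<psi>_def pres_zero pres_add pres_mult pres_smult cauchys_in_S fun_eq_iff)

sublocale C: presentation ssc cauchys "cauchy_algebra A base" \<psi> by (rule cauchy_presentation)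

lemma pre_null: "C.pre (null_sequences A base) = nulls"
proof -
  have "x \<in> cauchys \<Longrightarrow> \<psi> x \<in> null_sequences A base \<longleftrightarrow> (\<forall>k. small k x)" for x
    using V_eventually_iff[of x] by (simp add: null_sequences_def base_all_iff cauchys_in_S C.pres_in_carrier) (simp add: \<psi>_def)
  then show ?thesis by (auto simp: C.pre_def nulls_def)
qed

lemma null_ideal: "two_sided_ideal (cauchy_algebra A base) (null_sequences A base)"
  unfolding C.two_sided_ideal_iff pre_null using nulls_ideal by (auto simp: null_sequences_def)

definition \<Phi> :: "(nat \<Rightarrow> 'p) \<Rightarrow> (nat \<Rightarrow> 'a) set" where
  "\<Phi> x = cauchy_class A base (\<lambda>n. \<phi> (x n))"

lemma completion_presentation: "presentation ssc cauchys (completion A base) \<Phi>"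
proof -
  have "\<Phi> = (\<lambda>x. null_sequences A base +>\<^bsub>cauchy_algebra A base\<^esub> \<psi> x)"
    by (simp add: \<Phi>_def cauchy_class_def \<psi>_def fun_eq_iff)
  then show ?thesis
    using C.presentation_quot[OF null_ideal] by (simp add: completion_def)
qed

sublocale L: presentation ssc cauchys "completion A base" \<Phi> by (rule completion_presentation)

lemma \<Phi>_eq_iff: "x \<in> cauchys \<Longrightarrow> y \<in> cauchys \<Longrightarrow> \<Phi> x = \<Phi> y \<longleftrightarrow> x - y \<in> nulls"
  using C.coset_eq_iff[of "null_sequences A base" x y] null_ideal
  by (simp add: \<Phi>_def cauchy_class_def \<psi>_def pre_null two_sided_ideal_def)

lemma \<Phi>_zero_iff: "x \<in> cauchys \<Longrightarrow> \<Phi> x = \<zero>\<^bsub>completion A base\<^esub> \<longleftrightarrow> x \<in> nulls"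
  using \<Phi>_eq_iff[of x 0] by (simp add: L.pres_zero cauchys_closed)

text \<open>A set that absorbs null sequences is a union of classes and is therefore recovered from
  its image.\<close>

lemma pre_image:
  assumes "Y \<subseteq> cauchys" "\<And>x y. x \<in> cauchys \<Longrightarrow> y \<in> Y \<Longrightarrow> x - y \<in> nulls \<Longrightarrow> x \<in> Y"
  shows "L.pre (\<Phi> ` Y) = Y"
proof (intro subset_antisym subsetI)
  fix x assume "x \<in> L.pre (\<Phi> ` Y)"
  then obtain y where y: "x \<in> cauchys" "y \<in> Y" "\<Phi> x = \<Phi> y" by (auto simp: L.pre_def)
  then have "x - y \<in> nulls" using \<Phi>_eq_iff assms(1) by blast
  then show "x \<in> Y" using assms(2) y by blast
qed (use assms(1) in \<open>auto simp: L.pre_def\<close>)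

lemma completion_nhds_eq: "completion_nhds A base = (\<lambda>k. \<Phi> ` {x \<in> cauchys. small k x}) ` {k. 1 \<le> k}"
proof -
  have "cauchy_class A base ` {x \<in> carrier (cauchy_algebra A base). \<forall>\<^sub>F n in sequentially. x n \<in> V k}
     = \<Phi> ` {x \<in> cauchys. small k x}" for k
  proof -
    have "{x \<in> carrier (cauchy_algebra A base). \<forall>\<^sub>F n in sequentially. x n \<in> V k} = \<psi> ` {x \<in> cauchys. small k x}"
      unfolding C.carrier_eq by (auto simp: small_def \<psi>_def nb_def pre_def cauchys_in_S)
    then show ?thesis by (simp add: image_image \<Phi>_def \<psi>_def)
  qed
  then show ?thesis by (auto simp: completion_nhds_def base_def image_image)
qed

section \<open>The topology of the completion\<close>

definition cball :: "nat \<Rightarrow> (nat \<Rightarrow> 'p) \<Rightarrow> (nat \<Rightarrow> 'a) set set" where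
  "cball k z = \<Phi> ` {x \<in> cauchys. small k (x - z)}"

lemma completion_topology_eq:
  "completion_topology A base = topology_generated_by {cball k z | k z. 1 \<le> k \<and> z \<in> cauchys}"
proof -
  have coset: "\<Phi> ` {x \<in> cauchys. small k x} +>\<^bsub>completion A base\<^esub> \<Phi> z = cball k z" if z: "z \<in> cauchys" for k z
  proof -
    have "L.pre (\<Phi> ` {x \<in> cauchys. small k x}) = {x \<in> cauchys. small k x}"
    proof (rule pre_image)
      fix x y assume "x \<in> cauchys" "y \<in> {x \<in> cauchys. small k x}" "x - y \<in> nulls"
      then have "small k ((x - y) + y)" using nulls_small small_add by blast
      then show "x \<in> {x \<in> cauchys. small k x}" using \<open>x \<in> cauchys\<close> by simp
    qed auto
    then have "\<Phi> ` {x \<in> cauchys. small k x} +>\<^bsub>completion A base\<^esub> \<Phi> z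
       = \<Phi> ` {x \<in> cauchys. x - z \<in> {x \<in> cauchys. small k x}}"
      using L.coset_eq[of "\<Phi> ` {x \<in> cauchys. small k x}" z] z by (auto simp: L.carrier_eq)
    then show ?thesis using z by (simp add: cball_def cauchys_closed cong: conj_cong)
  qed
  have "{U +>\<^bsub>completion A base\<^esub> z | U z. U \<in> completion_nhds A base \<and> z \<in> carrier (completion A base)}
     = {cball k z | k z. 1 \<le> k \<and> z \<in> cauchys}"
  proof (intro subset_antisym subsetI)
    fix W assume "W \<in> {U +>\<^bsub>completion A base\<^esub> z | U z. U \<in> completion_nhds A base \<and> z \<in> carrier (completion A base)}"
    then obtain k z where "W = \<Phi> ` {x \<in> cauchys. small k x} +>\<^bsub>completion A base\<^esub> \<Phi> z" "1 \<le> k" "z \<in> cauchys"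
      unfolding completion_nhds_eq L.carrier_eq by blast
    then show "W \<in> {cball k z | k z. 1 \<le> k \<and> z \<in> cauchys}" using coset by blast
  next
    fix W assume "W \<in> {cball k z | k z. 1 \<le> k \<and> z \<in> cauchys}"
    then obtain k z where "W = \<Phi> ` {x \<in> cauchys. small k x} +>\<^bsub>completion A base\<^esub> \<Phi> z" "1 \<le> k" "z \<in> cauchys"
      using coset by blast
    then show "W \<in> {U +>\<^bsub>completion A base\<^esub> z | U z. U \<in> completion_nhds A base \<and> z \<in> carrier (completion A base)}"
      unfolding completion_nhds_eq L.carrier_eq by blast
  qed
  then show ?thesis by (simp add: completion_topology_def)
qed

lemma \<Phi>_in_cball_iff: "x \<in> cauchys \<Longrightarrow> \<Phi> x \<in> cball k z \<longleftrightarrow> small k (x - z)"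
proof
  assume x: "x \<in> cauchys" and "\<Phi> x \<in> cball k z"
  then obtain y where y: "y \<in> cauchys" "small k (y - z)" "x - y \<in> nulls"
    by (auto simp: cball_def \<Phi>_eq_iff)
  show "small k (x - z)" by (rule small_trans[OF nulls_small[OF y(3)] y(2)])
qed (auto simp: cball_def)

abbreviation ctop :: "(nat \<Rightarrow> 'a) set topology" where "ctop \<equiv> completion_topology A base"

text \<open>By definition the balls merely generate the topology. They form a basis because every
  point of a ball is a centre of it, and of two balls with a common centre one contains the
  other.\<close>

lemma openin_completion:
  "openin ctop U \<longleftrightarrow> U \<subseteq> carrier (completion A base) \<and>
     (\<forall>z\<in>cauchys. \<Phi> z \<in> U \<longrightarrow> (\<exists>k. \<forall>x\<in>cauchys. small k (x - z) \<longrightarrow> \<Phi> x \<in> U))"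
  (is "?L \<longleftrightarrow> ?R U")
proof
  assume ?L
  then have "generate_topology_on {cball k z | k z. 1 \<le> k \<and> z \<in> cauchys} U"
    by (simp add: completion_topology_eq openin_topology_generated_by_iff)
  then show "?R U"
  proof induction
    case (Int a b)
    have "\<exists>k. \<forall>x\<in>cauchys. small k (x - z) \<longrightarrow> \<Phi> x \<in> a \<inter> b" if z: "z \<in> cauchys" "\<Phi> z \<in> a \<inter> b" for z
    proof -
      obtain k where k: "\<forall>x\<in>cauchys. small k (x - z) \<longrightarrow> \<Phi> x \<in> a" using Int z by blast
      obtain l where l: "\<forall>x\<in>cauchys. small l (x - z) \<longrightarrow> \<Phi> x \<in> b" using Int z by blast
      show ?thesis using k l small_antimono[of k "max k l"] small_antimono[of l "max k l"]
        by (intro exI[of _ "max k l"]) auto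
    qed
    then show ?case using Int by blast
  next
    case (UN K)
    have "\<exists>k. \<forall>x\<in>cauchys. small k (x - z) \<longrightarrow> \<Phi> x \<in> \<Union>K" if z: "z \<in> cauchys" "\<Phi> z \<in> \<Union>K" for z
    proof -
      obtain a where a: "a \<in> K" "\<Phi> z \<in> a" using z by blast
      then obtain k where "\<forall>x\<in>cauchys. small k (x - z) \<longrightarrow> \<Phi> x \<in> a" using UN(2) z(1) by blast
      then show ?thesis using a(1) by blast
    qed
    then show ?case using UN by blast
  next
    case (Basis s)
    then obtain k z where s: "s = cball k z" "z \<in> cauchys" by auto
    have "\<Phi> x \<in> s" if "y \<in> cauchys" "\<Phi> y \<in> s" "x \<in> cauchys" "small k (x - y)" for x y
      using that s small_trans[of k x y z] by (simp add: \<Phi>_in_cball_iff)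
    moreover have "s \<subseteq> carrier (completion A base)"
      unfolding s(1) cball_def L.carrier_eq by blast
    ultimately show ?case by blast
  qed simp
next
  assume R: "?R U"
  define B where "B = {cball k z | k z. 1 \<le> k \<and> z \<in> cauchys \<and> cball k z \<subseteq> U}"
  have "U = \<Union>B"
  proof (intro subset_antisym subsetI)
    fix u assume u: "u \<in> U"
    obtain z where z: "z \<in> cauchys" "u = \<Phi> z"
      using subsetD[OF conjunct1[OF R] u] by (rule L.carrierE)
    obtain k where k: "\<forall>x\<in>cauchys. small k (x - z) \<longrightarrow> \<Phi> x \<in> U"
      using bspec[OF conjunct2[OF R] z(1)] z(2) u by blast
    \<comment> \<open>The generating balls have positive index, hence the passage from k to
      \<open>Suc k\<close>.\<close>
    have "cball (Suc k) z \<subseteq> U" using k small_antimono[of k "Suc k"] by (auto simp: cball_def)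
    moreover have "u \<in> cball (Suc k) z" using z by (simp add: \<Phi>_in_cball_iff small_zero)
    ultimately show "u \<in> \<Union>B" using z unfolding B_def by fastforce
  qed (auto simp: B_def)
  moreover have "openin ctop (\<Union>B)"
    by (rule openin_Union) (auto simp: B_def completion_topology_eq intro!: topology_generated_by_Basis)
  ultimately show ?L by simp
qed

lemma topspace_completion: "topspace ctop = carrier (completion A base)"
proof -
  have "openin ctop (carrier (completion A base))" by (auto simp: openin_completion)
  moreover have "topspace ctop \<subseteq> carrier (completion A base)"
    using openin_topspace[of ctop] unfolding openin_completion by blast
  ultimately show ?thesis using openin_subset by blast
qed

lemma openin_sub:
  assumes "H \<subseteq> carrier (completion A base)"
  shows "openin (subtopology ctop H) U \<longleftrightarrow> U \<subseteq> H \<and>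
     (\<forall>z\<in>cauchys. \<Phi> z \<in> U \<longrightarrow> (\<exists>k. \<forall>x\<in>cauchys. small k (x - z) \<longrightarrow> \<Phi> x \<in> H \<longrightarrow> \<Phi> x \<in> U))"
  (is "?L \<longleftrightarrow> ?R")
proof
  assume ?L
  then obtain Y where "openin ctop Y" "U = Y \<inter> H" by (auto simp: openin_subtopology)
  then show ?R by (fastforce simp: openin_completion)
next
  assume R: ?R
  define Y where "Y = \<Union>{cball k z | k z. z \<in> cauchys \<and> cball k z \<inter> H \<subseteq> U}"
  have "openin ctop Y" unfolding openin_completion
  proof (intro conjI ballI impI)
    fix z assume z: "z \<in> cauchys" "\<Phi> z \<in> Y"
    then obtain k y where y: "y \<in> cauchys" "cball k y \<inter> H \<subseteq> U" "small k (z - y)"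
      by (auto simp: Y_def \<Phi>_in_cball_iff)
    have "\<Phi> x \<in> Y" if "x \<in> cauchys" "small k (x - z)" for x
      using y that small_trans[OF that(2) y(3)] \<Phi>_in_cball_iff unfolding Y_def by blast
    then show "\<exists>k. \<forall>x\<in>cauchys. small k (x - z) \<longrightarrow> \<Phi> x \<in> Y" by blast
  qed (auto simp: Y_def cball_def)
  moreover have "U = Y \<inter> H"
  proof (intro subset_antisym subsetI IntI)
    fix u assume u: "u \<in> U"
    then show "u \<in> H" using R by blast
    then obtain z where z: "z \<in> cauchys" "u = \<Phi> z" using assms by (auto simp: L.carrier_eq)
    then obtain k where "\<forall>x\<in>cauchys. small k (x - z) \<longrightarrow> \<Phi> x \<in> H \<longrightarrow> \<Phi> x \<in> U" using R u by blast
    then have "cball k z \<inter> H \<subseteq> U" by (auto simp: cball_def)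
    moreover have "u \<in> cball k z" using z by (simp add: \<Phi>_in_cball_iff small_zero)
    ultimately show "u \<in> Y" using z by (auto simp: Y_def)
  qed (auto simp: Y_def)
  ultimately show ?L by (auto simp: openin_subtopology)
qed

text \<open>Openness of the complement, read contrapositively: smallness is symmetric, so having no
  ball outside \<open>J\<close> means being approximated by elements of \<open>J\<close> to every
  order.\<close>

lemma closedin_sub:
  assumes "H \<subseteq> carrier (completion A base)"
  shows "closedin (subtopology ctop H) J \<longleftrightarrow> J \<subseteq> H \<and>
     (\<forall>x\<in>L.pre H. (\<forall>k. \<exists>y\<in>L.pre J. small k (x - y)) \<longrightarrow> x \<in> L.pre J)"
proof -
  have ts: "topspace (subtopology ctop H) = H" using assms by (auto simp: topspace_completion)
  have "openin (subtopology ctop H) (H - J) \<longleftrightarrow>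
     (\<forall>z\<in>cauchys. \<Phi> z \<in> H - J \<longrightarrow> (\<exists>k. \<forall>x\<in>cauchys. small k (x - z) \<longrightarrow> \<Phi> x \<in> H \<longrightarrow> \<Phi> x \<in> H - J))"
    by (simp add: openin_sub[OF assms] del: Diff_iff)
  also have "\<dots> \<longleftrightarrow> (\<forall>x\<in>L.pre H. (\<forall>k. \<exists>y\<in>L.pre J. \<Phi> y \<in> H \<and> small k (x - y)) \<longrightarrow> x \<in> L.pre J)"
  proof -
    have eq: "(\<forall>x\<in>cauchys. small k (x - z) \<longrightarrow> \<Phi> x \<in> H \<longrightarrow> \<Phi> x \<in> H - J) \<longleftrightarrow>
       \<not> (\<exists>y\<in>L.pre J. \<Phi> y \<in> H \<and> small k (z - y))" for k z
      using small_minus_commute[of k _ z] small_minus_commute[of k z] by (auto simp: L.pre_def)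
    show ?thesis unfolding eq by (simp add: L.pre_def) blast
  qed
  finally have op: "openin (subtopology ctop H) (H - J) \<longleftrightarrow>
     (\<forall>x\<in>L.pre H. (\<forall>k. \<exists>y\<in>L.pre J. \<Phi> y \<in> H \<and> small k (x - y)) \<longrightarrow> x \<in> L.pre J)" .
  have "(y \<in> L.pre J \<and> \<Phi> y \<in> H \<and> P) \<longleftrightarrow> (y \<in> L.pre J \<and> P)" if "J \<subseteq> H" for y P
    using that by (auto simp: L.pre_def)
  then show ?thesis unfolding closedin_def ts op Bex_def by auto
qed

end

section \<open>Graded completions and their closed ideals\<close>

lemma continuous_map_prodI:
  assumes "\<And>x y. x \<in> topspace Z \<Longrightarrow> y \<in> topspace Z \<Longrightarrow> f (x, y) \<in> topspace Z"
    and "\<And>U x y. openin Z U \<Longrightarrow> x \<in> topspace Z \<Longrightarrow> y \<in> topspace Z \<Longrightarrow> f (x, y) \<in> U \<Longrightarrow>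
      \<exists>A B. openin Z A \<and> openin Z B \<and> x \<in> A \<and> y \<in> B \<and> (\<forall>a\<in>A. \<forall>b\<in>B. f (a, b) \<in> U)"
  shows "continuous_map (prod_topology Z Z) Z f"
  unfolding continuous_map_def
proof (intro conjI allI impI)
  show "f \<in> topspace (prod_topology Z Z) \<rightarrow> topspace Z" using assms(1) by auto
  fix U assume U: "openin Z U"
  show "openin (prod_topology Z Z) {x \<in> topspace (prod_topology Z Z). f x \<in> U}"
    unfolding openin_prod_topology_alt
  proof (intro allI impI)
    fix x y assume "(x, y) \<in> {x \<in> topspace (prod_topology Z Z). f x \<in> U}"
    then obtain A B where AB: "openin Z A" "openin Z B" "x \<in> A" "y \<in> B" "\<forall>a\<in>A. \<forall>b\<in>B. f (a, b) \<in> U"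
      using assms(2)[OF U, of x y] by auto
    have "A \<times> B \<subseteq> {x \<in> topspace (prod_topology Z Z). f x \<in> U}"
      using AB openin_subset[of Z] by (auto; blast)
    then show "\<exists>A B. openin Z A \<and> openin Z B \<and> x \<in> A \<and> y \<in> B \<and>
        A \<times> B \<subseteq> {x \<in> topspace (prod_topology Z Z). f x \<in> U}"
      using AB by blast
  qed
qed

context filtered_presentation
begin

text \<open>\<open>D\<close> is not assumed to absorb null sequences, so a point of the image may
  also be represented outside \<open>D\<close>. Representatives are exchanged at the cost of a null
  sequence, which is \<open>small k\<close> for every k.\<close>

lemma openin_ball:
  assumes "D \<subseteq> cauchys" "z \<in> cauchys"
  shows "openin (subtopology ctop (\<Phi> ` D)) (\<Phi> ` {x \<in> D. small k (x - z)})"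
proof -
  have H: "\<Phi> ` D \<subseteq> carrier (completion A base)" using assms(1) by (auto simp: L.carrier_eq)
  show ?thesis unfolding openin_sub[OF H]
  proof (intro conjI ballI impI)
    fix y assume y: "y \<in> cauchys" "\<Phi> y \<in> \<Phi> ` {x \<in> D. small k (x - z)}"
    then obtain x where x: "x \<in> D" "small k (x - z)" "\<Phi> y = \<Phi> x" by blast
    then have "y - x \<in> nulls" using \<Phi>_eq_iff y(1) assms(1) by blast
    then have yz: "small k (y - z)" using small_trans x(2) nulls_small by blast
    have "\<Phi> u \<in> \<Phi> ` {x \<in> D. small k (x - z)}"
      if u: "u \<in> cauchys" "small k (u - y)" "\<Phi> u \<in> \<Phi> ` D" for u
    proof -
      obtain v where v: "v \<in> D" "\<Phi> u = \<Phi> v" using u(3) by blast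
      then have "v - u \<in> nulls" using \<Phi>_eq_iff u(1) assms(1) by (metis subsetD)
      then have "small k (v - z)"
        using small_trans[OF small_trans[OF nulls_small u(2)] yz] by blast
      then show ?thesis using v by auto
    qed
    then show "\<exists>l. \<forall>x\<in>cauchys. small l (x - y) \<longrightarrow> \<Phi> x \<in> \<Phi> ` D \<longrightarrow> \<Phi> x \<in> \<Phi> ` {x \<in> D. small k (x - z)}"
      by blast
  qed auto
qed

lemma topological_algebra_sub:
  assumes D: "seq.subalg D" "D \<subseteq> cauchys"
  shows "topological_algebra ((completion A base)\<lparr>carrier := \<Phi> ` D\<rparr>) (subtopology ctop (\<Phi> ` D))"
proof -
  let ?A = "(completion A base)\<lparr>carrier := \<Phi> ` D\<rparr>"
  let ?ctop = "subtopology ctop (\<Phi> ` D)"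
  interpret D: presentation ssc D ?A \<Phi> by (rule L.presentation_restrict[OF D])
  have H: "\<Phi> ` D \<subseteq> carrier (completion A base)" using D(2) by (auto simp: L.carrier_eq)
  have tsD: "topspace ctop \<inter> \<Phi> ` D = \<Phi> ` D" using H by (auto simp: topspace_completion)
  then have ts: "topspace ?ctop = \<Phi> ` D" by simp
  have ball: "\<Phi> x \<in> \<Phi> ` {y \<in> D. small k (y - x)}" if "x \<in> D" for x k
    using that by (simp add: small_zero)
  have nbh: "\<exists>k. \<forall>y\<in>D. small k (y - x) \<longrightarrow> \<Phi> y \<in> U" if U: "openin ?ctop U" and xD: "x \<in> D" and xU: "\<Phi> x \<in> U" for U x
  proof -
    have "x \<in> cauchys" using xD D(2) by blast
    then obtain k where "\<forall>y\<in>cauchys. small k (y - x) \<longrightarrow> \<Phi> y \<in> \<Phi> ` D \<longrightarrow> \<Phi> y \<in> U"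
      using U xU unfolding openin_sub[OF H] by blast
    then show ?thesis using D(2) by blast
  qed
  show ?thesis unfolding topological_algebra_def
  proof (intro conjI allI)
    show "assoc_algebra ?A" by (rule D.pres_assoc_algebra)
    show "topspace ?ctop = carrier ?A" by (simp add: tsD)
    show "continuous_map (prod_topology ?ctop ?ctop) ?ctop (\<lambda>(x, y). x \<oplus>\<^bsub>?A\<^esub> y)"
    proof (rule continuous_map_prodI)
      fix U x y assume U: "openin ?ctop U" and xT: "x \<in> topspace ?ctop" and yT: "y \<in> topspace ?ctop"
        and xyU: "(\<lambda>(x, y). x \<oplus>\<^bsub>?A\<^esub> y) (x, y) \<in> U"
      obtain a b where ab: "a \<in> D" "x = \<Phi> a" "b \<in> D" "y = \<Phi> b" using xT yT unfolding ts by blast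
      have "\<Phi> (a + b) \<in> U" using xyU ab(2,4) D.pres_add[OF ab(1,3)] by simp
      then obtain k where k: "\<forall>z\<in>D. small k (z - (a + b)) \<longrightarrow> \<Phi> z \<in> U"
        using nbh[OF U D.S_closed(2)[OF ab(1,3)]] by blast
      have "\<Phi> a' \<oplus>\<^bsub>?A\<^esub> \<Phi> b' \<in> U" if "a' \<in> D" "b' \<in> D" "small k (a' - a)" "small k (b' - b)" for a' b'
      proof -
        have "small k ((a' + b') - (a + b))" using small_add[OF that(3,4)] by (simp add: algebra_simps)
        then have "\<Phi> (a' + b') \<in> U" using k D.S_closed(2)[OF that(1,2)] by blast
        then show ?thesis unfolding D.pres_add[OF that(1,2)] .
      qed
      then have in_U: "\<forall>u\<in>\<Phi> ` {z \<in> D. small k (z - a)}. \<forall>v\<in>\<Phi> ` {z \<in> D. small k (z - b)}. u \<oplus>\<^bsub>?A\<^esub> v \<in> U"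
        by blast
      have op: "openin ?ctop (\<Phi> ` {z \<in> D. small k (z - c)})" if "c \<in> D" for c
        using openin_ball[OF D(2), of c k] that D(2) by blast
      show "\<exists>A B. openin ?ctop A \<and> openin ?ctop B \<and> x \<in> A \<and> y \<in> B \<and>
          (\<forall>a\<in>A. \<forall>b\<in>B. (\<lambda>(x, y). x \<oplus>\<^bsub>?A\<^esub> y) (a, b) \<in> U)"
        unfolding prod.case ab(2,4)
        by (intro exI conjI) (rule op[OF ab(1)], rule op[OF ab(3)], rule ball[OF ab(1)], rule ball[OF ab(3)], rule in_U)
    qed (auto simp: tsD D.pres_add[simplified] D.S_closed)
    show "continuous_map (prod_topology ?ctop ?ctop) ?ctop (\<lambda>(x, y). x \<otimes>\<^bsub>?A\<^esub> y)"
    proof (rule continuous_map_prodI)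
      fix U x y assume U: "openin ?ctop U" and xT: "x \<in> topspace ?ctop" and yT: "y \<in> topspace ?ctop"
        and xyU: "(\<lambda>(x, y). x \<otimes>\<^bsub>?A\<^esub> y) (x, y) \<in> U"
      obtain a b where ab: "a \<in> D" "x = \<Phi> a" "b \<in> D" "y = \<Phi> b" using xT yT unfolding ts by blast
      have "\<Phi> (a * b) \<in> U" using xyU ab(2,4) D.pres_mult[OF ab(1,3)] by simp
      then obtain k where k: "\<forall>z\<in>D. small k (z - (a * b)) \<longrightarrow> \<Phi> z \<in> U"
        using nbh[OF U D.S_closed(6)[OF ab(1,3)]] by blast
      have abc: "a \<in> cauchys" "b \<in> cauchys" using ab D(2) by auto
      \<comment> \<open>The three bounds serve the summands of \<open>a' * b' - a * b = (a' - a) *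
        (b' - b) + (a' - a) * b + a * (b' - b)\<close>: \<open>l3\<close> for the first,
        \<open>l2\<close> for the second and \<open>l1\<close> for the last.\<close>
      obtain l1 where l1: "\<forall>x. small l1 x \<longrightarrow> small k (a * x) \<and> small k (x * a)"
        using cauchy_small_mult[OF abc(1), of k] by blast
      obtain l2 where l2: "\<forall>x. small l2 x \<longrightarrow> small k (b * x) \<and> small k (x * b)"
        using cauchy_small_mult[OF abc(2), of k] by blast
      obtain l3 where l3: "\<forall>x\<in>nb l3. \<forall>y\<in>nb l3. x * y \<in> nb k" using nb_mult[of k] by blast
      define l where "l = max l1 (max l2 l3)"
      have "\<Phi> a' \<otimes>\<^bsub>?A\<^esub> \<Phi> b' \<in> U" if "a' \<in> D" "b' \<in> D" "small l (a' - a)" "small l (b' - b)" for a' b'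
      proof -
        have s: "small l1 (b' - b)" "small l2 (a' - a)" "small l3 (a' - a)" "small l3 (b' - b)"
          using that small_antimono[of _ l] by (auto simp: l_def)
        have "small k ((a' - a) * (b' - b))"
          using eventually_conj[OF s(3)[unfolded small_def] s(4)[unfolded small_def]] l3
          unfolding small_def by (auto elim!: eventually_mono)
        then have "small k ((a' - a) * (b' - b) + ((a' - a) * b + a * (b' - b)))"
          using l1 l2 s small_add by blast
        also have "(a' - a) * (b' - b) + ((a' - a) * b + a * (b' - b)) = a' * b' - a * b"
          by (simp add: algebra_simps)
        finally have "\<Phi> (a' * b') \<in> U" using k D.S_closed(6)[OF that(1,2)] by blast
        then show ?thesis unfolding D.pres_mult[OF that(1,2)] .
      qed
      then have in_U: "\<forall>u\<in>\<Phi> ` {z \<in> D. small l (z - a)}. \<forall>v\<in>\<Phi> ` {z \<in> D. small l (z - b)}. u \<otimes>\<^bsub>?A\<^esub> v \<in> U"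
        by blast
      have op: "openin ?ctop (\<Phi> ` {z \<in> D. small l (z - c)})" if "c \<in> D" for c
        using openin_ball[OF D(2), of c l] that D(2) by blast
      show "\<exists>A B. openin ?ctop A \<and> openin ?ctop B \<and> x \<in> A \<and> y \<in> B \<and>
          (\<forall>a\<in>A. \<forall>b\<in>B. (\<lambda>(x, y). x \<otimes>\<^bsub>?A\<^esub> y) (a, b) \<in> U)"
        unfolding prod.case ab(2,4)
        by (intro exI conjI) (rule op[OF ab(1)], rule op[OF ab(3)], rule ball[OF ab(1)], rule ball[OF ab(3)], rule in_U)
    qed (auto simp: tsD D.pres_mult[simplified] D.S_closed)
    fix c
    show "continuous_map ?ctop ?ctop (\<lambda>x. c \<odot>\<^bsub>?A\<^esub> x)"
      unfolding continuous_map_def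
    proof (intro conjI allI impI)
      show "(\<lambda>x. c \<odot>\<^bsub>?A\<^esub> x) \<in> topspace ?ctop \<rightarrow> topspace ?ctop"
        by (auto simp: tsD D.pres_smult[simplified] D.S_closed)
      fix U assume U: "openin ?ctop U"
      have "\<exists>k. \<forall>x\<in>cauchys. small k (x - z) \<longrightarrow> \<Phi> x \<in> \<Phi> ` D \<longrightarrow> \<Phi> x \<in> {x \<in> topspace ?ctop. c \<odot>\<^bsub>?A\<^esub> x \<in> U}"
        if z: "z \<in> cauchys" "\<Phi> z \<in> {x \<in> topspace ?ctop. c \<odot>\<^bsub>?A\<^esub> x \<in> U}" for z
      proof -
        obtain d where d: "d \<in> D" "\<Phi> z = \<Phi> d" using z unfolding ts by blast
        then have zd: "z - d \<in> nulls" using \<Phi>_eq_iff z(1) D(2) by blast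
        have "\<Phi> (ssc c d) \<in> U" using z d D.pres_smult[of d c] by simp
        then obtain k where k: "\<forall>y\<in>D. small k (y - ssc c d) \<longrightarrow> \<Phi> y \<in> U"
          using nbh[OF U D.S_closed(3)[OF d(1)]] by blast
        have "\<Phi> x \<in> {x \<in> topspace ?ctop. c \<odot>\<^bsub>?A\<^esub> x \<in> U}"
          if x: "x \<in> cauchys" "small k (x - z)" "\<Phi> x \<in> \<Phi> ` D" for x
        proof -
          obtain e where e: "e \<in> D" "\<Phi> x = \<Phi> e" using x(3) by blast
          then have "e - x \<in> nulls" using \<Phi>_eq_iff x(1) D(2) by (metis subsetD)
          then have "small k (e - d)"
            using small_trans[OF small_trans[OF nulls_small x(2)] nulls_small[OF zd]] by blast
          then have "small k (ssc c e - ssc c d)"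
            using small_ssc[of k "e - d" c] seq.sc_diff_right[of c e d] by simp
          then have "\<Phi> (ssc c e) \<in> U" using k D.S_closed(3)[OF e(1)] by blast
          then show ?thesis using e ts D.pres_smult[OF e(1)] by simp
        qed
        then show ?thesis by blast
      qed
      then show "openin ?ctop {x \<in> topspace ?ctop. c \<odot>\<^bsub>?A\<^esub> x \<in> U}"
        unfolding openin_sub[OF H] using ts by blast
    qed
  qed
qed

end

text \<open>The projections \<open>\<pi> i\<close> encode a grading of the presenting ring. In the
  two product rules only one factor has to be homogeneous, so projections pass through products with
  arbitrary elements. \<open>\<pi>_V\<close> says that the neighbourhoods are graded, which makes
  the projections extend to the completion.\<close>

locale graded_presentation = filtered_presentation sc S A \<phi> V
  for sc :: "'f::field \<Rightarrow> 'p::ring \<Rightarrow> 'p" and S and A :: "('f, 'a) module" and \<phi> V +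
  fixes \<pi> :: "int \<Rightarrow> 'p \<Rightarrow> 'p"
  assumes \<pi>_add: "\<pi> i (x + y) = \<pi> i x + \<pi> i y"
    and \<pi>_sc: "\<pi> i (sc c x) = sc c (\<pi> i x)"
    and \<pi>_in_S: "x \<in> S \<Longrightarrow> \<pi> i x \<in> S"
    and \<pi>_\<pi>: "\<pi> i (\<pi> j x) = (if i = j then \<pi> i x else 0)"
    and \<pi>_sum: "\<exists>D. finite D \<and> x = (\<Sum>i\<in>D. \<pi> i x)"
    and \<pi>_mult_left: "\<pi> i (\<pi> j a * x) = \<pi> j a * \<pi> (i - j) x"
    and \<pi>_mult_right: "\<pi> i (x * \<pi> j a) = \<pi> (i - j) x * \<pi> j a"
    and \<pi>_V: "x \<in> pre (V k) \<Longrightarrow> \<pi> i x \<in> pre (V k)"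
begin

section \<open>Homogeneous parts of Cauchy sequences\<close>

definition hpart :: "int \<Rightarrow> (nat \<Rightarrow> 'p) \<Rightarrow> nat \<Rightarrow> 'p" where "hpart i x = (\<lambda>n. \<pi> i (x n))"

lemma \<pi>_diff: "\<pi> i (x - y) = \<pi> i x - \<pi> i y"
  using \<pi>_add[of i "x - y" y] by simp

lemma hpart_add: "hpart i (x + y) = hpart i x + hpart i y" by (simp add: hpart_def \<pi>_add fun_eq_iff)
lemma hpart_diff: "hpart i (x - y) = hpart i x - hpart i y" by (simp add: hpart_def \<pi>_diff fun_eq_iff)
lemma hpart_ssc: "hpart i (ssc c x) = ssc c (hpart i x)" by (simp add: hpart_def \<pi>_sc fun_eq_iff)
lemma hpart_P: "hpart i (hpart j x) = (if i = j then hpart i x else 0)" by (simp add: hpart_def \<pi>_\<pi> fun_eq_iff)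
lemma hpart_zero: "hpart i 0 = 0" using hpart_add[of i 0 0] by simp
lemma hpart_sum: "hpart i (sum f D) = (\<Sum>d\<in>D. hpart i (f d))"
proof (induction D rule: infinite_finite_induct)
  case (insert d D)
  show ?case unfolding sum.insert[OF insert(1,2)] hpart_add insert(3) ..
next
  case (infinite D)
  show ?case unfolding sum.infinite[OF infinite] by (rule hpart_zero)
next
  case empty
  show ?case unfolding sum.empty by (rule hpart_zero)
qed
lemma hpart_mult_left: "hpart i (hpart j a * x) = hpart j a * hpart (i - j) x" by (simp add: hpart_def \<pi>_mult_left fun_eq_iff)
lemma hpart_mult_right: "hpart i (x * hpart j a) = hpart (i - j) x * hpart j a" by (simp add: hpart_def \<pi>_mult_right fun_eq_iff)

lemma \<pi>_nb: "x \<in> nb k \<Longrightarrow> \<pi> i x \<in> nb k" by (simp add: nb_def \<pi>_V)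

lemma hpart_small: "small k x \<Longrightarrow> small k (hpart i x)"
  unfolding small_def hpart_def by (erule eventually_mono) (rule \<pi>_nb)

lemma hpart_cauchys: "x \<in> cauchys \<Longrightarrow> hpart i x \<in> cauchys"
  unfolding cauchys_def hpart_def using \<pi>_nb[of _ _ i] \<pi>_in_S by (simp add: \<pi>_diff[symmetric]) meson

lemma hpart_nulls: "x \<in> nulls \<Longrightarrow> hpart i x \<in> nulls"
  by (simp add: nulls_def hpart_small hpart_cauchys)

definition homs :: "int \<Rightarrow> (nat \<Rightarrow> 'p) set" where "homs i = {x \<in> cauchys. hpart i x = x}"

lemma hpart_homs: "x \<in> cauchys \<Longrightarrow> hpart i x \<in> homs i"
  by (simp add: homs_def hpart_cauchys hpart_P)

lemma homs_cauchys: "x \<in> homs i \<Longrightarrow> x \<in> cauchys" by (simp add: homs_def)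

lemma homs_hpart: "x \<in> homs i \<Longrightarrow> hpart j x = (if i = j then x else 0)"
  using hpart_P[of j i x] by (auto simp: homs_def)

lemma homs_mult: "x \<in> homs i \<Longrightarrow> y \<in> homs j \<Longrightarrow> x * y \<in> homs (i + j)"
  using hpart_mult_left[of "i + j" i x y] by (simp add: homs_def cauchy_mult)

definition component :: "int \<Rightarrow> 'a set" where "component i = \<phi> ` {x \<in> S. \<pi> i x = x}"

definition comp :: "int \<Rightarrow> (nat \<Rightarrow> 'a) set set" where
  "comp i = ctop closure_of (completion_embed A base ` component i)"

text \<open>Projection to degree i is continuous and fixes the component, hence it fixes the closure
  up to null sequences. Conversely, the entries of a sequence in \<open>homs i\<close> are
  themselves homogeneous and approximate its class.\<close>

lemma comp_eq: "comp i = \<Phi> ` homs i"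
proof -
  have emb: "completion_embed A base (\<phi> a) = \<Phi> (\<lambda>n. a)" for a
    by (simp add: completion_embed_def \<Phi>_def)
  have cl: "\<Phi> x \<in> comp i \<longleftrightarrow> (\<forall>k. \<exists>a\<in>S. \<pi> i a = a \<and> small k ((\<lambda>n. a) - x))" (is "?L \<longleftrightarrow> ?R")
    if x: "x \<in> cauchys" for x
  proof
    assume ?L
    show ?R
    proof
      fix k
      have "openin ctop (cball k x)" using openin_ball[OF order_refl x, of k] x
        by (metis L.carrier_eq cball_def subtopology_topspace topspace_completion)
      moreover have "\<Phi> x \<in> cball k x" using x by (simp add: \<Phi>_in_cball_iff small_zero)
      ultimately obtain y where "y \<in> completion_embed A base ` component i" "y \<in> cball k x"
        using \<open>?L\<close> unfolding comp_def in_closure_of by blast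
      then obtain a where "a \<in> S" "\<pi> i a = a" "\<Phi> (\<lambda>n. a) \<in> cball k x"
        by (auto simp: component_def emb)
      then show "\<exists>a\<in>S. \<pi> i a = a \<and> small k ((\<lambda>n. a) - x)"
        using \<Phi>_in_cball_iff cauchy_const by blast
    qed
  next
    assume R: ?R
    show ?L unfolding comp_def in_closure_of
    proof (intro conjI allI impI)
      show "\<Phi> x \<in> topspace ctop" using x by (simp add: topspace_completion)
      fix U assume U: "\<Phi> x \<in> U \<and> openin ctop U"
      then obtain k where k: "\<forall>y\<in>cauchys. small k (y - x) \<longrightarrow> \<Phi> y \<in> U"
        unfolding openin_completion using x by blast
      obtain a where a: "a \<in> S" "\<pi> i a = a" "small k ((\<lambda>n. a) - x)" using R by blast
      then have "\<Phi> (\<lambda>n. a) \<in> U" using k cauchy_const by blast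
      then show "\<exists>y. y \<in> completion_embed A base ` component i \<and> y \<in> U"
        using a unfolding component_def by (metis (mono_tags, lifting) emb image_eqI mem_Collect_eq)
    qed
  qed
  have sub: "comp i \<subseteq> \<Phi> ` cauchys"
    using closure_of_subset_topspace[of ctop] by (auto simp: comp_def topspace_completion L.carrier_eq)
  show ?thesis
  proof (intro subset_antisym subsetI)
    fix y assume y: "y \<in> comp i"
    then obtain x where x: "x \<in> cauchys" "y = \<Phi> x" using sub by blast
    have "small k (x - hpart i x)" for k
    proof -
      obtain a where a: "a \<in> S" "\<pi> i a = a" "small k ((\<lambda>n. a) - x)" using cl[OF x(1)] y x(2) by blast
      have "hpart i (\<lambda>n. a) = (\<lambda>n. a)" using a by (simp add: hpart_def)
      then have "small k ((\<lambda>n. a) - hpart i x)" using hpart_small[OF a(3), of i] by (simp add: hpart_diff)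
      then show ?thesis using small_trans[OF small_minus_commute[OF a(3)]] by blast
    qed
    then have "x - hpart i x \<in> nulls" using x by (simp add: nulls_def cauchys_closed hpart_cauchys)
    then have "y = \<Phi> (hpart i x)" using x \<Phi>_eq_iff hpart_cauchys by blast
    then show "y \<in> \<Phi> ` homs i" using hpart_homs[OF x(1)] by blast
  next
    fix y assume "y \<in> \<Phi> ` homs i"
    then obtain x where x: "x \<in> cauchys" "hpart i x = x" "y = \<Phi> x" by (auto simp: homs_def)
    have "\<exists>a\<in>S. \<pi> i a = a \<and> small k ((\<lambda>n. a) - x)" for k
    proof -
      obtain M where "small k (x - (\<lambda>n. x M))" using cauchy_small_const[OF x(1)] by blast
      then have "small k ((\<lambda>n. x M) - x)" by (rule small_minus_commute)
      moreover have "\<pi> i (x M) = x M" using x(2) by (metis hpart_def)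
      ultimately show ?thesis using cauchys_in_S[OF x(1)] by blast
    qed
    then show "y \<in> comp i" using cl x by blast
  qed
qed

section \<open>The sum of the closed components\<close>

definition hats :: "(nat \<Rightarrow> 'p) set" where
  "hats = {x \<in> cauchys. \<exists>D. finite D \<and> x - (\<Sum>i\<in>D. hpart i x) \<in> nulls}"

lemma hats_cauchys: "x \<in> hats \<Longrightarrow> x \<in> cauchys" by (simp add: hats_def)

lemma hats_sub: "hats \<subseteq> cauchys" by (auto simp: hats_def)

text \<open>\<open>hats\<close> is defined through the projections of \<open>x\<close>. Any other
  homogeneous decomposition modulo null sequences agrees with that one: applying
  \<open>hpart i\<close> to the null sequence \<open>x - sum g D\<close> compares the two parts of
  degree i.\<close>

lemma hatsI:
  assumes "x \<in> cauchys" "finite D" "\<And>i. i \<in> D \<Longrightarrow> g i \<in> homs i" "x - sum g D \<in> nulls"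
  shows "x \<in> hats"
proof -
  have g: "hpart i (sum g D) = (if i \<in> D then g i else 0)" for i
  proof -
    have "hpart i (sum g D) = (\<Sum>j\<in>D. if j = i then g i else 0)"
      unfolding hpart_sum by (rule sum.cong) (auto simp: homs_hpart[OF assms(3)])
    then show ?thesis using assms(2) by simp
  qed
  have "(\<Sum>i\<in>D. hpart i x) - sum g D = (\<Sum>i\<in>D. hpart i (x - sum g D))"
    by (simp add: hpart_diff g sum_subtractf)
  moreover have "(\<Sum>i\<in>D. hpart i (x - sum g D)) \<in> nulls"
    by (rule seq.subsp_sum[OF nulls_subsp]) (rule hpart_nulls[OF assms(4)])
  ultimately have "(x - sum g D) - ((\<Sum>i\<in>D. hpart i x) - sum g D) \<in> nulls"
    using nulls_closed(5)[OF assms(4)] by metis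
  then show ?thesis using assms(1,2) by (auto simp: hats_def)
qed

lemma nulls_hats: "x \<in> nulls \<Longrightarrow> x \<in> hats"
  using nulls_sub by (auto simp: hats_def intro!: exI[of _ "{}"])

lemma homs_hats: "x \<in> homs i \<Longrightarrow> x \<in> hats"
  by (rule hatsI[of x "{i}" "\<lambda>_. x"]) (auto simp: homs_cauchys nulls_closed)

lemma hats_parts_mono:
  assumes "x \<in> cauchys" "finite D" "x - (\<Sum>i\<in>D. hpart i x) \<in> nulls" "i \<notin> D"
  shows "hpart i x \<in> nulls"
proof -
  have "hpart i (\<Sum>j\<in>D. hpart j x) = 0" unfolding hpart_sum using assms(4)
    by (intro sum.neutral) (auto simp: hpart_P)
  then show ?thesis using hpart_nulls[OF assms(3), of i] by (simp add: hpart_diff)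
qed

lemma hats_subsp: "seq.subsp hats"
  unfolding seq.subsp_def
proof (intro conjI ballI allI)
  show "0 \<in> hats" by (simp add: nulls_hats nulls_closed)
  fix x assume x: "x \<in> hats"
  then obtain D where D: "finite D" "x - (\<Sum>i\<in>D. hpart i x) \<in> nulls" by (auto simp: hats_def)
  show "ssc c x \<in> hats" for c
  proof (rule hatsI[of _ D "\<lambda>i. hpart i (ssc c x)"])
    have "ssc c x - (\<Sum>i\<in>D. hpart i (ssc c x)) = ssc c (x - (\<Sum>i\<in>D. hpart i x))"
      unfolding seq.sc_diff_right seq.sc_sum_right hpart_ssc ..
    then show "ssc c x - (\<Sum>i\<in>D. hpart i (ssc c x)) \<in> nulls" using nulls_closed(3)[OF D(2)] by metis
  qed (use x D in \<open>auto intro: hpart_homs cauchys_closed hats_cauchys\<close>)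
  fix y assume y: "y \<in> hats"
  then obtain E where E: "finite E" "y - (\<Sum>i\<in>E. hpart i y) \<in> nulls" by (auto simp: hats_def)
  \<comment> \<open>Both supports are enlarged to their union, which is harmless because the parts
    outside a support are null.\<close>
  have ext: "z - (\<Sum>i\<in>D\<union>E. hpart i z) \<in> nulls" if "z \<in> cauchys" "F \<subseteq> D \<union> E" "z - (\<Sum>i\<in>F. hpart i z) \<in> nulls" for z F
  proof -
    have F: "finite F" using that(2) D(1) E(1) by (meson finite_UnI finite_subset)
    have n: "(\<Sum>i\<in>D\<union>E-F. hpart i z) \<in> nulls"
      by (rule seq.subsp_sum[OF nulls_subsp]) (use hats_parts_mono[OF that(1) F that(3)] in auto)
    have "(\<Sum>i\<in>D\<union>E. hpart i z) = (\<Sum>i\<in>D\<union>E-F. hpart i z) + (\<Sum>i\<in>F. hpart i z)"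
      using sum.subset_diff[OF that(2)] D(1) E(1) by simp
    then have "z - (\<Sum>i\<in>D\<union>E. hpart i z) = (z - (\<Sum>i\<in>F. hpart i z)) - (\<Sum>i\<in>D\<union>E-F. hpart i z)"
      by (metis diff_diff_eq add.commute)
    then show ?thesis using nulls_closed(5)[OF that(3) n] by metis
  qed
  have "(x - (\<Sum>i\<in>D\<union>E. hpart i x)) + (y - (\<Sum>i\<in>D\<union>E. hpart i y)) \<in> nulls"
    using ext[OF hats_cauchys[OF x] _ D(2)] ext[OF hats_cauchys[OF y] _ E(2)] nulls_closed(2) by blast
  moreover have "(x - (\<Sum>i\<in>D\<union>E. hpart i x)) + (y - (\<Sum>i\<in>D\<union>E. hpart i y)) = (x + y) - (\<Sum>i\<in>D\<union>E. hpart i (x + y))"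
    by (simp add: hpart_add sum.distrib)
  ultimately have "(x + y) - (\<Sum>i\<in>D\<union>E. hpart i (x + y)) \<in> nulls" by metis
  then show "x + y \<in> hats"
    using cauchys_closed(2)[OF x[THEN hats_cauchys] y[THEN hats_cauchys]] D(1) E(1) unfolding hats_def by blast
qed

lemma hats_mult: assumes "x \<in> hats" "y \<in> hats" shows "x * y \<in> hats"
proof -
  note c = assms[THEN hats_cauchys]
  obtain D where D: "finite D" "x - (\<Sum>i\<in>D. hpart i x) \<in> nulls" using assms(1) by (auto simp: hats_def)
  obtain E where E: "finite E" "y - (\<Sum>i\<in>E. hpart i y) \<in> nulls" using assms(2) by (auto simp: hats_def)
  have cD: "(\<Sum>i\<in>D. hpart i x) \<in> cauchys" by (rule seq.subsp_sum[OF cauchys_subsp]) (simp add: c hpart_cauchys)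
  have eq: "x * y = (x - (\<Sum>i\<in>D. hpart i x)) * y + (\<Sum>i\<in>D. hpart i x) * (y - (\<Sum>i\<in>E. hpart i y))
      + (\<Sum>i\<in>D. hpart i x) * (\<Sum>i\<in>E. hpart i y)" by (simp add: algebra_simps)
  have "(\<Sum>i\<in>D. hpart i x) * (\<Sum>i\<in>E. hpart i y) \<in> hats"
    unfolding sum_product by (intro seq.subsp_sum[OF hats_subsp] homs_hats[OF homs_mult[OF hpart_homs hpart_homs]] c)
  moreover have "(x - (\<Sum>i\<in>D. hpart i x)) * y \<in> hats" using nulls_mult(2)[OF c(2) D(2)] by (rule nulls_hats)
  moreover have "(\<Sum>i\<in>D. hpart i x) * (y - (\<Sum>i\<in>E. hpart i y)) \<in> hats"
    using nulls_mult(1)[OF cD E(2)] by (rule nulls_hats)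
  ultimately show ?thesis unfolding eq using seq.subspD(2)[OF hats_subsp] by blast
qed

lemma hats_subalg: "seq.subalg hats" by (simp add: seq.subalg_def hats_subsp hats_mult)

lemmas hats_closed = seq.subspD[OF hats_subsp] hats_mult

lemma const_hats: assumes "a \<in> S" shows "(\<lambda>n. a) \<in> hats"
proof -
  obtain D where D: "finite D" "a = (\<Sum>i\<in>D. \<pi> i a)" using \<pi>_sum by blast
  show ?thesis
  proof (rule hatsI[of _ D "\<lambda>i. hpart i (\<lambda>n. a)"])
    have "(\<lambda>n. a) - (\<Sum>i\<in>D. hpart i (\<lambda>n. a)) = 0" using D(2) by (simp add: fun_eq_iff hpart_def sum_fun_apply)
    then show "(\<lambda>n. a) - (\<Sum>i\<in>D. hpart i (\<lambda>n. a)) \<in> nulls" by (simp add: nulls_closed)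
  qed (use assms D in \<open>auto intro: hpart_homs cauchy_const\<close>)
qed

text \<open>Applying \<open>hpart i\<close> to a decomposition isolates its term of degree i.
  Algebra and carrier are left variable because the lemma serves both the completion and the ideal
  generated by \<open>W\<close>.\<close>

lemma homogeneous_parts_unique:
  assumes pr: "presentation ssc D A' \<Phi>" and D: "D \<subseteq> cauchys" and x: "x \<in> D"
    and C: "\<And>i. C i \<subseteq> \<Phi> ` (D \<inter> homs i)" and f: "homogeneous_parts A' C (\<Phi> x) f"
  shows "f i = \<Phi> (hpart i x)" "x \<in> hats"
proof -
  interpret D: presentation ssc D A' \<Phi> by (rule pr)
  define E where "E = {i. f i \<noteq> \<zero>\<^bsub>A'\<^esub>}"
  have "\<forall>i. \<exists>g\<in>D \<inter> homs i. f i = \<Phi> g" using f C unfolding homogeneous_parts_def by blast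
  then obtain g where g: "\<And>i. g i \<in> D" "\<And>i. g i \<in> homs i" "\<And>i. f i = \<Phi> (g i)" by (metis IntE)
  have E: "finite E" and sum: "\<Phi> x = finsum A' f E" using f by (auto simp: homogeneous_parts_def E_def)
  have "f = (\<lambda>i. \<Phi> (g i))" using g(3) by auto
  then have "\<Phi> x = \<Phi> (sum g E)" using sum D.pres_finsum[OF E, of g] g(1) by simp
  moreover have sE: "sum g E \<in> cauchys"
    by (rule seq.subsp_sum[OF cauchys_subsp]) (use g D in auto)
  ultimately have n: "x - sum g E \<in> nulls" using \<Phi>_eq_iff x D by blast
  show "x \<in> hats" by (rule hatsI[OF _ E g(2) n]) (use x D in auto)
  have "hpart i (sum g E) = (if i \<in> E then g i else 0)"
  proof -
    have "hpart i (sum g E) = (\<Sum>j\<in>E. if j = i then g i else 0)"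
      unfolding hpart_sum by (rule sum.cong) (auto simp: homs_hpart[OF g(2)])
    then show ?thesis using E by simp
  qed
  then have "hpart i x - (if i \<in> E then g i else 0) \<in> nulls" using hpart_nulls[OF n, of i] by (simp add: hpart_diff)
  then have "\<Phi> (hpart i x) = \<Phi> (if i \<in> E then g i else 0)"
    using \<Phi>_eq_iff[of "hpart i x"] x D g(1) by (auto simp: hpart_cauchys cauchys_closed subset_iff)
  also have "\<dots> = f i" using g(3) by (auto simp: E_def D.pres_zero)
  finally show "f i = \<Phi> (hpart i x)" by simp
qed

lemma homogeneous_parts_exists:
  assumes pr: "presentation ssc D A' \<Phi>" and D: "x \<in> D" and x: "x \<in> hats"
    and C: "\<And>i. \<Phi> ` (D \<inter> homs i) \<subseteq> C i" and hpart: "\<And>i. hpart i x \<in> D"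
  shows "homogeneous_parts A' C (\<Phi> x) (\<lambda>i. \<Phi> (hpart i x))"
proof -
  interpret D: presentation ssc D A' \<Phi> by (rule pr)
  have xc: "x \<in> cauchys" using x hats_cauchys by blast
  obtain E where E: "finite E" "x - (\<Sum>i\<in>E. hpart i x) \<in> nulls" using x by (auto simp: hats_def)
  have zero: "\<Phi> (hpart i x) = \<zero>\<^bsub>A'\<^esub> \<longleftrightarrow> hpart i x \<in> nulls" for i
    using \<Phi>_eq_iff[of "hpart i x" 0] xc by (simp add: D.pres_zero hpart_cauchys cauchys_closed)
  \<comment> \<open>\<open>homogeneous_parts\<close> sums exactly over the nonzero terms, so the
    indices of \<open>E\<close> whose part is null have to be removed.\<close>
  define E' where "E' = {i. \<Phi> (hpart i x) \<noteq> \<zero>\<^bsub>A'\<^esub>}"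
  have sub: "E' \<subseteq> E" using hats_parts_mono[OF xc E] zero by (auto simp: E'_def)
  then have fin: "finite E'" using E(1) finite_subset by blast
  have "(\<Sum>i\<in>E-E'. hpart i x) \<in> nulls"
    by (rule seq.subsp_sum[OF nulls_subsp]) (auto simp: E'_def zero)
  then have "(x - (\<Sum>i\<in>E. hpart i x)) + (\<Sum>i\<in>E-E'. hpart i x) \<in> nulls" using nulls_closed(2)[OF E(2)] by blast
  moreover have "(x - (\<Sum>i\<in>E. hpart i x)) + (\<Sum>i\<in>E-E'. hpart i x) = x - (\<Sum>i\<in>E'. hpart i x)"
    using sum.subset_diff[OF sub E(1), of "\<lambda>i. hpart i x"] by simp
  ultimately have "x - (\<Sum>i\<in>E'. hpart i x) \<in> nulls" by metis
  then have "\<Phi> x = \<Phi> (\<Sum>i\<in>E'. hpart i x)"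
    using \<Phi>_eq_iff[OF xc seq.subsp_sum[OF cauchys_subsp, of E' "\<lambda>i. hpart i x"]] hpart_cauchys[OF xc] by blast
  also have "\<dots> = finsum A' (\<lambda>i. \<Phi> (hpart i x)) E'" using D.pres_finsum[OF fin, of "\<lambda>i. hpart i x"] hpart by metis
  finally show ?thesis
    using fin C hpart hpart_homs[OF xc] unfolding homogeneous_parts_def E'_def by blast
qed

lemma component_sum_completion: "component_sum (completion A base) comp = \<Phi> ` hats"
proof (intro subset_antisym subsetI)
  fix y assume "y \<in> component_sum (completion A base) comp"
  then obtain f where f: "homogeneous_parts (completion A base) comp y f" by (auto simp: component_sum_def)
  have y: "y = finsum (completion A base) f {i. f i \<noteq> \<zero>\<^bsub>completion A base\<^esub>}"
    and fi: "f i \<in> comp i" for i using f unfolding homogeneous_parts_def by blast+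
  have "f i \<in> carrier (completion A base)" for i
    using fi[of i] homs_cauchys unfolding comp_eq L.carrier_eq by blast
  then have "y \<in> carrier (completion A base)" unfolding y by (intro L.M.finsum_closed) auto
  then obtain x where x: "x \<in> cauchys" "y = \<Phi> x" by (rule L.carrierE)
  have "x \<in> hats"
    by (rule homogeneous_parts_unique(2)[OF completion_presentation order_refl x(1) _ f[unfolded x(2)]])
      (use homs_cauchys in \<open>auto simp: comp_eq\<close>)
  then show "y \<in> \<Phi> ` hats" using x by blast
next
  fix y assume "y \<in> \<Phi> ` hats"
  then obtain x where x: "x \<in> hats" "y = \<Phi> x" by blast
  have "homogeneous_parts (completion A base) comp (\<Phi> x) (\<lambda>i. \<Phi> (hpart i x))"
    by (rule homogeneous_parts_exists[OF completion_presentation])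
      (use x hats_cauchys hpart_cauchys in \<open>auto simp: comp_eq\<close>)
  then show "y \<in> component_sum (completion A base) comp" using x(2) by (auto simp: component_sum_def)
qed


definition hat_algebra :: "('f, (nat \<Rightarrow> 'a) set) module" where
  "hat_algebra = (completion A base)\<lparr>carrier := component_sum (completion A base) comp\<rparr>"

definition hat_topology :: "(nat \<Rightarrow> 'a) set topology" where
  "hat_topology = subtopology (completion_topology A base) (carrier hat_algebra)"

lemma hat_algebra_eq: "hat_algebra = (completion A base)\<lparr>carrier := \<Phi> ` hats\<rparr>"
  by (simp add: hat_algebra_def component_sum_completion)

lemma carrier_hat_algebra: "carrier hat_algebra = \<Phi> ` hats" by (simp add: hat_algebra_eq)

lemma hat_presentation: "presentation ssc hats hat_algebra \<Phi>"
  unfolding hat_algebra_eq by (rule L.presentation_restrict[OF hats_subalg hats_sub])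

sublocale H: presentation ssc hats hat_algebra \<Phi> by (rule hat_presentation)

lemma hats_saturated: "x \<in> cauchys \<Longrightarrow> y \<in> hats \<Longrightarrow> x - y \<in> nulls \<Longrightarrow> x \<in> hats"
  using hats_closed(2)[OF nulls_hats, of "x - y" y] by simp

lemma pre_eq_hat_pre: "U \<subseteq> \<Phi> ` hats \<Longrightarrow> L.pre U = H.pre U"
proof (intro subset_antisym subsetI)
  assume U: "U \<subseteq> \<Phi> ` hats"
  fix x assume "x \<in> L.pre U"
  then have x: "x \<in> cauchys" "\<Phi> x \<in> U" by (auto simp: L.pre_def)
  then obtain y where y: "y \<in> hats" "\<Phi> x = \<Phi> y" using U by blast
  have "x - y \<in> nulls" using \<Phi>_eq_iff[OF x(1) hats_cauchys[OF y(1)]] y(2) by blast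
  then show "x \<in> H.pre U" using hats_saturated[OF x(1) y(1)] x(2) by (simp add: H.pre_def)
qed (use hats_sub in \<open>auto simp: L.pre_def H.pre_def\<close>)

text \<open>Closed two-sided ideals of the graded completion, pulled back to sequences. Containing
  \<open>nulls\<close> makes the set a union of classes; the last clause is closedness in terms of
  approximation.\<close>

definition closed_ideal :: "(nat \<Rightarrow> 'p) set \<Rightarrow> bool" where
  "closed_ideal J \<longleftrightarrow> seq.ideal_in hats J \<and> nulls \<subseteq> J \<and>
     (\<forall>x\<in>hats. (\<forall>k. \<exists>y\<in>J. small k (x - y)) \<longrightarrow> x \<in> J)"

lemma closed_ideal_iff:
  "two_sided_ideal hat_algebra J \<and> closedin hat_topology J \<longleftrightarrow> J \<subseteq> \<Phi> ` hats \<and> closed_ideal (H.pre J)"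
proof (cases "J \<subseteq> \<Phi> ` hats")
  case True
  have sub: "\<Phi> ` hats \<subseteq> carrier (completion A base)" using hats_sub by (auto simp: L.carrier_eq)
  have hh: "H.pre (\<Phi> ` hats) = hats" by (auto simp: H.pre_def)
  have cl: "closedin hat_topology J \<longleftrightarrow> (\<forall>x\<in>hats. (\<forall>k. \<exists>y\<in>H.pre J. small k (x - y)) \<longrightarrow> x \<in> H.pre J)"
    using True
    by (simp add: hat_topology_def carrier_hat_algebra closedin_sub[OF sub] pre_eq_hat_pre[OF True]
        pre_eq_hat_pre[OF order_refl] hh)
  have "nulls \<subseteq> H.pre J" if "seq.ideal_in hats (H.pre J)"
  proof
    fix x assume x: "x \<in> nulls"
    have "0 \<in> H.pre J" using that seq.subspD(1) by (auto simp: seq.ideal_in_def)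
    then have "\<Phi> 0 \<in> J" by (simp add: H.pre_def)
    moreover have "\<Phi> x = \<Phi> 0" using x \<Phi>_eq_iff[of x 0] nulls_sub cauchys_closed(1) by auto
    ultimately show "x \<in> H.pre J" using nulls_hats[OF x] by (simp add: H.pre_def)
  qed
  then show ?thesis unfolding closed_ideal_def cl H.two_sided_ideal_iff carrier_hat_algebra
    using True by blast
next
  case False
  then show ?thesis by (auto simp: H.two_sided_ideal_iff carrier_hat_algebra)
qed

lemma closed_ideal_hats: "closed_ideal hats"
  using hats_subsp hats_mult nulls_hats by (auto simp: closed_ideal_def seq.ideal_in_def)

lemma closed_idealD:
  assumes "closed_ideal J"
  shows "seq.subsp J" "J \<subseteq> hats" "nulls \<subseteq> J"
    "\<And>a x. a \<in> hats \<Longrightarrow> x \<in> J \<Longrightarrow> a * x \<in> J" "\<And>a x. a \<in> hats \<Longrightarrow> x \<in> J \<Longrightarrow> x * a \<in> J"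
    "\<And>x. x \<in> hats \<Longrightarrow> (\<And>k. \<exists>y\<in>J. small k (x - y)) \<Longrightarrow> x \<in> J"
  using assms unfolding closed_ideal_def seq.ideal_in_def by blast+

lemma closed_ideal_pre_image:
  assumes "closed_ideal J" shows "H.pre (\<Phi> ` J) = J"
proof -
  note J = closed_idealD[OF assms]
  have JC: "J \<subseteq> cauchys" using J(2) hats_sub by blast
  have "L.pre (\<Phi> ` J) = J"
    by (rule pre_image[OF JC]) (metis J(1,3) diff_add_cancel seq.subspD(2) subsetD)
  then show ?thesis using pre_eq_hat_pre[of "\<Phi> ` J"] J(2) by blast
qed

section \<open>Closed ideals generated by a set\<close>

definition gen_ideal :: "(nat \<Rightarrow> 'p) set \<Rightarrow> (nat \<Rightarrow> 'p) set" where
  "gen_ideal W = \<Inter>{J. closed_ideal J \<and> W \<subseteq> J}"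

lemma gen_ideal_min: "closed_ideal J \<Longrightarrow> W \<subseteq> J \<Longrightarrow> gen_ideal W \<subseteq> J"
  by (auto simp: gen_ideal_def)

lemma gen_ideal_gens: "W \<subseteq> gen_ideal W" by (auto simp: gen_ideal_def)

lemma closed_ideal_gen_ideal:
  assumes "W \<subseteq> hats" shows "closed_ideal (gen_ideal W)"
proof -
  let ?F = "{J. closed_ideal J \<and> W \<subseteq> J}"
  have ne: "hats \<in> ?F" using assms closed_ideal_hats by simp
  have D: "closed_ideal J" if "J \<in> ?F" for J using that by simp
  define I where "I = gen_ideal W"
  have mem: "x \<in> I \<longleftrightarrow> (\<forall>J\<in>?F. x \<in> J)" for x by (simp add: I_def gen_ideal_def)
  have "closed_ideal I"
    unfolding closed_ideal_def seq.ideal_in_def seq.subsp_def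
  proof (intro conjI ballI allI impI subsetI)
    show "x \<in> I" if x: "x \<in> hats" "\<forall>k. \<exists>y\<in>I. small k (x - y)" for x
      unfolding mem
    proof
      fix J assume J: "J \<in> ?F"
      have "\<exists>y\<in>J. small k (x - y)" for k using x(2) J mem by blast
      then show "x \<in> J" using closed_idealD(6)[OF D[OF J] x(1)] by blast
    qed
    show "0 \<in> I" unfolding mem using seq.subspD(1)[OF closed_idealD(1)[OF D]] by blast
    show "x + y \<in> I" if "x \<in> I" "y \<in> I" for x y
      using that unfolding mem using seq.subspD(2)[OF closed_idealD(1)[OF D]] by blast
    show "ssc c x \<in> I" if "x \<in> I" for x c
      using that unfolding mem using seq.subspD(3)[OF closed_idealD(1)[OF D]] by blast
    show "x \<in> hats" if "x \<in> I" for x using that ne unfolding mem by blast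
    show "x \<in> I" if "x \<in> nulls" for x
      using that closed_idealD(3)[OF D] unfolding mem by blast
    show "a * x \<in> I" "x * a \<in> I" if "a \<in> hats" "x \<in> I" for a x
    proof -
      have "a * x \<in> J \<and> x * a \<in> J" if "J \<in> ?F" for J
        using closed_idealD(4,5)[OF D[OF that] \<open>a \<in> hats\<close>, of x] \<open>x \<in> I\<close> that unfolding mem by simp
      then show "a * x \<in> I" "x * a \<in> I" unfolding mem by simp_all
    qed
  qed
  then show ?thesis by (simp add: I_def)
qed

lemma hull_eq_gen_ideal:
  assumes "W \<subseteq> hats"
  shows "(\<lambda>J. two_sided_ideal hat_algebra J \<and> closedin hat_topology J) hull (\<Phi> ` W) = \<Phi> ` gen_ideal W"
proof (rule hull_unique)
  show "\<Phi> ` W \<subseteq> \<Phi> ` gen_ideal W" using gen_ideal_gens by blast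
  note c = closed_ideal_gen_ideal[OF assms]
  show "two_sided_ideal hat_algebra (\<Phi> ` gen_ideal W) \<and> closedin hat_topology (\<Phi> ` gen_ideal W)"
    unfolding closed_ideal_iff closed_ideal_pre_image[OF c] using c closed_idealD(2)[OF c] by blast
  fix t assume t: "\<Phi> ` W \<subseteq> t" "two_sided_ideal hat_algebra t \<and> closedin hat_topology t"
  then have ts: "t \<subseteq> \<Phi> ` hats" "closed_ideal (H.pre t)" unfolding closed_ideal_iff by auto
  have "W \<subseteq> H.pre t" using t(1) assms by (auto simp: H.pre_def)
  then have "gen_ideal W \<subseteq> H.pre t" by (rule gen_ideal_min[OF ts(2)])
  then show "\<Phi> ` gen_ideal W \<subseteq> t" by (auto simp: H.pre_def)
qed

text \<open>The elements of the ideal all of whose homogeneous parts stay in it form a closed ideal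
  containing \<open>W\<close>, hence are everything. Closure under products is checked after
  splitting the other factor into homogeneous parts and a null remainder.\<close>

lemma gen_ideal_hpart:
  assumes W: "W \<subseteq> homs 0" and x: "x \<in> gen_ideal W"
  shows "hpart i x \<in> gen_ideal W"
proof -
  let ?I = "gen_ideal W"
  have Wh: "W \<subseteq> hats" using W homs_hats by blast
  note I = closed_idealD[OF closed_ideal_gen_ideal[OF Wh]]
  define K where "K = {x \<in> ?I. \<forall>i. hpart i x \<in> ?I}"
  have IC: "x \<in> ?I \<Longrightarrow> x \<in> cauchys" for x using I(2) hats_cauchys by blast
  have mult: "hpart i (a * x) \<in> ?I \<and> hpart i (x * a) \<in> ?I" if a: "a \<in> hats" and x: "x \<in> K" for a x i
  proof -
    obtain D where D: "finite D" "a - (\<Sum>j\<in>D. hpart j a) \<in> nulls" using a by (auto simp: hats_def)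
    have xc: "x \<in> cauchys" using x IC by (simp add: K_def)
    have Pa: "hpart j a \<in> hats" for j using hpart_homs[OF hats_cauchys[OF a]] homs_hats by blast
    have e: "a * x = (a - (\<Sum>j\<in>D. hpart j a)) * x + (\<Sum>j\<in>D. hpart j a * x)"
      "x * a = x * (a - (\<Sum>j\<in>D. hpart j a)) + (\<Sum>j\<in>D. x * hpart j a)"
      by (simp_all add: left_diff_distrib right_diff_distrib sum_distrib_left sum_distrib_right)
    have "hpart i ((a - (\<Sum>j\<in>D. hpart j a)) * x) \<in> ?I" "hpart i (x * (a - (\<Sum>j\<in>D. hpart j a))) \<in> ?I"
      using hpart_nulls[OF nulls_mult(2)[OF xc D(2)]] hpart_nulls[OF nulls_mult(1)[OF xc D(2)]] I(3) by auto
    moreover have "(\<Sum>j\<in>D. hpart i (hpart j a * x)) \<in> ?I" "(\<Sum>j\<in>D. hpart i (x * hpart j a)) \<in> ?I"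
      unfolding hpart_mult_left hpart_mult_right
      by (rule seq.subsp_sum[OF I(1)]; use x Pa I(4,5) in \<open>simp add: K_def\<close>)+
    ultimately show ?thesis unfolding e hpart_add hpart_sum using seq.subspD(2)[OF I(1)] by blast
  qed
  have "closed_ideal K"
    unfolding closed_ideal_def seq.ideal_in_def seq.subsp_def
  proof (intro conjI ballI allI impI subsetI)
    show "0 \<in> K" using seq.subspD(1)[OF I(1)] by (simp add: K_def hpart_zero)
    show "x + y \<in> K" if "x \<in> K" "y \<in> K" for x y
      using that seq.subspD(2)[OF I(1)] by (simp add: K_def hpart_add)
    show "ssc c x \<in> K" if "x \<in> K" for x c
      using that seq.subspD(3)[OF I(1)] by (simp add: K_def hpart_ssc)
    show "x \<in> hats" if "x \<in> K" for x using that I(2) by (auto simp: K_def)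
    show "x \<in> K" if "x \<in> nulls" for x using that I(3) hpart_nulls by (auto simp: K_def)
    show "a * x \<in> K" "x * a \<in> K" if "a \<in> hats" "x \<in> K" for a x
      using mult[OF that] I(4,5) that by (auto simp: K_def)
    fix x assume x: "x \<in> hats" "\<forall>k. \<exists>y\<in>K. small k (x - y)"
    show "x \<in> K" unfolding K_def
    proof (intro CollectI conjI allI)
      show "x \<in> ?I" by (rule I(6)[OF x(1)]) (use x(2) in \<open>auto simp: K_def\<close>)
      show "hpart i x \<in> ?I" for i
      proof (rule I(6))
        show "hpart i x \<in> hats" by (rule homs_hats[OF hpart_homs[OF hats_cauchys[OF x(1)]]])
        show "\<exists>y\<in>?I. small k (hpart i x - y)" for k
        proof -
          obtain y where y: "y \<in> K" "small k (x - y)" using x(2) by blast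
          then have "small k (hpart i x - hpart i y)" using hpart_small[OF y(2), of i] by (simp add: hpart_diff)
          then show ?thesis using y(1) unfolding K_def by blast
        qed
      qed
    qed
  qed
  moreover have "W \<subseteq> K"
  proof
    fix w assume w: "w \<in> W"
    have "hpart i w \<in> ?I" for i
      using homs_hpart[OF subsetD[OF W w], of i] subsetD[OF gen_ideal_gens w] seq.subspD(1)[OF I(1)] by simp
    then show "w \<in> K" using w gen_ideal_gens[of W] by (auto simp: K_def)
  qed
  ultimately have "?I \<subseteq> K" by (rule gen_ideal_min)
  then show ?thesis using x by (auto simp: K_def)
qed

text \<open>An ideal of \<open>I\<close> need not be an ideal of the whole algebra, but since the generators \<open>w\<close> are
  idempotent, \<open>a w b = (a w) w (w b)\<close> lies in every ideal of \<open>I\<close> that contains \<open>w\<close>.\<close>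

theorem topologically_graded_simple_gen_ideal:
  assumes W: "W \<subseteq> homs 0" and idem: "\<And>w. w \<in> W \<Longrightarrow> w * w - w \<in> nulls"
    and nz: "\<exists>w\<in>W. w \<notin> nulls"
    and key: "\<And>J a i. seq.subsp J \<Longrightarrow> nulls \<subseteq> J \<Longrightarrow> J \<subseteq> gen_ideal W \<Longrightarrow>
       (\<And>a x. a \<in> gen_ideal W \<Longrightarrow> x \<in> J \<Longrightarrow> a * x \<in> J \<and> x * a \<in> J) \<Longrightarrow>
       (\<And>x. x \<in> hats \<Longrightarrow> (\<And>k. \<exists>y\<in>J. small k (x - y)) \<Longrightarrow> x \<in> J) \<Longrightarrow>
       a \<in> J \<Longrightarrow> a \<in> homs i \<Longrightarrow> a \<notin> nulls \<Longrightarrow> W \<subseteq> J"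
  shows "topologically_graded_simple (hat_algebra\<lparr>carrier := \<Phi> ` gen_ideal W\<rparr>)
           (subtopology hat_topology (\<Phi> ` gen_ideal W)) (\<lambda>i. \<Phi> ` gen_ideal W \<inter> comp i)"
proof -
  define I where "I = gen_ideal W"
  have Wh: "W \<subseteq> hats" using W homs_hats by blast
  have cI: "closed_ideal I" unfolding I_def by (rule closed_ideal_gen_ideal[OF Wh])
  note I = closed_idealD[OF cI]
  have Isub: "I \<subseteq> cauchys" using I(2) hats_sub by blast
  have WI: "W \<subseteq> I" by (simp add: I_def gen_ideal_gens)
  have PI: "x \<in> I \<Longrightarrow> hpart i x \<in> I" for x i unfolding I_def by (rule gen_ideal_hpart[OF W])
  have Ialg: "seq.subalg I" using I(1,2,4) by (auto simp: seq.subalg_def)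
  define AI where "AI = (completion A base)\<lparr>carrier := \<Phi> ` I\<rparr>"
  define TI where "TI = subtopology ctop (\<Phi> ` I)"
  define CI where "CI = (\<lambda>i. \<Phi> ` I \<inter> comp i)"
  have eqA: "hat_algebra\<lparr>carrier := \<Phi> ` I\<rparr> = AI" by (simp add: hat_algebra_eq AI_def)
  have "\<Phi> ` hats \<inter> \<Phi> ` I = \<Phi> ` I" using I(2) by blast
  then have eqT: "subtopology hat_topology (\<Phi> ` I) = TI"
    by (simp add: hat_topology_def TI_def carrier_hat_algebra subtopology_subtopology)
  have sat: "x \<in> I" if "x \<in> cauchys" "y \<in> I" "x - y \<in> nulls" for x y
    using seq.subspD(2)[OF I(1), of "x - y" y] I(3) that by auto
  have preI: "L.pre (\<Phi> ` I) = I" by (rule pre_image[OF Isub sat])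
  have prI: "presentation ssc I AI \<Phi>" unfolding AI_def by (rule L.presentation_restrict[OF Ialg Isub])
  interpret AI: presentation ssc I AI \<Phi> by (rule prI)
  have carI: "carrier AI = \<Phi> ` I" by (simp add: AI_def)
  have CI: "CI i = \<Phi> ` (I \<inter> homs i)" for i
  proof (intro subset_antisym subsetI)
    fix y assume "y \<in> CI i"
    then obtain a b where "a \<in> I" "y = \<Phi> a" "b \<in> homs i" "y = \<Phi> b" by (auto simp: CI_def comp_eq)
    moreover have "b \<in> I"
    proof (rule sat)
      show "b \<in> cauchys" using \<open>b \<in> homs i\<close> homs_cauchys by blast
      show "a \<in> I" by fact
      show "b - a \<in> nulls"
        using \<Phi>_eq_iff[OF \<open>b \<in> cauchys\<close>] \<open>a \<in> I\<close> Isub \<open>y = \<Phi> a\<close> \<open>y = \<Phi> b\<close> by blast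
    qed
    ultimately show "y \<in> \<Phi> ` (I \<inter> homs i)" by blast
  qed (auto simp: CI_def comp_eq)
  have zeroI: "\<Phi> x = \<zero>\<^bsub>AI\<^esub> \<longleftrightarrow> x \<in> nulls" if "x \<in> cauchys" for x
    using \<Phi>_zero_iff[OF that] by (simp add: AI_def)
  have preC: "AI.pre (CI i) = {x \<in> I. x - hpart i x \<in> nulls}" for i
  proof (intro subset_antisym subsetI)
    fix x assume "x \<in> AI.pre (CI i)"
    then obtain y where y: "x \<in> I" "y \<in> I" "y \<in> homs i" "\<Phi> x = \<Phi> y" by (auto simp: AI.pre_def CI)
    then have n: "x - y \<in> nulls" using \<Phi>_eq_iff Isub by (metis subsetD)
    have "hpart i x - y \<in> nulls" using hpart_nulls[OF n, of i] homs_hpart[OF y(3), of i] by (simp add: hpart_diff)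
    then have "(x - y) - (hpart i x - y) \<in> nulls" by (rule nulls_closed(5)[OF n])
    then show "x \<in> {x \<in> I. x - hpart i x \<in> nulls}" using y by simp
  next
    fix x assume x: "x \<in> {x \<in> I. x - hpart i x \<in> nulls}"
    then have "\<Phi> x = \<Phi> (hpart i x)" using \<Phi>_eq_iff[of x "hpart i x"] Isub hpart_cauchys by auto
    then show "x \<in> AI.pre (CI i)" using x PI hpart_homs Isub by (auto simp: AI.pre_def CI)
  qed
  have "topologically_graded_simple AI TI CI"
    unfolding topologically_graded_simple_def
  proof (intro conjI allI impI)
    show "topological_algebra AI TI"
      unfolding AI_def TI_def by (rule topological_algebra_sub[OF Ialg Isub])
    show "graded_algebra AI CI" unfolding graded_algebra_def
    proof (intro conjI allI ballI)
      show "assoc_algebra AI" by (rule AI.pres_assoc_algebra)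
      show "lin_subspace AI (CI i)" for i
        unfolding AI.lin_subspace_iff preC
      proof
        show "CI i \<subseteq> carrier AI" by (auto simp: CI_def carI)
        show "seq.subsp {x \<in> I. x - hpart i x \<in> nulls}"
          unfolding seq.subsp_def
        proof (intro conjI ballI allI)
          show "0 \<in> {x \<in> I. x - hpart i x \<in> nulls}" using I(1) seq.subspD(1) nulls_closed(1) by (simp add: hpart_zero)
          show "x + y \<in> {x \<in> I. x - hpart i x \<in> nulls}"
            if "x \<in> {x \<in> I. x - hpart i x \<in> nulls}" "y \<in> {x \<in> I. x - hpart i x \<in> nulls}" for x y
          proof -
            have "(x - hpart i x) + (y - hpart i y) \<in> nulls" using that nulls_closed(2) by blast
            moreover have "(x - hpart i x) + (y - hpart i y) = x + y - hpart i (x + y)" by (simp add: hpart_add)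
            ultimately show ?thesis using that seq.subspD(2)[OF I(1)] by simp
          qed
          show "ssc c x \<in> {x \<in> I. x - hpart i x \<in> nulls}" if "x \<in> {x \<in> I. x - hpart i x \<in> nulls}" for c x
          proof -
            have x: "x \<in> I" "x - hpart i x \<in> nulls" using that by auto
            have "ssc c x - hpart i (ssc c x) \<in> nulls"
              using nulls_closed(3)[OF x(2), of c] unfolding seq.sc_diff_right hpart_ssc .
            then show ?thesis using seq.subspD(3)[OF I(1) x(1)] by (intro CollectI conjI)
          qed
        qed
      qed
      show "\<exists>!f. homogeneous_parts AI CI y f" if y: "y \<in> carrier AI" for y
      proof -
        obtain x where x: "x \<in> I" "y = \<Phi> x" using y by (auto simp: carI)
        show ?thesis
        proof (rule ex1I)
          show "homogeneous_parts AI CI y (\<lambda>i. \<Phi> (hpart i x))" unfolding x(2)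
            by (rule homogeneous_parts_exists[OF prI x(1)]) (use x I(2) PI in \<open>auto simp: CI\<close>)
          show "f = (\<lambda>i. \<Phi> (hpart i x))" if "homogeneous_parts AI CI y f" for f
            using homogeneous_parts_unique(1)[OF prI Isub x(1), of CI f] that x(2) by (auto simp: CI)
        qed
      qed
      show "x \<otimes>\<^bsub>AI\<^esub> y \<in> CI (i + j)" if xC: "x \<in> CI i" and yC: "y \<in> CI j" for i j x y
      proof -
        obtain a b where ab: "a \<in> I" "a \<in> homs i" "x = \<Phi> a" "b \<in> I" "b \<in> homs j" "y = \<Phi> b"
          using xC yC by (auto simp: CI)
        then have "x \<otimes>\<^bsub>AI\<^esub> y = \<Phi> (a * b)" by (simp add: AI.pres_mult)
        moreover have "a * b \<in> I \<inter> homs (i + j)"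
          using homs_mult[OF ab(2,5)] AI.S_mult[OF ab(1,4)] by simp
        ultimately show ?thesis by (simp add: CI)
      qed
    qed
    obtain w where w: "w \<in> W" "w \<notin> nulls" using nz by blast
    have wI: "w \<in> I" using w WI by blast
    have "w * w \<notin> nulls"
    proof
      assume "w * w \<in> nulls"
      then have "w * w - (w * w - w) \<in> nulls" using nulls_closed(5) idem[OF w(1)] by blast
      then show False using w(2) by simp
    qed
    then have "\<Phi> w \<otimes>\<^bsub>AI\<^esub> \<Phi> w \<noteq> \<zero>\<^bsub>AI\<^esub>"
      using zeroI[of "w * w"] AI.pres_mult[OF wI wI] AI.S_mult[OF wI wI] Isub by auto
    then show "\<exists>x\<in>carrier AI. \<exists>y\<in>carrier AI. x \<otimes>\<^bsub>AI\<^esub> y \<noteq> \<zero>\<^bsub>AI\<^esub>"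
      using wI by (auto simp: carI)
    fix J assume J: "two_sided_ideal AI J \<and> J = component_sum AI (\<lambda>i. J \<inter> CI i) \<and> closedin TI J"
    define K where "K = AI.pre J"
    have JI: "J \<subseteq> \<Phi> ` I" and Kid: "seq.ideal_in I K"
      using J by (auto simp: AI.two_sided_ideal_iff carI K_def)
    have JK: "J = \<Phi> ` K" using AI.image_pre[of J] JI by (simp add: K_def carI)
    have Ksp: "seq.subsp K" and KI: "K \<subseteq> I" using Kid by (auto simp: seq.ideal_in_def)
    have Kmult: "a * x \<in> K \<and> x * a \<in> K" if "a \<in> I" "x \<in> K" for a x
      using Kid that by (auto simp: seq.ideal_in_def)
    have Knull: "nulls \<subseteq> K"
    proof
      fix x assume x: "x \<in> nulls"
      then have "\<Phi> x = \<Phi> 0" using \<Phi>_eq_iff[of x 0] nulls_sub cauchys_closed(1) by auto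
      moreover have "\<Phi> 0 \<in> J" using seq.subspD(1)[OF Ksp] by (simp add: K_def AI.pre_def)
      ultimately show "x \<in> K" using x I(3) by (auto simp: K_def AI.pre_def)
    qed
    have Lpre: "L.pre J = K" using preI JI Isub by (auto simp: L.pre_def K_def AI.pre_def)
    have HI: "\<Phi> ` I \<subseteq> carrier (completion A base)" using Isub by (auto simp: L.carrier_eq)
    have Kclosed: "x \<in> K" if "x \<in> hats" "\<And>k. \<exists>y\<in>K. small k (x - y)" for x
    proof -
      have "\<exists>y\<in>I. small k (x - y)" for k using that(2) KI by blast
      then have "x \<in> I" using I(6)[OF that(1)] by blast
      moreover have "closedin (subtopology ctop (\<Phi> ` I)) J" using J by (simp add: TI_def)
      ultimately show ?thesis using that(2) unfolding closedin_sub[OF HI] preI Lpre by blast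
    qed
    show "J = {\<zero>\<^bsub>AI\<^esub>} \<or> J = carrier AI"
    proof (cases "K \<subseteq> nulls")
      case True
      then have "K = nulls" using Knull by blast
      have "J = {\<Phi> 0}"
      proof -
        have "\<Phi> x = \<Phi> 0" if "x \<in> nulls" for x
          using that \<Phi>_eq_iff[of x 0] nulls_sub cauchys_closed(1) by auto
        then show ?thesis unfolding JK \<open>K = nulls\<close> using nulls_closed(1) by blast
      qed
      then show ?thesis by (simp add: AI.pres_zero)
    next
      case False
      then obtain x where x: "x \<in> K" "x \<notin> nulls" by blast
      have xI: "x \<in> I" using x KI by blast
      have "\<Phi> x \<in> component_sum AI (\<lambda>i. J \<inter> CI i)" using x(1) J JK by blast
      then obtain f where f: "homogeneous_parts AI (\<lambda>i. J \<inter> CI i) (\<Phi> x) f"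
        by (auto simp: component_sum_def)
      \<comment> \<open>Gradedness of \<open>J\<close> enters here: uniqueness of the decomposition
        identifies the terms supplied by \<open>component_sum\<close> with the classes of
        \<open>hpart i x\<close>.\<close>
      have PK: "hpart i x \<in> K" for i
      proof -
        have "f i = \<Phi> (hpart i x)"
          by (rule homogeneous_parts_unique(1)[OF prI Isub xI _ f]) (auto simp: CI)
        moreover have "f i \<in> J" using f by (auto simp: homogeneous_parts_def)
        ultimately show ?thesis using PI[OF xI] by (simp add: K_def AI.pre_def)
      qed
      have "\<exists>i. hpart i x \<notin> nulls"
      proof (rule ccontr)
        assume "\<not> (\<exists>i. hpart i x \<notin> nulls)"
        then have all: "\<And>i. hpart i x \<in> nulls" by blast
        obtain D where "x - (\<Sum>i\<in>D. hpart i x) \<in> nulls" using xI I(2) by (auto simp: hats_def)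
        moreover have "(\<Sum>i\<in>D. hpart i x) \<in> nulls" using all by (intro seq.subsp_sum[OF nulls_subsp])
        ultimately have "(x - (\<Sum>i\<in>D. hpart i x)) + (\<Sum>i\<in>D. hpart i x) \<in> nulls" by (rule nulls_closed(2))
        then show False using x(2) by simp
      qed
      then obtain i where i: "hpart i x \<notin> nulls" by blast
      have WK: "W \<subseteq> K"
        by (rule key[OF Ksp Knull _ _ _ PK[of i] hpart_homs i])
          (use KI Kmult Kclosed xI Isub in \<open>auto simp: I_def\<close>)
      \<comment> \<open>\<open>Q\<close> is the largest closed ideal of the whole of
        \<open>hats\<close> inside \<open>K\<close>. Once \<open>W \<subseteq> Q\<close> is known,
        minimality of the generated ideal gives
        \<open>I \<subseteq> Q \<subseteq> K\<close>.\<close>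
      define Q where "Q = {x \<in> K. \<forall>a\<in>hats. \<forall>b\<in>hats. a * x \<in> K \<and> x * b \<in> K \<and> a * x * b \<in> K}"
      have "closed_ideal Q"
        unfolding closed_ideal_def seq.ideal_in_def seq.subsp_def
      proof (intro conjI ballI allI impI subsetI)
        show "0 \<in> Q" using seq.subspD(1)[OF Ksp] by (simp add: Q_def)
        show "x + y \<in> Q" if "x \<in> Q" "y \<in> Q" for x y
          using that seq.subspD(2)[OF Ksp] by (simp add: Q_def distrib_left distrib_right)
        show "ssc c x \<in> Q" if "x \<in> Q" for x c
          unfolding Q_def
        proof (intro CollectI conjI ballI)
          show "ssc c x \<in> K" using that by (intro seq.subspD(3)[OF Ksp]) (simp add: Q_def)
          fix a b assume ab: "a \<in> hats" "b \<in> hats"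
          have *: "a * x \<in> K" "x * b \<in> K" "a * x * b \<in> K" using that ab by (simp_all add: Q_def)
          show "a * ssc c x \<in> K" "ssc c x * b \<in> K" "a * ssc c x * b \<in> K"
            unfolding seq.sc_mult_left seq.sc_mult_right by (intro seq.subspD(3)[OF Ksp] *)+
        qed
        show "x \<in> hats" if "x \<in> Q" for x using that KI I(2) by (auto simp: Q_def)
        show "x \<in> Q" if "x \<in> nulls" for x
          using that Knull nulls_mult hats_cauchys unfolding Q_def by blast
        show "a * x \<in> Q" if "a \<in> hats" "x \<in> Q" for a x
          using that hats_mult unfolding Q_def by (simp flip: mult.assoc)
        show "x * a \<in> Q" if "a \<in> hats" "x \<in> Q" for a x
          using that hats_mult unfolding Q_def by (simp add: mult.assoc)
        fix x assume x: "x \<in> hats" "\<forall>k. \<exists>y\<in>Q. small k (x - y)"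
        have 1: "x \<in> K" by (rule Kclosed[OF x(1)]) (use x(2) in \<open>auto simp: Q_def\<close>)
        have 2: "a * x \<in> K" if a: "a \<in> hats" for a
        proof (rule Kclosed)
          show "a * x \<in> hats" using a x(1) hats_mult by blast
          show "\<exists>y\<in>K. small k (a * x - y)" for k
          proof -
            obtain l where "\<forall>z. small l z \<longrightarrow> small k (a * z) \<and> small k (z * a)"
              using cauchy_small_mult[OF hats_cauchys[OF a], of k] by blast
            moreover obtain y where y: "y \<in> Q" "small l (x - y)" using x(2) by blast
            ultimately have "small k (a * x - a * y)" by (metis right_diff_distrib)
            then show ?thesis using y(1) a unfolding Q_def by blast
          qed
        qed
        have 3: "x * b \<in> K" if b: "b \<in> hats" for b
        proof (rule Kclosed)
          show "x * b \<in> hats" using b x(1) hats_mult by blast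
          show "\<exists>y\<in>K. small k (x * b - y)" for k
          proof -
            obtain l where "\<forall>z. small l z \<longrightarrow> small k (b * z) \<and> small k (z * b)"
              using cauchy_small_mult[OF hats_cauchys[OF b], of k] by blast
            moreover obtain y where y: "y \<in> Q" "small l (x - y)" using x(2) by blast
            ultimately have "small k (x * b - y * b)" by (metis left_diff_distrib)
            then show ?thesis using y(1) b unfolding Q_def by blast
          qed
        qed
        have 4: "a * x * b \<in> K" if a: "a \<in> hats" and b: "b \<in> hats" for a b
        proof (rule Kclosed)
          show "a * x * b \<in> hats" using a b x(1) hats_mult by blast
          show "\<exists>y\<in>K. small k (a * x * b - y)" for k
          proof -
            obtain l where l: "\<forall>z. small l z \<longrightarrow> small k (b * z) \<and> small k (z * b)"
              using cauchy_small_mult[OF hats_cauchys[OF b], of k] by blast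
            obtain l' where "\<forall>z. small l' z \<longrightarrow> small l (a * z) \<and> small l (z * a)"
              using cauchy_small_mult[OF hats_cauchys[OF a], of l] by blast
            moreover obtain y where y: "y \<in> Q" "small l' (x - y)" using x(2) by blast
            ultimately have "small k (a * x * b - a * y * b)" using l by (metis left_diff_distrib right_diff_distrib)
            then show ?thesis using y(1) a b unfolding Q_def by blast
          qed
        qed
        show "x \<in> Q" using 1 2 3 4 by (simp add: Q_def)
      qed
      moreover have "W \<subseteq> Q"
      proof
        fix w assume w: "w \<in> W"
        have wK: "w \<in> K" and wI: "w \<in> I" and wh: "w \<in> hats" using w WK WI Wh by auto
        have n: "w * w - w \<in> nulls" by (rule idem[OF w])
        have aw: "a * w \<in> K" if "a \<in> hats" for a
        proof -
          have "(a * w) * w \<in> K" using Kmult I(4)[OF that wI] wK by blast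
          moreover have "a * (w * w - w) \<in> K" using nulls_mult(1)[OF hats_cauchys[OF that] n] Knull by blast
          ultimately have "(a * w) * w - a * (w * w - w) \<in> K" by (rule seq.subspD(5)[OF Ksp])
          then show ?thesis by (simp add: algebra_simps)
        qed
        have wb: "w * b \<in> K" if "b \<in> hats" for b
        proof -
          have "w * (w * b) \<in> K" using Kmult I(5)[OF that wI] wK by blast
          moreover have "(w * w - w) * b \<in> K" using nulls_mult(2)[OF hats_cauchys[OF that] n] Knull by blast
          ultimately have "w * (w * b) - (w * w - w) * b \<in> K" by (rule seq.subspD(5)[OF Ksp])
          then show ?thesis by (simp add: algebra_simps)
        qed
        have awb: "a * w * b \<in> K" if "a \<in> hats" "b \<in> hats" for a b
        proof -
          have "(a * w) * (w * b) \<in> K" using Kmult I(4)[OF that(1) wI] wb[OF that(2)] by blast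
          moreover have "a * (w * w - w) * b \<in> K"
            using nulls_mult(2)[OF hats_cauchys[OF that(2)] nulls_mult(1)[OF hats_cauchys[OF that(1)] n]] Knull by blast
          ultimately have "(a * w) * (w * b) - a * (w * w - w) * b \<in> K" by (rule seq.subspD(5)[OF Ksp])
          then show ?thesis by (simp add: algebra_simps)
        qed
        show "w \<in> Q" using wK aw wb awb by (simp add: Q_def)
      qed
      ultimately have "I \<subseteq> Q" unfolding I_def by (rule gen_ideal_min)
      then have "K = I" using KI by (auto simp: Q_def)
      then show ?thesis using JK by (simp add: carI)
    qed
  qed
  then show ?thesis using eqA eqT by (simp add: I_def CI_def)
qed

end

section \<open>The free algebra\<close>

lemma poly_expand: "p = (\<Sum>w\<in>Poly_Mapping.keys p. Poly_Mapping.single w (Poly_Mapping.lookup p w))"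
proof (rule poly_mapping_eqI)
  fix k
  have "(\<Sum>w\<in>Poly_Mapping.keys p. Poly_Mapping.lookup (Poly_Mapping.single w (Poly_Mapping.lookup p w)) k)
    = (\<Sum>w\<in>Poly_Mapping.keys p. if w = k then Poly_Mapping.lookup p k else 0)"
    by (rule sum.cong) (auto simp: lookup_single)
  then show "Poly_Mapping.lookup p k = Poly_Mapping.lookup
      (\<Sum>w\<in>Poly_Mapping.keys p. Poly_Mapping.single w (Poly_Mapping.lookup p w)) k"
    by (auto simp: lookup_sum in_keys_iff)
qed

abbreviation scal :: "'f::field \<Rightarrow> ('k \<Rightarrow>\<^sub>0 'f) \<Rightarrow> ('k \<Rightarrow>\<^sub>0 'f)" where
  "scal c \<equiv> Poly_Mapping.map ((*) c)"

lemma lookup_scal [simp]: "Poly_Mapping.lookup (scal c p) w = c * Poly_Mapping.lookup p w"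
  by (simp add: map.rep_eq when_def)

lemma scal_commute:
  fixes p :: "'k::monoid_add \<Rightarrow>\<^sub>0 'f::field"
  shows "p * Poly_Mapping.single 0 c = Poly_Mapping.single 0 c * p"
proof -
  have "(\<Sum>w\<in>K. Poly_Mapping.single w (h w)) * Poly_Mapping.single 0 c =
    Poly_Mapping.single 0 c * (\<Sum>w\<in>K. Poly_Mapping.single w (h w))" for K :: "'k set" and h :: "'k \<Rightarrow> 'f"
    by (simp add: sum_distrib_left sum_distrib_right mult_single mult.commute)
  then show ?thesis using poly_expand[of p] by metis
qed

interpretation poly: scaled_ring "scal :: 'f::field \<Rightarrow> ('k::monoid_add \<Rightarrow>\<^sub>0 'f) \<Rightarrow> _"
proof
  fix c :: 'f and x y :: "'k \<Rightarrow>\<^sub>0 'f"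
  show "scal c x * y = scal c (x * y)" by (simp add: mult_map_scale_conv_mult mult.assoc)
  show "x * scal c y = scal c (x * y)"
    by (simp add: mult_map_scale_conv_mult scal_commute flip: mult.assoc)
qed (auto intro!: poly_mapping_eqI simp: lookup_add algebra_simps)

lemma single_eq_scal: "Poly_Mapping.single w c = scal c (monomial w)"
  by simp

lemma monomial_mult: "monomial u * monomial w = monomial (u @ w)"
  by (simp add: mult_single plus_list_def)

lemma subsp_monomials:
  assumes "poly.subsp K" "\<And>w. w \<in> Poly_Mapping.keys p \<Longrightarrow> monomial w \<in> K"
  shows "p \<in> K"
proof -
  have "(\<Sum>w\<in>Poly_Mapping.keys p. Poly_Mapping.single w (Poly_Mapping.lookup p w)) \<in> K"
  proof (rule poly.subsp_sum[OF assms(1)])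
    fix w assume "w \<in> Poly_Mapping.keys p"
    then show "Poly_Mapping.single w (Poly_Mapping.lookup p w) \<in> K"
      using poly.subspD(3)[OF assms(1) assms(2)[of w], of "Poly_Mapping.lookup p w"]
      by (simp add: single_eq_scal[symmetric])
  qed
  then show ?thesis using poly_expand[of p] by simp
qed

section \<open>Linear functionals on the free algebra\<close>

definition linext :: "('k \<Rightarrow> 'f::field) \<Rightarrow> ('k \<Rightarrow>\<^sub>0 'f) \<Rightarrow> 'f" where
  "linext g p = (\<Sum>w\<in>Poly_Mapping.keys p. Poly_Mapping.lookup p w * g w)"

lemma linext_superset:
  assumes "finite K" "Poly_Mapping.keys p \<subseteq> K"
  shows "linext g p = (\<Sum>w\<in>K. Poly_Mapping.lookup p w * g w)"
  unfolding linext_def by (rule sum.mono_neutral_left[OF assms]) (auto simp: in_keys_iff)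

lemma linext_add: "linext g (p + q) = linext g p + linext g q"
proof -
  let ?K = "Poly_Mapping.keys p \<union> Poly_Mapping.keys q"
  have "Poly_Mapping.keys (p + q) \<subseteq> ?K" by (rule keys_add)
  then show ?thesis
    using linext_superset[of ?K p g] linext_superset[of ?K q g] linext_superset[of ?K "p + q" g]
    by (simp add: lookup_add distrib_right sum.distrib)
qed

lemma linext_zero [simp]: "linext g 0 = 0" by (simp add: linext_def)

lemma linext_scal: "linext g (scal c p) = c * linext g p"
proof -
  have "Poly_Mapping.keys (scal c p) \<subseteq> Poly_Mapping.keys p" by (auto simp: in_keys_iff)
  from linext_superset[OF finite_keys this] show ?thesis
    by (simp add: linext_def sum_distrib_left mult.assoc)
qed

lemma linext_uminus: "linext g (- p) = - linext g p"
  using linext_add[of g p "- p"] by (simp add: eq_neg_iff_add_eq_0 add.commute)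

lemma linext_diff: "linext g (p - q) = linext g p - linext g q"
  using linext_add[of g p "- q"] by (simp add: linext_uminus)

lemma linext_sum: "linext g (sum f D) = (\<Sum>i\<in>D. linext g (f i))"
  by (induction D rule: infinite_finite_induct) (simp_all add: linext_add)

lemma linext_single [simp]: "linext g (Poly_Mapping.single w c) = c * g w"
  by (cases "c = 0") (simp_all add: linext_def)

lemma linext_lin: "linext (\<lambda>w. \<Sum>i\<in>D. a i * g i w) p = (\<Sum>i\<in>D. a i * linext (g i) p)"
proof -
  have "linext (\<lambda>w. \<Sum>i\<in>D. a i * g i w) p =
      (\<Sum>w\<in>Poly_Mapping.keys p. \<Sum>i\<in>D. a i * (Poly_Mapping.lookup p w * g i w))"
    unfolding linext_def by (simp add: sum_distrib_left mult.left_commute)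
  also have "\<dots> = (\<Sum>i\<in>D. \<Sum>w\<in>Poly_Mapping.keys p. a i * (Poly_Mapping.lookup p w * g i w))"
    by (rule sum.swap)
  finally show ?thesis by (simp add: linext_def sum_distrib_left)
qed

text \<open>The functional is evaluated on a product by fixing the right-hand word first. This order
  is what turns the action of words on states into \<open>rep_mult\<close>.\<close>

lemma linext_mult:
  fixes p q :: "'g list \<Rightarrow>\<^sub>0 'f::field"
  shows "linext g (p * q) = linext (\<lambda>w. linext (\<lambda>u. g (u @ w)) p) q"
proof -
  have 1: "linext g (p * monomial w) = linext (\<lambda>u. g (u @ w)) p" for w
  proof -
    have "linext g ((\<Sum>u\<in>K. Poly_Mapping.single u (h u)) * monomial w) =
        linext (\<lambda>u. g (u @ w)) (\<Sum>u\<in>K. Poly_Mapping.single u (h u))" for K h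
      by (simp add: sum_distrib_right mult_single linext_sum plus_list_def)
    then show ?thesis using poly_expand[of p] by metis
  qed
  have 2: "linext g (p * Poly_Mapping.single w c) = c * linext (\<lambda>u. g (u @ w)) p" for w c
  proof -
    have "p * Poly_Mapping.single w c = scal c (p * monomial w)"
      unfolding poly.sc_mult_right[symmetric] by (simp add: single_eq_scal[symmetric])
    then show ?thesis by (simp only: linext_scal 1)
  qed
  have "linext g (p * q) = linext g (p * (\<Sum>w\<in>Poly_Mapping.keys q. Poly_Mapping.single w (Poly_Mapping.lookup q w)))"
    by (rule arg_cong[OF poly_expand])
  also have "\<dots> = linext (\<lambda>w. linext (\<lambda>u. g (u @ w)) p) q"
    unfolding sum_distrib_left linext_sum 2 by (simp add: linext_def)
  finally show ?thesis .
qed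

section \<open>The grading of the free algebra\<close>

definition word_degree :: "('v, 'e) generator list \<Rightarrow> int" where
  "word_degree w = sum_list (map generator_degree w)"

lemma word_degree_append [simp]: "word_degree (u @ w) = word_degree u + word_degree w"
  by (simp add: word_degree_def)

definition degree_part ::
    "int \<Rightarrow> (('v, 'e) generator list \<Rightarrow>\<^sub>0 'f::field) \<Rightarrow> (('v, 'e) generator list \<Rightarrow>\<^sub>0 'f)" where
  "degree_part i p = Abs_poly_mapping (\<lambda>w. if word_degree w = i then Poly_Mapping.lookup p w else 0)"

lemma lookup_degree_part:
  "Poly_Mapping.lookup (degree_part i p) w = (if word_degree w = i then Poly_Mapping.lookup p w else 0)"
proof -
  have "finite {w. (if word_degree w = i then Poly_Mapping.lookup p w else 0) \<noteq> 0}"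
    by (rule finite_subset[OF _ finite_keys[of p]]) (auto simp: in_keys_iff split: if_splits)
  then show ?thesis by (simp add: degree_part_def Abs_poly_mapping_inverse)
qed

lemma keys_degree_part:
  "Poly_Mapping.keys (degree_part i p) = {w \<in> Poly_Mapping.keys p. word_degree w = i}"
  by (auto simp: in_keys_iff lookup_degree_part split: if_splits)

lemma degree_part_add: "degree_part i (p + q) = degree_part i p + degree_part i q"
  by (rule poly_mapping_eqI) (simp add: lookup_degree_part lookup_add)

lemma degree_part_scal: "degree_part i (scal c p) = scal c (degree_part i p)"
  by (rule poly_mapping_eqI) (simp add: lookup_degree_part)

lemma degree_part_zero [simp]: "degree_part i 0 = 0"
  by (rule poly_mapping_eqI) (simp add: lookup_degree_part)

lemma degree_part_diff: "degree_part i (p - q) = degree_part i p - degree_part i q"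
  by (rule poly_mapping_eqI) (simp add: lookup_degree_part lookup_minus)

lemma degree_part_sum: "degree_part i (sum f D) = (\<Sum>d\<in>D. degree_part i (f d))"
  by (induction D rule: infinite_finite_induct) (simp_all add: degree_part_add)

lemma degree_part_single [simp]:
  "degree_part i (Poly_Mapping.single w c) = (if word_degree w = i then Poly_Mapping.single w c else 0)"
  by (rule poly_mapping_eqI) (auto simp: lookup_degree_part lookup_single when_def)

lemma degree_part_degree_part:
  "degree_part i (degree_part j p) = (if i = j then degree_part i p else 0)"
  by (rule poly_mapping_eqI) (auto simp: lookup_degree_part)

lemma degree_part_eq_iff:
  "degree_part i p = p \<longleftrightarrow> (\<forall>w\<in>Poly_Mapping.keys p. word_degree w = i)"
  unfolding poly_mapping_eq_iff by (auto simp: fun_eq_iff lookup_degree_part in_keys_iff)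

lemma degree_part_sum_expand:
  "\<exists>D. finite D \<and> p = (\<Sum>i\<in>D. degree_part i p)"
proof (intro exI conjI)
  let ?D = "word_degree ` Poly_Mapping.keys p"
  show "finite ?D" by simp
  show "p = (\<Sum>i\<in>?D. degree_part i p)"
  proof (rule poly_mapping_eqI)
    fix w
    have "(\<Sum>i\<in>?D. if word_degree w = i then Poly_Mapping.lookup p w else 0) = Poly_Mapping.lookup p w"
      by (cases "w \<in> Poly_Mapping.keys p") (auto simp: in_keys_iff)
    then show "Poly_Mapping.lookup p w = Poly_Mapping.lookup (\<Sum>i\<in>?D. degree_part i p) w"
      by (simp add: lookup_sum lookup_degree_part)
  qed
qed

lemma degree_part_mult_left:
  fixes p q :: "('v, 'e) generator list \<Rightarrow>\<^sub>0 'f::field"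
  shows "degree_part i (degree_part j p * q) = degree_part j p * degree_part (i - j) q"
proof -
  \<comment> \<open>The identity is proved for arbitrary finite sums of monomials and then
    instantiated: rewriting with \<open>poly_expand\<close> directly would loop, since its right
    side mentions \<open>p\<close> again.\<close>
  have "degree_part i (degree_part j (\<Sum>u\<in>K. Poly_Mapping.single u (h u)) * (\<Sum>w\<in>K'. Poly_Mapping.single w (h' w)))
    = degree_part j (\<Sum>u\<in>K. Poly_Mapping.single u (h u)) * degree_part (i - j) (\<Sum>w\<in>K'. Poly_Mapping.single w (h' w))"
    for K K' and h h' :: "('v, 'e) generator list \<Rightarrow> 'f"
    unfolding degree_part_sum sum_product by (intro sum.cong) (auto simp: mult_single plus_list_def)
  from this[where K = "Poly_Mapping.keys p" and h = "Poly_Mapping.lookup p"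
      and K' = "Poly_Mapping.keys q" and h' = "Poly_Mapping.lookup q"]
  show ?thesis unfolding poly_expand[symmetric] .
qed

lemma degree_part_mult_right:
  fixes p q :: "('v, 'e) generator list \<Rightarrow>\<^sub>0 'f::field"
  shows "degree_part i (q * degree_part j p) = degree_part (i - j) q * degree_part j p"
proof -
  have "degree_part i ((\<Sum>w\<in>K'. Poly_Mapping.single w (h' w)) * degree_part j (\<Sum>u\<in>K. Poly_Mapping.single u (h u)))
    = degree_part (i - j) (\<Sum>w\<in>K'. Poly_Mapping.single w (h' w)) * degree_part j (\<Sum>u\<in>K. Poly_Mapping.single u (h u))"
    for K K' and h h' :: "('v, 'e) generator list \<Rightarrow> 'f"
    unfolding degree_part_sum sum_product by (intro sum.cong) (auto simp: mult_single plus_list_def)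
  from this[where K = "Poly_Mapping.keys p" and h = "Poly_Mapping.lookup p"
      and K' = "Poly_Mapping.keys q" and h' = "Poly_Mapping.lookup q"]
  show ?thesis unfolding poly_expand[symmetric] .
qed

section \<open>Calculations in Leavitt path algebras\<close>

text \<open>The argument \<open>F\<close> fixes the coefficient field, which neither the graph nor
  the specialization mentions.\<close>

locale leavitt_graph = fin_digraph G for G :: "('v, 'e) pre_digraph" +
  fixes \<gamma> :: "'v \<Rightarrow> 'e" and F :: "'f::field itself"
  assumes specialization: "specialization G \<gamma>"
begin

type_synonym ('a, 'b, 'c) wpoly = "('b, 'c) generator list \<Rightarrow>\<^sub>0 'a"

definition FA :: "('f, 'v, 'e) wpoly set" where
  "FA = {p. Poly_Mapping.keys p \<subseteq> lists (generators G) - {[]}}"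

definition words :: "('v, 'e) generator list set" where
  "words = lists (generators G) - {[]}"

lemma FA_iff: "p \<in> FA \<longleftrightarrow> Poly_Mapping.keys p \<subseteq> words" by (simp add: FA_def words_def)

lemma monomial_FA [simp]: "monomial w \<in> FA \<longleftrightarrow> w \<in> words" by (simp add: FA_iff)

lemma FA_subsp: "poly.subsp FA"
proof -
  show ?thesis
    unfolding poly.subsp_def FA_iff
  proof (intro conjI ballI allI)
    show "Poly_Mapping.keys (0 :: ('f, 'v, 'e) wpoly) \<subseteq> words" by simp
    show "Poly_Mapping.keys (x + y) \<subseteq> words" if "x \<in> FA" "y \<in> FA" for x y
      using that keys_add[of x y] unfolding FA_iff by blast
    show "Poly_Mapping.keys (scal c x) \<subseteq> words" if "x \<in> FA" for c x
      using that unfolding FA_iff by (auto simp: in_keys_iff)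
  qed
qed

lemma FA_subalg: "poly.subalg FA"
proof -
  have "p * q \<in> FA" if "p \<in> FA" "q \<in> FA" for p q
    using that keys_mult[of p q] by (fastforce simp: FA_def plus_list_def)
  then show ?thesis by (simp add: poly.subalg_def FA_subsp)
qed

sublocale FA: presentation scal FA "free_algebra (generators G)" "\<lambda>p. p"
  by unfold_locales (simp_all add: FA_subalg free_algebra_def FA_def[symmetric])

definition rel_ideal :: "('f, 'v, 'e) wpoly set" where "rel_ideal = leavitt_ideal G"

lemma words_simps [simp]:
  "[] \<notin> words" "g # w \<in> words \<longleftrightarrow> g \<in> generators G \<and> set w \<subseteq> generators G"
  "u \<noteq> [] \<Longrightarrow> w \<noteq> [] \<Longrightarrow> u @ w \<in> words \<longleftrightarrow> u \<in> words \<and> w \<in> words"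
  by (auto simp: words_def)

lemma generators_simps [simp]:
  "Vert v \<in> generators G \<longleftrightarrow> v \<in> verts G" "Edge e \<in> generators G \<longleftrightarrow> e \<in> arcs G"
  "Ghost e \<in> generators G \<longleftrightarrow> e \<in> arcs G"
  by (auto simp: generators_def)

lemma relations_FA: "leavitt_relations G \<subseteq> FA"
proof -
  have "(\<Sum>e\<in>out_arcs G v. gedge e * gghost e) \<in> FA" for v
    by (rule poly.subsp_sum[OF FA_subsp]) (simp add: monomial_mult)
  then show ?thesis
    unfolding leavitt_relations_def
    by (auto simp: monomial_mult FA.S_closed(1) intro!: FA.S_closed(5))
qed

lemma FA_pre: "U \<subseteq> FA \<Longrightarrow> FA.pre U = U" by (auto simp: FA.pre_def)

lemma carrier_FA: "carrier (free_algebra (generators G)) = FA" by (simp add: FA.carrier_eq)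

lemma rel_ideal_min: assumes "poly.ideal_in FA K" "leavitt_relations G \<subseteq> K" shows "rel_ideal \<subseteq> K"
proof -
  have "K \<subseteq> FA" using assms(1) by (simp add: poly.ideal_in_def)
  then have "two_sided_ideal (free_algebra (generators G)) K"
    using assms(1) by (simp add: FA.two_sided_ideal_iff carrier_FA FA_pre)
  then show ?thesis unfolding rel_ideal_def leavitt_ideal_def by (intro hull_minimal assms(2))
qed

lemma rel_ideal_two_sided: "two_sided_ideal (free_algebra (generators G)) rel_ideal"
proof -
  let ?F = "{J. two_sided_ideal (free_algebra (generators G)) J \<and> leavitt_relations G \<subseteq> J}"
  have D: "J \<subseteq> FA \<and> poly.ideal_in FA J" if "J \<in> ?F" for J
    using that by (auto simp: FA.two_sided_ideal_iff carrier_FA FA_pre)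
  have rel_ideal: "rel_ideal = \<Inter>?F" by (simp add: rel_ideal_def leavitt_ideal_def hull_def)
  have "poly.ideal_in FA FA"
    using FA.S_closed by (simp add: poly.ideal_in_def FA_subsp)
  then have "FA \<in> ?F" using relations_FA by (simp add: FA.two_sided_ideal_iff carrier_FA FA_pre)
  then have sub: "rel_ideal \<subseteq> FA" unfolding rel_ideal by blast
  have "poly.ideal_in FA rel_ideal"
    unfolding poly.ideal_in_def poly.subsp_def
  proof (intro conjI ballI allI)
    show "0 \<in> rel_ideal" unfolding rel_ideal using D by (auto simp: poly.ideal_in_def poly.subsp_def)
    show "rel_ideal \<subseteq> FA" by (rule sub)
    show "x + y \<in> rel_ideal" if "x \<in> rel_ideal" "y \<in> rel_ideal" for x y
      using that D unfolding rel_ideal poly.ideal_in_def poly.subsp_def by simp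
    show "scal c x \<in> rel_ideal" if "x \<in> rel_ideal" for x c
      using that D unfolding rel_ideal poly.ideal_in_def poly.subsp_def by simp
    show "a * x \<in> rel_ideal" "x * a \<in> rel_ideal" if "a \<in> FA" "x \<in> rel_ideal" for a x
      using that D unfolding rel_ideal poly.ideal_in_def by simp_all
  qed
  then show ?thesis using sub by (simp add: FA.two_sided_ideal_iff carrier_FA FA_pre)
qed

lemma rel_ideal_ideal: "poly.ideal_in FA rel_ideal"
  using rel_ideal_two_sided FA.two_sided_ideal_iff[of rel_ideal] FA_pre[of rel_ideal] by (simp add: carrier_FA)

lemma rel_ideal_subsp: "poly.subsp rel_ideal" and rel_ideal_sub: "rel_ideal \<subseteq> FA"
  using rel_ideal_ideal by (auto simp: poly.ideal_in_def)

lemmas rel_ideal_closed = poly.subspD[OF rel_ideal_subsp]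

lemma rel_ideal_mult: "a \<in> FA \<Longrightarrow> x \<in> rel_ideal \<Longrightarrow> a * x \<in> rel_ideal" "a \<in> FA \<Longrightarrow> x \<in> rel_ideal \<Longrightarrow> x * a \<in> rel_ideal"
  using rel_ideal_ideal by (auto simp: poly.ideal_in_def)

lemma relations_rel_ideal: "leavitt_relations G \<subseteq> rel_ideal"
  unfolding rel_ideal_def leavitt_ideal_def by (rule hull_subset)

abbreviation lc :: "('f, 'v, 'e) wpoly \<Rightarrow> ('f, 'v, 'e) wpoly set" where "lc \<equiv> leavitt_class G"

lemma leavitt_presentation: "presentation scal FA (leavitt G) lc"
proof -
  have "lc = (\<lambda>x. rel_ideal +>\<^bsub>free_algebra (generators G)\<^esub> x)"
    by (simp add: fun_eq_iff leavitt_class_def rel_ideal_def)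
  then show ?thesis
    using FA.presentation_quot[OF rel_ideal_two_sided] by (simp add: leavitt_def rel_ideal_def)
qed

sublocale LP: presentation scal FA "leavitt G" lc by (rule leavitt_presentation)

lemma lc_eq_iff: "x \<in> FA \<Longrightarrow> y \<in> FA \<Longrightarrow> lc x = lc y \<longleftrightarrow> x - y \<in> rel_ideal"
  using FA.coset_eq_iff[of rel_ideal x y] rel_ideal_two_sided FA_pre[OF rel_ideal_sub]
  by (simp add: two_sided_ideal_def leavitt_class_def rel_ideal_def)

text \<open>Calculations in the Leavitt path algebra are carried out as congruences between
  polynomials. The side conditions about \<open>FA\<close> in the product rules come from the fact
  that \<open>rel_ideal\<close> is an ideal of \<open>FA\<close>.\<close>

definition eqv :: "('f, 'v, 'e) wpoly \<Rightarrow> ('f, 'v, 'e) wpoly \<Rightarrow> bool" (infix \<open>\<doteq>\<close> 50) where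
  "x \<doteq> y \<longleftrightarrow> x - y \<in> rel_ideal"

lemma eqv_refl [simp]: "x \<doteq> x" by (simp add: eqv_def rel_ideal_closed)

lemma eqv_sym: "x \<doteq> y \<Longrightarrow> y \<doteq> x" using rel_ideal_closed(4)[of "x - y"] by (simp add: eqv_def)

lemma eqv_trans [trans]: "x \<doteq> y \<Longrightarrow> y \<doteq> z \<Longrightarrow> x \<doteq> z"
  using rel_ideal_closed(2)[of "x - y" "y - z"] by (simp add: eqv_def)

lemma eqv_add: "x \<doteq> y \<Longrightarrow> x' \<doteq> y' \<Longrightarrow> x + x' \<doteq> y + y'"
  using rel_ideal_closed(2)[of "x - y" "x' - y'"] by (simp add: eqv_def algebra_simps)

lemma eqv_diff: "x \<doteq> y \<Longrightarrow> x' \<doteq> y' \<Longrightarrow> x - x' \<doteq> y - y'"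
  using rel_ideal_closed(5)[of "x - y" "x' - y'"] by (simp add: eqv_def algebra_simps)

lemma eqv_scal: "x \<doteq> y \<Longrightarrow> scal c x \<doteq> scal c y"
  using rel_ideal_closed(3)[of "x - y" c] by (simp add: eqv_def poly.sc_diff_right)

lemma eqv_sum: "(\<And>i. i \<in> D \<Longrightarrow> f i \<doteq> g i) \<Longrightarrow> sum f D \<doteq> sum g D"
  by (induction D rule: infinite_finite_induct) (simp_all add: eqv_add)

lemma eqv_mult_left: "a \<in> FA \<Longrightarrow> x \<doteq> y \<Longrightarrow> a * x \<doteq> a * y"
  using rel_ideal_mult(1)[of a "x - y"] by (simp add: eqv_def right_diff_distrib)

lemma eqv_mult_right: "a \<in> FA \<Longrightarrow> x \<doteq> y \<Longrightarrow> x * a \<doteq> y * a"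
  using rel_ideal_mult(2)[of a "x - y"] by (simp add: eqv_def left_diff_distrib)

lemma eqv_zero_iff: "x \<doteq> 0 \<longleftrightarrow> x \<in> rel_ideal" by (simp add: eqv_def)

lemma eqv_relations:
  "v \<in> verts G \<Longrightarrow> w \<in> verts G \<Longrightarrow> gvert v * gvert w \<doteq> (if v = w then gvert v else 0)"
  "e \<in> arcs G \<Longrightarrow> gvert (tail G e) * gedge e \<doteq> gedge e"
  "e \<in> arcs G \<Longrightarrow> gedge e * gvert (head G e) \<doteq> gedge e"
  "e \<in> arcs G \<Longrightarrow> gvert (head G e) * gghost e \<doteq> gghost e"
  "e \<in> arcs G \<Longrightarrow> gghost e * gvert (tail G e) \<doteq> gghost e"
  "e \<in> arcs G \<Longrightarrow> f \<in> arcs G \<Longrightarrow> gghost e * gedge f \<doteq> (if e = f then gvert (head G e) else 0)"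
  "v \<in> verts G \<Longrightarrow> \<not> sink G v \<Longrightarrow> gvert v \<doteq> (\<Sum>e\<in>out_arcs G v. gedge e * gghost e)"
  unfolding eqv_def using relations_rel_ideal unfolding leavitt_relations_def by blast+

end

section \<open>The involution and products of paths\<close>

definition star_word :: "('v, 'e) generator list \<Rightarrow> ('v, 'e) generator list" where
  "star_word w = rev (map generator_star w)"

lemma generator_star_star [simp]: "generator_star (generator_star g) = g"
  by (cases g) auto

lemma star_word_star [simp]: "star_word (star_word w) = w"
  by (simp add: star_word_def rev_map o_def)

lemma star_word_append: "star_word (u @ w) = star_word w @ star_word u"
  by (simp add: star_word_def)

lemma inj_star_word: "inj star_word" by (metis injI star_word_star)

text \<open>Coefficients are pulled back along \<open>star_word\<close>; this is the linear
  extension of \<open>star_word\<close> because that map is its own inverse.\<close>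

definition star :: "(('v, 'e) generator list \<Rightarrow>\<^sub>0 'f::field) \<Rightarrow> (('v, 'e) generator list \<Rightarrow>\<^sub>0 'f)" where
  "star p = Poly_Mapping.map_key star_word p"

lemma lookup_star: "Poly_Mapping.lookup (star p) w = Poly_Mapping.lookup p (star_word w)"
  by (simp add: star_def map_key.rep_eq[OF inj_star_word])

lemma star_star [simp]: "star (star p) = p"
  by (rule poly_mapping_eqI) (simp add: lookup_star)

lemma star_add: "star (p + q) = star p + star q"
  by (rule poly_mapping_eqI) (simp add: lookup_star lookup_add)

lemma star_diff: "star (p - q) = star p - star q"
  by (rule poly_mapping_eqI) (simp add: lookup_star lookup_minus)

lemma star_zero [simp]: "star 0 = 0"
  by (rule poly_mapping_eqI) (simp add: lookup_star)

lemma star_scal: "star (scal c p) = scal c (star p)"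
  by (rule poly_mapping_eqI) (simp add: lookup_star)

lemma star_sum: "star (sum f D) = (\<Sum>d\<in>D. star (f d))"
  by (induction D rule: infinite_finite_induct) (simp_all add: star_add)

lemma star_single [simp]: "star (Poly_Mapping.single w c) = Poly_Mapping.single (star_word w) c"
  by (rule poly_mapping_eqI) (auto simp: lookup_star lookup_single when_def)

lemma star_mult:
  fixes p q :: "('v, 'e) generator list \<Rightarrow>\<^sub>0 'f::field"
  shows "star (p * q) = star q * star p"
proof -
  have "star ((\<Sum>u\<in>K. Poly_Mapping.single u (h u)) * (\<Sum>w\<in>K'. Poly_Mapping.single w (h' w)))
    = star (\<Sum>w\<in>K'. Poly_Mapping.single w (h' w)) * star (\<Sum>u\<in>K. Poly_Mapping.single u (h u))"
    for K K' and h h' :: "('v, 'e) generator list \<Rightarrow> 'f"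
    unfolding star_sum sum_product
    by (subst sum.swap) (simp add: mult_single plus_list_def star_word_append mult.commute star_sum)
  from this[where K = "Poly_Mapping.keys p" and h = "Poly_Mapping.lookup p"
      and K' = "Poly_Mapping.keys q" and h' = "Poly_Mapping.lookup q"]
  show ?thesis unfolding poly_expand[symmetric] .
qed

context leavitt_graph
begin

lemma star_word_words [simp]: "star_word w \<in> words \<longleftrightarrow> w \<in> words"
proof -
  have g: "generator_star g \<in> generators G" if "g \<in> generators G" for g
    using that by (cases g) auto
  have "star_word w \<in> words" if "w \<in> words" for w
    using that g by (auto simp: words_def star_word_def)
  then show ?thesis by (metis star_word_star)
qed

lemma star_FA: "p \<in> FA \<Longrightarrow> star p \<in> FA"
  by (auto simp: FA_iff in_keys_iff lookup_star subset_iff)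

text \<open>The involution permutes the defining relations, so the ideal they generate is stable.
  Afterwards each rule for products with paths yields its mirror image for free.\<close>

lemma star_rel_ideal: assumes "x \<in> rel_ideal" shows "star x \<in> rel_ideal"
proof -
  define K where "K = {p \<in> FA. star p \<in> rel_ideal}"
  have "poly.ideal_in FA K"
    using rel_ideal_mult star_FA
    by (auto simp: K_def poly.ideal_in_def poly.subsp_def star_add star_scal star_mult
        rel_ideal_closed FA.S_closed)
  moreover have "leavitt_relations G \<subseteq> K"
  proof
    fix r :: "('f, 'v, 'e) wpoly" assume r: "r \<in> leavitt_relations G"
    have "star r \<in> leavitt_relations G"
      using r[unfolded leavitt_relations_def]
    proof (elim UnE UN_E insertE)
      assume "r \<in> {gvert v * gvert w - (if v = w then gvert v else 0) | v w. v \<in> verts G \<and> w \<in> verts G}"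
      then obtain v w where r: "r = gvert v * gvert w - (if v = w then gvert v else 0)" "v \<in> verts G" "w \<in> verts G"
        by blast
      have "star r = gvert w * gvert v - (if w = v then gvert w else 0)"
        using r by (simp add: star_diff star_mult star_word_def)
      then show "star r \<in> leavitt_relations G" unfolding leavitt_relations_def using r by blast
    next
      assume "r \<in> {gghost e * gedge f - (if e = f then gvert (head G e) else 0) | e f. e \<in> arcs G \<and> f \<in> arcs G}"
      then obtain e f where r: "r = gghost e * gedge f - (if e = f then gvert (head G e) else 0)" "e \<in> arcs G" "f \<in> arcs G"
        by blast
      have "star r = gghost f * gedge e - (if f = e then gvert (head G f) else 0)"
        using r by (simp add: star_diff star_mult star_word_def)
      then show "star r \<in> leavitt_relations G" unfolding leavitt_relations_def using r by blast
    next
      assume "r \<in> {gvert v - (\<Sum>e\<in>out_arcs G v. gedge e * gghost e) | v. v \<in> verts G \<and> \<not> sink G v}"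
      then obtain v where r: "r = gvert v - (\<Sum>e\<in>out_arcs G v. gedge e * gghost e)" "v \<in> verts G" "\<not> sink G v"
        by blast
      have "star r = r" using r by (simp add: star_diff star_sum star_mult star_word_def)
      then show "star r \<in> leavitt_relations G" using \<open>r \<in> leavitt_relations G\<close> by simp
    qed (auto simp: star_diff star_mult star_word_def leavitt_relations_def)
    then show "r \<in> K" using r relations_FA relations_rel_ideal by (auto simp: K_def)
  qed
  ultimately show ?thesis using rel_ideal_min assms by (auto simp: K_def)
qed

lemma eqv_star: "x \<doteq> y \<Longrightarrow> star x \<doteq> star y"
  using star_rel_ideal[of "x - y"] by (simp add: eqv_def star_diff)

fun endv :: "'v \<Rightarrow> 'e list \<Rightarrow> 'v" where
  "endv u [] = u"
| "endv u (e # es) = endv (head G e) es"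

lemma endv_append [simp]: "endv u (es @ fs) = endv (endv u es) fs"
  by (induction es arbitrary: u) auto

definition isp :: "'v \<Rightarrow> 'e list \<Rightarrow> bool" where "isp u es \<longleftrightarrow> (u, es) \<in> paths G"

lemma isp_Nil [simp]: "isp u [] \<longleftrightarrow> u \<in> verts G"
  by (auto simp: isp_def paths_def awalk_def)

lemma isp_Cons [simp]: "isp u (e # es) \<longleftrightarrow> e \<in> arcs G \<and> u = tail G e \<and> isp (head G e) es"
  by (auto simp: isp_def paths_def awalk_def)

lemma isp_append: "isp u (es @ fs) \<longleftrightarrow> isp u es \<and> isp (endv u es) fs"
proof (induction es arbitrary: u)
  case Nil
  show ?case by (auto simp: isp_def paths_def awalk_def)
qed auto

lemma isp_verts: "isp u es \<Longrightarrow> u \<in> verts G" "isp u es \<Longrightarrow> endv u es \<in> verts G"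
  by (induction es arbitrary: u) auto

definition pm :: "'v \<Rightarrow> 'e list \<Rightarrow> ('f, 'v, 'e) wpoly" where "pm u es = monomial (path_word (u, es))"
definition sm :: "'v \<Rightarrow> 'e list \<Rightarrow> ('f, 'v, 'e) wpoly" where "sm u es = monomial (path_star_word (u, es))"

lemma pm_Nil [simp]: "pm u [] = gvert u" and sm_Nil [simp]: "sm u [] = gvert u"
  by (simp_all add: pm_def sm_def path_word_def path_star_word_def)

lemma star_pm [simp]: "star (pm u es) = sm u es" and star_sm [simp]: "star (sm u es) = pm u es"
proof -
  show "star (pm u es) = sm u es" by (simp add: pm_def sm_def path_star_word_def star_word_def)
  then show "star (sm u es) = pm u es" by (metis star_star)
qed

lemma isp_arcs: "isp u es \<Longrightarrow> e \<in> set es \<Longrightarrow> e \<in> arcs G"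
  by (induction es arbitrary: u) auto

lemma isp_words: assumes "isp u es" shows "path_word (u, es) \<in> words"
proof -
  have "Edge ` set es \<subseteq> generators G" using isp_arcs[OF assms] by auto
  then show ?thesis using isp_verts(1)[OF assms]
    by (auto simp: path_word_def words_def simp del: generators_simps(2))
qed

lemma pm_FA: "isp u es \<Longrightarrow> pm u es \<in> FA" by (simp add: pm_def isp_words)

lemma sm_FA: "isp u es \<Longrightarrow> sm u es \<in> FA" using star_FA[OF pm_FA] by simp

lemma gens_FA [simp]: "v \<in> verts G \<Longrightarrow> gvert v \<in> FA" "e \<in> arcs G \<Longrightarrow> gedge e \<in> FA"
  "e \<in> arcs G \<Longrightarrow> gghost e \<in> FA" by simp_all

lemma star_gens [simp]: "star (gvert v) = gvert v" "star (gedge e) = gghost e" "star (gghost e) = gedge e"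
  by (simp_all add: star_word_def)

text \<open>A vertex is represented by a one-letter word, not by the empty word. For
  \<open>es = []\<close> the left side therefore has an extra letter that only a relation removes;
  hence a congruence and not an equality.\<close>

lemma pm_Cons: assumes "isp (tail G e) (e # es)" shows "gedge e * pm (head G e) es \<doteq> pm (tail G e) (e # es)"
proof (cases es)
  case Nil
  then show ?thesis using assms eqv_relations(3)[of e] by (simp add: pm_def path_word_def)
next
  case (Cons f fs)
  then show ?thesis by (simp add: pm_def path_word_def monomial_mult)
qed

lemma sm_Cons: assumes "isp (tail G e) (e # es)" shows "sm (head G e) es * gghost e \<doteq> sm (tail G e) (e # es)"
  using eqv_star[OF pm_Cons[OF assms]] by (simp add: star_mult star_word_def)

lemma gvert_gedge:
  assumes "v \<in> verts G" "e \<in> arcs G"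
  shows "gvert v * gedge e \<doteq> (if v = tail G e then gedge e else 0)"
proof -
  have "gvert v * gedge e \<doteq> gvert v * (gvert (tail G e) * gedge e)"
    using assms by (intro eqv_mult_left eqv_sym[OF eqv_relations(2)]) auto
  also have "\<dots> = (gvert v * gvert (tail G e)) * gedge e" by (simp only: mult.assoc)
  also have "\<dots> \<doteq> (if v = tail G e then gvert v else 0) * gedge e"
    using assms by (intro eqv_mult_right eqv_relations(1)) auto
  also have "\<dots> \<doteq> (if v = tail G e then gedge e else 0)"
    using assms eqv_relations(2)[of e] by auto
  finally show ?thesis .
qed

lemma gvert_pm:
  assumes "v \<in> verts G" "isp u es"
  shows "gvert v * pm u es \<doteq> (if v = u then pm u es else 0)"
proof (cases es)
  case Nil
  then show ?thesis using assms eqv_relations(1)[of v u] by (auto dest: isp_verts)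
next
  case (Cons e es')
  have p: "isp (tail G e) (e # es')" and u: "u = tail G e" and e: "e \<in> arcs G" using assms Cons by auto
  have "gvert v * pm u es \<doteq> gvert v * (gedge e * pm (head G e) es')"
    unfolding Cons u using assms by (intro eqv_mult_left eqv_sym[OF pm_Cons[OF p]]) auto
  also have "\<dots> = (gvert v * gedge e) * pm (head G e) es'" by (simp only: mult.assoc)
  also have "\<dots> \<doteq> (if v = tail G e then gedge e else 0) * pm (head G e) es'"
    using assms e p by (intro eqv_mult_right gvert_gedge pm_FA) auto
  also have "\<dots> \<doteq> (if v = u then pm u es else 0)"
    using pm_Cons[OF p] by (simp add: Cons u)
  finally show ?thesis .
qed

lemma pm_pm:
  assumes "isp u es" "isp v fs"
  shows "pm u es * pm v fs \<doteq> (if v = endv u es then pm u (es @ fs) else 0)"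
  using assms(1)
proof (induction es arbitrary: u)
  case Nil
  then show ?case using gvert_pm[OF _ assms(2), of u] by auto
next
  case (Cons e es)
  then have p: "isp (tail G e) (e # es)" and u: "u = tail G e" and e: "e \<in> arcs G" by auto
  have "pm u (e # es) * pm v fs \<doteq> (gedge e * pm (head G e) es) * pm v fs"
    unfolding u using assms by (intro eqv_mult_right eqv_sym[OF pm_Cons[OF p]] pm_FA)
  also have "\<dots> = gedge e * (pm (head G e) es * pm v fs)" by (simp only: mult.assoc)
  also have "\<dots> \<doteq> gedge e * (if v = endv (head G e) es then pm (head G e) (es @ fs) else 0)"
    using Cons e by (intro eqv_mult_left Cons.IH) auto
  also have "\<dots> \<doteq> (if v = endv u (e # es) then pm u ((e # es) @ fs) else 0)"
    using pm_Cons[of e "es @ fs"] p assms by (cases "v = endv (head G e) es") (auto simp: u isp_append)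
  finally show ?case .
qed

lemma sm_sm:
  assumes "isp u es" "isp v fs"
  shows "sm v fs * sm u es \<doteq> (if v = endv u es then sm u (es @ fs) else 0)"
  using eqv_star[OF pm_pm[OF assms]] by (cases "v = endv u es") (simp_all add: star_mult)

lemma pm_gvert: "isp u es \<Longrightarrow> v \<in> verts G \<Longrightarrow> pm u es * gvert v \<doteq> (if v = endv u es then pm u es else 0)"
  using pm_pm[of u es v "[]"] by (cases "v = endv u es") auto

lemma sm_gvert: "isp u es \<Longrightarrow> v \<in> verts G \<Longrightarrow> sm u es * gvert v \<doteq> (if v = u then sm u es else 0)"
  using sm_sm[of v "[]" u es] by (cases "v = u") auto

lemma gghost_pm:
  assumes "e \<in> arcs G" "isp u (f # fs)"
  shows "gghost e * pm u (f # fs) \<doteq> (if e = f then pm (head G f) fs else 0)"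
proof -
  have p: "isp (tail G f) (f # fs)" and u: "u = tail G f" and f: "f \<in> arcs G" using assms by auto
  have "gghost e * pm u (f # fs) \<doteq> gghost e * (gedge f * pm (head G f) fs)"
    unfolding u using assms by (intro eqv_mult_left eqv_sym[OF pm_Cons[OF p]]) auto
  also have "\<dots> = (gghost e * gedge f) * pm (head G f) fs" by (simp only: mult.assoc)
  also have "\<dots> \<doteq> (if e = f then gvert (head G e) else 0) * pm (head G f) fs"
    using assms p by (intro eqv_mult_right eqv_relations(6) pm_FA) auto
  also have "\<dots> \<doteq> (if e = f then pm (head G f) fs else 0)"
    using p gvert_pm[of "head G f" "head G f" fs] isp_verts by auto
  finally show ?thesis .
qed

lemma sm_pm_prefix:
  assumes "isp u (es @ fs)"
  shows "sm u es * pm u (es @ fs) \<doteq> pm (endv u es) fs"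
  using assms
proof (induction es arbitrary: u)
  case Nil
  then show ?case using gvert_pm[of u u fs] isp_verts by auto
next
  case (Cons e es)
  then have p: "isp (tail G e) (e # es @ fs)" and u: "u = tail G e" and e: "e \<in> arcs G"
    and q: "isp (tail G e) (e # es)" by (auto simp: isp_append)
  have "sm u (e # es) * pm u ((e # es) @ fs) \<doteq> (sm (head G e) es * gghost e) * pm u (e # es @ fs)"
    unfolding u append_Cons using p by (intro eqv_mult_right eqv_sym[OF sm_Cons[OF q]] pm_FA)
  also have "\<dots> = sm (head G e) es * (gghost e * pm u (e # es @ fs))" by (simp only: mult.assoc)
  also have "\<dots> \<doteq> sm (head G e) es * pm (head G e) (es @ fs)"
    using gghost_pm[OF e, of u e "es @ fs"] p q by (intro eqv_mult_left sm_FA) (auto simp: u)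
  also have "\<dots> \<doteq> pm (endv u (e # es)) fs" using Cons.IH[of "head G e"] p by simp
  finally show ?case .
qed

lemma sm_pm_prefix':
  "isp u (es @ fs) \<Longrightarrow> sm u (es @ fs) * pm u es \<doteq> sm (endv u es) fs"
  using eqv_star[OF sm_pm_prefix[of u es fs]] by (simp add: star_mult)

lemma sm_pm_same: "isp u es \<Longrightarrow> sm u es * pm u es \<doteq> gvert (endv u es)"
  using sm_pm_prefix[of u es "[]"] by simp

text \<open>Edges are cancelled one by one up to the first difference: there either two distinct
  edges meet and \<open>e\<^sup>* f = 0\<close>, or a vertex meets a path with another
  source.\<close>

lemma sm_pm_zero:
  assumes "isp u es" "isp v fs" "\<not> (u = v \<and> ((\<exists>gs. fs = es @ gs) \<or> (\<exists>gs. es = fs @ gs)))"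
  shows "sm u es * pm v fs \<doteq> 0"
  using assms
proof (induction es arbitrary: u v fs)
  case Nil
  then show ?case using gvert_pm[of u v fs] by auto
next
  case (Cons e es)
  then have u: "u = tail G e" and e: "e \<in> arcs G" and q: "isp (tail G e) (e # es)"
    and h: "isp (head G e) es" by auto
  show ?case
  proof (cases fs)
    case Nil
    then show ?thesis using sm_gvert[of u "e # es" v] Cons.prems by auto
  next
    case (Cons f fs')
    have f: "isp (tail G f) (f # fs')" "v = tail G f" using Cons.prems(2) Cons by auto
    have "sm u (e # es) * pm v fs \<doteq> (sm (head G e) es * gghost e) * pm v fs"
      unfolding u using Cons.prems by (intro eqv_mult_right eqv_sym[OF sm_Cons[OF q]] pm_FA)
    also have "\<dots> = sm (head G e) es * (gghost e * pm v fs)" by (simp only: mult.assoc)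
    also have "\<dots> \<doteq> sm (head G e) es * (if e = f then pm (head G f) fs' else 0)"
      unfolding Cons using f e h by (intro eqv_mult_left sm_FA gghost_pm) auto
    also have "\<dots> \<doteq> 0"
    proof (cases "e = f")
      case True
      have "sm (head G e) es * pm (head G e) fs' \<doteq> 0"
        using Cons.prems(3) f True Cons u h by (intro Cons.IH) auto
      then show ?thesis using True by simp
    qed simp
    finally show ?thesis .
  qed
qed

section \<open>The representation on eventually special paths\<close>

abbreviation special :: "'e set" where "special \<equiv> special_arcs G \<gamma>"

lemma special_iff: "e \<in> special \<longleftrightarrow> e \<in> arcs G \<and> e = \<gamma> (tail G e)"
proof
  assume "e \<in> special"
  then obtain v where v: "v \<in> verts G" "\<not> sink G v" "e = \<gamma> v" by (auto simp: special_arcs_def)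
  then have "e \<in> out_arcs G v" using specialization by (auto simp: specialization_def)
  then show "e \<in> arcs G \<and> e = \<gamma> (tail G e)" using v by auto
next
  assume e: "e \<in> arcs G \<and> e = \<gamma> (tail G e)"
  then have "\<not> sink G (tail G e)" by (auto simp: sink_def)
  then show "e \<in> special" using e unfolding special_arcs_def by (metis (mono_tags, lifting) image_eqI mem_Collect_eq tail_in_verts)
qed

lemma \<gamma>_out: assumes "v \<in> verts G" "\<not> sink G v"
  shows "\<gamma> v \<in> arcs G" "tail G (\<gamma> v) = v" "\<gamma> v \<in> special"
proof -
  show 1: "\<gamma> v \<in> arcs G" "tail G (\<gamma> v) = v"
    using assms specialization by (auto simp: specialization_def)
  then show "\<gamma> v \<in> special" by (simp add: special_iff)
qed

text \<open>A state \<open>(u, p)\<close> stands for the path \<open>p\<close> from \<open>u\<close> followed by the maximal special path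
  that starts where \<open>p\<close> ends.\<close>

definition states :: "('v \<times> 'e list) set" where
  "states = {(u, p). isp u p \<and> (p = [] \<or> last p \<notin> special)}"

text \<open>\<open>None\<close> stands for zero. A special edge in front of an empty list is not
  recorded, since the maximal special path from its source already begins with it; dually,
  \<open>Ghost e\<close> acts on an empty list by removing the first edge of the special path, which
  must be \<open>e\<close>.\<close>

fun step :: "('v, 'e) generator \<Rightarrow> 'v \<times> 'e list \<Rightarrow> ('v \<times> 'e list) option" where
  "step (Vert v) (u, p) = (if u = v then Some (u, p) else None)"
| "step (Edge e) (u, p) = (if u = head G e then
     Some (tail G e, if p = [] \<and> e \<in> special then [] else e # p) else None)"
| "step (Ghost e) (u, []) = (if u = tail G e \<and> e \<in> special then Some (head G e, []) else None)"
| "step (Ghost e) (u, f # p) = (if e = f then Some (head G e, p) else None)"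

fun act :: "('v, 'e) generator list \<Rightarrow> 'v \<times> 'e list \<Rightarrow> ('v \<times> 'e list) option" where
  "act [] x = Some x"
| "act (g # w) x = (case act w x of None \<Rightarrow> None | Some y \<Rightarrow> step g y)"

lemma act_append: "act (u @ w) x = (case act w x of None \<Rightarrow> None | Some y \<Rightarrow> act u y)"
  by (induction u) (auto split: option.splits)

lemma step_states: "g \<in> generators G \<Longrightarrow> x \<in> states \<Longrightarrow> step g x = Some y \<Longrightarrow> y \<in> states"
  by (cases g; cases x; cases "snd x") (auto simp: states_def split: if_splits)

lemma act_states: "set w \<subseteq> generators G \<Longrightarrow> x \<in> states \<Longrightarrow> act w x = Some y \<Longrightarrow> y \<in> states"
  by (induction w arbitrary: y) (auto split: option.splits intro: step_states)

text \<open>The action in transposed form: this is the value at \<open>p x\<close> of the functional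
  that takes the values \<open>\<phi>\<close> on the states. Formal sums of states are avoided in
  this way, and \<open>rep_mult\<close> applies the right factor to the state first.\<close>

definition rep :: "('f, 'v, 'e) wpoly \<Rightarrow> ('v \<times> 'e list \<Rightarrow> 'f) \<Rightarrow> 'v \<times> 'e list \<Rightarrow> 'f" where
  "rep p \<phi> x = linext (\<lambda>w. case act w x of None \<Rightarrow> 0 | Some y \<Rightarrow> \<phi> y) p"

lemma rep_add: "rep (p + q) \<phi> x = rep p \<phi> x + rep q \<phi> x" by (simp add: rep_def linext_add)
lemma rep_diff: "rep (p - q) \<phi> x = rep p \<phi> x - rep q \<phi> x" by (simp add: rep_def linext_diff)
lemma rep_scal: "rep (scal c p) \<phi> x = c * rep p \<phi> x" by (simp add: rep_def linext_scal)
lemma rep_zero [simp]: "rep 0 \<phi> x = 0" by (simp add: rep_def)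
lemma rep_sum: "rep (sum f D) \<phi> x = (\<Sum>d\<in>D. rep (f d) \<phi> x)" by (simp add: rep_def linext_sum)
lemma rep_monomial: "rep (monomial w) \<phi> x = (case act w x of None \<Rightarrow> 0 | Some y \<Rightarrow> \<phi> y)"
  by (simp add: rep_def)

lemma rep_mult: "rep (p * q) \<phi> x = rep q (rep p \<phi>) x"
proof -
  have "linext (\<lambda>u. case act (u @ w) x of None \<Rightarrow> 0 | Some y \<Rightarrow> \<phi> y) p =
     (case act w x of None \<Rightarrow> 0 | Some y \<Rightarrow> rep p \<phi> y)" for w
    by (cases "act w x") (simp_all add: act_append rep_def linext_def)
  then show ?thesis unfolding rep_def linext_mult by simp
qed

lemma rep_eq_zero:
  assumes "set ` Poly_Mapping.keys p \<subseteq> Pow (generators G)" "x \<in> states" "\<And>y. y \<in> states \<Longrightarrow> \<phi> y = 0"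
  shows "rep p \<phi> x = 0"
proof -
  have "(case act w x of None \<Rightarrow> 0 | Some y \<Rightarrow> \<phi> y) = 0" if "w \<in> Poly_Mapping.keys p" for w
  proof (cases "act w x")
    case (Some y)
    have "set w \<subseteq> generators G" using assms(1) that by blast
    then show ?thesis using act_states[OF _ assms(2) Some] assms(3) Some by simp
  qed simp
  then show ?thesis unfolding rep_def linext_def by (simp add: sum.neutral)
qed

lemma rep_rel_ideal: assumes "p \<in> rel_ideal" "x \<in> states" shows "rep p \<phi> x = 0"
proof -
  define K where "K = {p \<in> FA. \<forall>x\<in>states. \<forall>\<phi>. rep p \<phi> x = 0}"
  have gen: "set ` Poly_Mapping.keys p \<subseteq> Pow (generators G)" if "p \<in> FA" for p
    using that by (auto simp: FA_def)
  have KI: "poly.ideal_in FA K"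
    unfolding poly.ideal_in_def poly.subsp_def
  proof (intro conjI ballI allI)
    show "a * x \<in> K" "x * a \<in> K" if "a \<in> FA" "x \<in> K" for a x
      using that rep_eq_zero[OF gen[OF \<open>a \<in> FA\<close>]] by (auto simp: K_def rep_mult FA.S_closed)
  qed (auto simp: K_def rep_add rep_scal FA.S_closed)
  have rel: "rep (gvert (tail G e) * gedge e - gedge e) \<phi> x = 0"
      "rep (gedge e * gvert (head G e) - gedge e) \<phi> x = 0"
      "rep (gvert (head G e) * gghost e - gghost e) \<phi> x = 0"
      "rep (gghost e * gvert (tail G e) - gghost e) \<phi> x = 0" if "e \<in> arcs G" "x \<in> states" for e x \<phi>
  proof -
    obtain u p where x: "x = (u, p)" by (cases x)
    show "rep (gvert (tail G e) * gedge e - gedge e) \<phi> x = 0" "rep (gedge e * gvert (head G e) - gedge e) \<phi> x = 0"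
      by (simp_all add: x rep_diff rep_mult rep_monomial)
    show "rep (gvert (head G e) * gghost e - gghost e) \<phi> x = 0" "rep (gghost e * gvert (tail G e) - gghost e) \<phi> x = 0"
      using that(2) by (cases p; auto simp: x rep_diff rep_mult rep_monomial states_def)+
  qed
  have "leavitt_relations G \<subseteq> K"
  proof
    fix r :: "('f, 'v, 'e) wpoly" assume r: "r \<in> leavitt_relations G"
    have "rep r \<phi> x = 0" if "x \<in> states" for x \<phi>
      using r[unfolded leavitt_relations_def]
    proof (elim UnE UN_E insertE)
      assume "r \<in> {gvert v * gvert w - (if v = w then gvert v else 0) | v w. v \<in> verts G \<and> w \<in> verts G}"
      then show ?thesis by (cases x) (auto simp: rep_diff rep_mult rep_monomial)
    next
      assume "r \<in> {gghost e * gedge f - (if e = f then gvert (head G e) else 0) | e f. e \<in> arcs G \<and> f \<in> arcs G}"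
      then show ?thesis by (cases x) (auto simp: rep_diff rep_mult rep_monomial special_iff)
    next
      assume "r \<in> {gvert v - (\<Sum>e\<in>out_arcs G v. gedge e * gghost e) | v. v \<in> verts G \<and> \<not> sink G v}"
      then obtain v where v: "r = gvert v - (\<Sum>e\<in>out_arcs G v. gedge e * gghost e)" "v \<in> verts G" "\<not> sink G v"
        by blast
      obtain u p where x: "x = (u, p)" by (cases x)
      \<comment> \<open>\<open>f\<close> is the first edge of the path that \<open>(u, p)\<close>
        stands for; if u = v, then \<open>f f\<^sup>*\<close> fixes the state and every other
        summand kills it.\<close>
      define f where "f = (case p of [] \<Rightarrow> \<gamma> u | f # _ \<Rightarrow> f)"
      have f: "f \<in> out_arcs G u" if "u = v"
        using \<open>x \<in> states\<close> x v \<gamma>_out that by (cases p) (auto simp: f_def states_def)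
      have "rep (gedge e * gghost e) \<phi> x = (if u = v \<and> e = f then \<phi> x else 0)" if "e \<in> out_arcs G v" for e
      proof (cases p)
        case Nil
        then show ?thesis using that x v \<gamma>_out[of v]
          by (auto simp: rep_mult rep_monomial f_def special_iff)
      next
        case (Cons g q)
        then show ?thesis using that x \<open>x \<in> states\<close>
          by (auto simp: rep_mult rep_monomial f_def states_def split: if_splits)
      qed
      then have "rep (\<Sum>e\<in>out_arcs G v. gedge e * gghost e) \<phi> x = (\<Sum>e\<in>out_arcs G v. if e = f then (if u = v then \<phi> x else 0) else 0)"
        unfolding rep_sum by (intro sum.cong) auto
      also have "\<dots> = (if u = v then \<phi> x else 0)"
        using f by (auto simp: finite_out_arcs)
      finally show ?thesis using v x by (simp add: rep_diff rep_monomial)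
    qed (simp_all add: rel[OF _ that])
    then show "r \<in> K" using r relations_FA by (auto simp: K_def)
  qed
  then show ?thesis using rel_ideal_min[OF KI] assms by (auto simp: K_def)
qed

section \<open>The neighbourhoods of zero\<close>


definition sdl :: "'e list \<Rightarrow> nat" where "sdl es = length (takeWhile (\<lambda>e. e \<in> special) (rev es))"

lemma sd_eq: "sd G \<gamma> (u, es) = sdl es" by (simp add: sd_def sdl_def)

lemma sdl_Nil [simp]: "sdl [] = 0" by (simp add: sdl_def)

lemma sdl_snoc: "sdl (es @ [e]) = (if e \<in> special then Suc (sdl es) else 0)"
  by (simp add: sdl_def)

lemma sdl_append_le: "sdl (es @ fs) \<le> sdl es + sdl fs"
  by (induction fs rule: rev_induct) (auto simp: sdl_snoc simp flip: append_assoc)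

lemma sdl_append_ge: "sdl fs \<le> sdl (es @ fs)"
  by (induction fs rule: rev_induct) (auto simp: sdl_snoc simp flip: append_assoc)

lemma sdl_append_special: "set fs \<subseteq> special \<Longrightarrow> sdl (es @ fs) = sdl es + length fs"
  by (induction fs rule: rev_induct) (auto simp: sdl_snoc simp flip: append_assoc)

lemma sdl_eq_0_iff: "sdl es = 0 \<longleftrightarrow> es = [] \<or> last es \<notin> special"
  by (cases es rule: rev_cases) (auto simp: sdl_snoc)

text \<open>Integer form of n \<ge> k(s + d + 1) for a single product of paths. With truncated
  subtraction the two length differences add up to the absolute difference.\<close>

definition deep :: "nat \<Rightarrow> 'e list \<Rightarrow> 'e list \<Rightarrow> bool" where
  "deep k es fs \<longleftrightarrow> k * (sdl es + sdl fs + (length es - length fs) + (length fs - length es) + 1)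
     \<le> length es + length fs"

lemma deepI:
  assumes "sdl es \<le> s" "sdl fs \<le> t" "length es - length fs \<le> d" "length fs - length es \<le> d'"
    "k * (s + t + d + d' + 1) \<le> length es + length fs"
  shows "deep k es fs"
proof -
  have "k * (sdl es + sdl fs + (length es - length fs) + (length fs - length es) + 1) \<le> k * (s + t + d + d' + 1)"
    using assms by (intro mult_le_mono2) simp
  from order_trans[OF this assms(5)] show ?thesis unfolding deep_def .
qed

lemma deep_antimono: "k \<le> l \<Longrightarrow> deep l es fs \<Longrightarrow> deep k es fs"
  unfolding deep_def by (meson mult_le_mono1 order_trans)

lemma deep_commute: "deep k es fs \<longleftrightarrow> deep k fs es"
  by (simp add: deep_def ac_simps)

definition N :: "nat \<Rightarrow> ('f, 'v, 'e) wpoly set" where "N k = LP.pre (leavitt_nhd G \<gamma> k)"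

lemma nhd_generator:
  assumes "isp u es" "isp v fs"
  shows "lc (monomial (path_word (u, es))) \<otimes>\<^bsub>leavitt G\<^esub> lc (monomial (path_star_word (v, fs))) = lc (pm u es * sm v fs)"
  using LP.pres_mult[OF pm_FA[OF assms(1)] sm_FA[OF assms(2)]] by (simp add: pm_def sm_def)

lemma nsd_in_carrier: "leavitt_nsd G \<gamma> n s d \<subseteq> lc ` FA"
  unfolding leavitt_nsd_def
proof (rule LP.lin_subspace_hull_image[OF FA_subsp order_refl], safe)
  fix u es v fs assume "(u, es) \<in> paths G" "(v, fs) \<in> paths G"
  then have "isp u es" "isp v fs" by (simp_all add: isp_def)
  then show "lc (monomial (path_word (u, es))) \<otimes>\<^bsub>leavitt G\<^esub> lc (monomial (path_star_word (v, fs))) \<in> lc ` FA"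
    by (simp add: nhd_generator FA.S_mult pm_FA sm_FA)
qed

lemma nhd_subspace: "lin_subspace (leavitt G) (leavitt_nhd G \<gamma> k :: ('f, 'v, 'e) wpoly set set)"
  unfolding leavitt_nhd_def
proof (rule LP.lin_subspace_hull)
  show "\<Union>{leavitt_nsd G \<gamma> n s d | n s d. n \<ge> 0 \<and> s \<ge> 0 \<and> d \<ge> 0 \<and> n \<ge> real k * (s + d + 1)}
      \<subseteq> carrier (leavitt G :: ('f, ('f, 'v, 'e) wpoly set) module)"
    unfolding LP.carrier_eq using nsd_in_carrier by blast
qed

lemma N_subsp: "poly.subsp (N k)" and N_sub: "N k \<subseteq> FA"
  using nhd_subspace by (auto simp: N_def LP.lin_subspace_iff LP.pre_def)

lemmas N_closed = poly.subspD[OF N_subsp]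

lemma rel_ideal_N: "rel_ideal \<subseteq> N k"
proof
  fix x assume x: "x \<in> rel_ideal"
  then have "lc x = lc 0" using lc_eq_iff[of x 0] rel_ideal_sub FA.S_closed(1) by auto
  moreover have "lc 0 \<in> leavitt_nhd G \<gamma> k" using N_closed(1)[of k] by (simp add: N_def LP.pre_def)
  ultimately show "x \<in> N k" using x rel_ideal_sub by (auto simp: N_def LP.pre_def)
qed

lemma N_eqv: "x \<doteq> y \<Longrightarrow> x \<in> N k \<longleftrightarrow> y \<in> N k"
  using poly.subsp_diff_iff[OF N_subsp] rel_ideal_N unfolding eqv_def by blast

lemma N_gens:
  assumes "isp u es" "isp v fs" "deep k es fs"
  shows "pm u es * sm v fs \<in> N k"
proof -
  define n s d where "n = real (length es + length fs)" and "s = real (sdl es + sdl fs)"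
    and "d = real ((length es - length fs) + (length fs - length es))"
  have d: "d = \<bar>real (length es) - real (length fs)\<bar>" by (auto simp: d_def)
  have "real (k * (sdl es + sdl fs + (length es - length fs) + (length fs - length es) + 1)) \<le> n"
    using assms(3) unfolding deep_def n_def by (simp only: of_nat_le_iff)
  then have "n \<ge> real k * (s + d + 1)" unfolding s_def d_def by (simp only: of_nat_mult of_nat_add of_nat_1 add.assoc)
  moreover have "n \<ge> 0" "s \<ge> 0" "d \<ge> 0" by (simp_all add: n_def s_def d_def)
  ultimately have 1: "leavitt_nsd G \<gamma> n s d \<subseteq> (leavitt_nhd G \<gamma> k :: ('f, 'v, 'e) wpoly set set)"
    unfolding leavitt_nhd_def by (intro subset_trans[OF _ hull_subset]) blast
  have "lc (pm u es * sm v fs) \<in> leavitt_nsd G \<gamma> n s d"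
    unfolding leavitt_nsd_def nhd_generator[OF assms(1,2), symmetric]
  proof (rule subsetD[OF hull_subset], intro CollectI exI conjI)
    show "(u, es) \<in> paths G" "(v, fs) \<in> paths G" using assms by (simp_all add: isp_def)
  qed (simp_all add: n_def s_def d sd_eq)
  then show ?thesis
    using 1 by (auto simp: N_def LP.pre_def FA.S_mult pm_FA sm_FA assms)
qed

text \<open>Eliminates the real parameters: whatever admissible n, s, d a generator of
  \<open>leavitt_nsd\<close> comes from, the actual values of the pair of paths are at least as
  favourable, so the pair is \<open>deep\<close>.\<close>

lemma N_induct:
  assumes K: "poly.subsp K" "K \<subseteq> FA" "rel_ideal \<subseteq> K"
    and gens: "\<And>u es v fs. isp u es \<Longrightarrow> isp v fs \<Longrightarrow> deep k es fs \<Longrightarrow> pm u es * sm v fs \<in> K"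
  shows "N k \<subseteq> K"
proof
  fix x assume x: "x \<in> N k"
  have "leavitt_nsd G \<gamma> n s d \<subseteq> lc ` K" if nsd: "n \<ge> 0" "s \<ge> 0" "d \<ge> 0" "n \<ge> real k * (s + d + 1)" for n s d
    unfolding leavitt_nsd_def
  proof (rule LP.lin_subspace_hull_image[OF K(1,2)], safe)
    fix u es v fs assume "(u, es) \<in> paths G" "(v, fs) \<in> paths G"
      and b: "n \<le> real (path_length (u, es)) + real (path_length (v, fs))"
      "real (sd G \<gamma> (u, es)) + real (sd G \<gamma> (v, fs)) \<le> s"
      "\<bar>real (path_length (u, es)) - real (path_length (v, fs))\<bar> \<le> d"
    then have p: "isp u es" "isp v fs" by (simp_all add: isp_def)
    have "real (sdl es + sdl fs + (length es - length fs) + (length fs - length es) + 1) \<le> s + d + 1"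
      using b(2,3) by (auto simp: sd_eq of_nat_diff abs_le_iff split: if_splits)
    then have "real k * real (sdl es + sdl fs + (length es - length fs) + (length fs - length es) + 1) \<le> real k * (s + d + 1)"
      by (intro mult_left_mono) auto
    also have "\<dots> \<le> real (length es + length fs)" using nsd b(1) by simp
    finally have "deep k es fs" unfolding deep_def by (simp only: of_nat_mult[symmetric] of_nat_le_iff)
    then show "lc (monomial (path_word (u, es))) \<otimes>\<^bsub>leavitt G\<^esub> lc (monomial (path_star_word (v, fs))) \<in> lc ` K"
      using gens p by (simp add: nhd_generator)
  qed
  then have "leavitt_nhd G \<gamma> k \<subseteq> lc ` K"
    unfolding leavitt_nhd_def by (intro LP.lin_subspace_hull_image[OF K(1,2)]) blast
  then obtain y where y: "y \<in> K" "lc x = lc y" and xFA: "x \<in> FA" using x by (auto simp: N_def LP.pre_def)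
  then have "x - y \<in> K" using lc_eq_iff[of x y] K(2,3) by blast
  then have "(x - y) + y \<in> K" using y(1) poly.subspD(2)[OF K(1)] by blast
  then show "x \<in> K" by simp
qed

lemma N_antimono: assumes "k \<le> l" shows "N l \<subseteq> N k"
  by (rule N_induct[OF N_subsp N_sub rel_ideal_N]) (use assms N_gens deep_antimono in blast)

lemma N_star: assumes "x \<in> N k" shows "star x \<in> N k"
proof -
  have "N k \<subseteq> {x \<in> FA. star x \<in> N k}"
  proof (rule N_induct)
    show "poly.subsp {x \<in> FA. star x \<in> N k}"
      using N_closed by (auto simp: poly.subsp_def star_add star_scal FA.S_closed)
    show "rel_ideal \<subseteq> {x \<in> FA. star x \<in> N k}" using star_rel_ideal rel_ideal_sub rel_ideal_N by blast
    show "pm u es * sm v fs \<in> {x \<in> FA. star x \<in> N k}" if "isp u es" "isp v fs" "deep k es fs" for u es v fs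
      using that N_gens[of v fs u es k] deep_commute[of k]
      by (simp add: star_mult FA.S_mult pm_FA sm_FA)
  qed auto
  then show ?thesis using assms by blast
qed

lemma N_star_iff: "star x \<in> N k \<longleftrightarrow> x \<in> N k" by (metis N_star star_star)

lemma N_left_subsp: "a \<in> FA \<Longrightarrow> poly.subsp {x \<in> FA. a * x \<in> N k}" "a \<in> FA \<Longrightarrow> rel_ideal \<subseteq> {x \<in> FA. a * x \<in> N k}"
proof -
  assume a: "a \<in> FA"
  show "poly.subsp {x \<in> FA. a * x \<in> N k}"
    using N_closed by (auto simp: poly.subsp_def distrib_left FA.S_closed)
  show "rel_ideal \<subseteq> {x \<in> FA. a * x \<in> N k}" using rel_ideal_mult(1)[OF a] rel_ideal_sub rel_ideal_N[of k] by blast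
qed

text \<open>One generator raises the special end and the length difference by at most 1 each and
  shortens the total length by at most 1. The weight t + 1 thus becomes at most t + 3 \<le> 3(t +
  1); when an edge is lost the weight is only t + 2, and \<open>k \<ge> 1\<close> leaves room for
  that edge.\<close>

lemma N_mult_generator:
  assumes g: "g \<in> generators G" and k: "k \<ge> 1" and x: "x \<in> N (3 * k)"
  shows "monomial [g] * x \<in> N k"
proof -
  have gF: "(monomial [g] :: ('f, 'v, 'e) wpoly) \<in> FA" using g by simp
  have "N (3 * k) \<subseteq> {x \<in> FA. monomial [g] * x \<in> N k}"
  proof (rule N_induct[OF N_left_subsp(1)[OF gF] _ N_left_subsp(2)[OF gF]])
    fix u es v fs assume p: "isp u es" "isp v fs" and d: "deep (3 * k) es fs"
    define t where "t = sdl es + sdl fs + (length es - length fs) + (length fs - length es)"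
    have d': "k * (t + t + t + 3) \<le> length es + length fs"
      using d by (simp add: deep_def t_def algebra_simps)
    have d0: "k * (t + 1) \<le> length es + length fs" "k * (t + 3) \<le> length es + length fs + 1" "k * (t + 2) + 1 \<le> length es + length fs"
    proof -
      have "k * (t + 1) \<le> k * (t + t + t + 3)" "k * (t + 3) \<le> k * (t + t + t + 3)"
        by (intro mult_le_mono2; simp)+
      moreover have "k * (t + 2) + 1 \<le> k * (t + t + t + 3)"
      proof -
        have "k * (t + 2) + 1 \<le> k * (t + 2) + k" using k by simp
        also have "\<dots> = k * (t + 3)" by (simp add: algebra_simps)
        also have "\<dots> \<le> k * (t + t + t + 3)" by (intro mult_le_mono2) simp
        finally show ?thesis .
      qed
      ultimately show "k * (t + 1) \<le> length es + length fs" "k * (t + 3) \<le> length es + length fs + 1"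
        "k * (t + 2) + 1 \<le> length es + length fs" using d' by linarith+
    qed
    have "monomial [g] * (pm u es * sm v fs) \<in> N k"
    proof (cases g)
      case (Vert w)
      then have w: "w \<in> verts G" using g by simp
      have "gvert w * (pm u es * sm v fs) = (gvert w * pm u es) * sm v fs" by (simp only: mult.assoc)
      also have "\<dots> \<doteq> (if w = u then pm u es else 0) * sm v fs"
        by (intro eqv_mult_right sm_FA p gvert_pm w)
      finally have eq: "gvert w * (pm u es * sm v fs) \<doteq> (if w = u then pm u es else 0) * sm v fs" .
      have "deep k es fs" using d by (rule deep_antimono[rotated]) simp
      then have "(if w = u then pm u es else 0) * sm v fs \<in> N k" using N_gens[OF p] N_closed(1) by simp
      then show ?thesis using N_eqv[OF eq] Vert by simp
    next
      case (Edge e)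
      then have e: "e \<in> arcs G" using g by simp
      have pe: "isp (tail G e) [e]" using e by simp
      have pme: "pm (tail G e) [e] = gedge e" by (simp add: pm_def path_word_def)
      have "gedge e * (pm u es * sm v fs) = (pm (tail G e) [e] * pm u es) * sm v fs"
        by (simp only: mult.assoc pme)
      also have "\<dots> \<doteq> (if u = head G e then pm (tail G e) (e # es) else 0) * sm v fs"
        using pm_pm[OF pe p(1)] by (intro eqv_mult_right sm_FA p) (cases "u = head G e"; simp)
      finally have eq: "gedge e * (pm u es * sm v fs) \<doteq> (if u = head G e then pm (tail G e) (e # es) else 0) * sm v fs" .
      have "deep k (e # es) fs"
        using sdl_append_le[of "[e]" es] d0(2) by (intro deepI[of _ "sdl es + 1" _ "sdl fs" "length es - length fs + 1" "length fs - length es"])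
          (auto simp: sdl_def t_def algebra_simps intro: order_trans)
      then have "(if u = head G e then pm (tail G e) (e # es) else 0) * sm v fs \<in> N k"
        using N_gens[of "tail G e" "e # es" v fs k] p e N_closed(1) by auto
      then show ?thesis using N_eqv[OF eq] Edge by simp
    next
      case (Ghost e)
      then have e: "e \<in> arcs G" using g by simp
      have pe: "isp (tail G e) [e]" using e by simp
      have sme: "sm (tail G e) [e] = gghost e" by (simp add: sm_def path_star_word_def path_word_def)
      have eq0: "gghost e * (pm u es * sm v fs) = (gghost e * pm u es) * sm v fs" by (simp only: mult.assoc)
      show ?thesis
      proof (cases es)
        case Nil
        then have u: "u \<in> verts G" using p by simp
        have "gghost e * (pm u es * sm v fs) = gghost e * (gvert u * sm v fs)" by (simp add: Nil)
        also have "\<dots> \<doteq> gghost e * (if u = endv v fs then sm v fs else 0)"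
          using sm_sm[of v fs u "[]"] p u e by (intro eqv_mult_left) (auto split: if_splits)
        also have "\<dots> \<doteq> (if u = endv v fs \<and> tail G e = u then sm v (fs @ [e]) else 0)"
          using sm_sm[OF p(2) pe] unfolding sme by (auto split: if_splits)
        finally have eq: "gghost e * (pm u es * sm v fs) \<doteq> (if u = endv v fs \<and> tail G e = u then sm v (fs @ [e]) else 0)" .
        show ?thesis
        proof (cases "u = endv v fs \<and> tail G e = u")
          case True
          have q: "isp v (fs @ [e])" using p(2) pe True by (simp add: isp_append)
          have "sdl (fs @ [e]) \<le> sdl fs + 1" by (simp add: sdl_snoc)
          then have "deep k [] (fs @ [e])"
            using d0(2) Nil by (intro deepI[of _ 0 _ "sdl fs + 1" 0 "length fs + 1"])
              (auto simp: t_def algebra_simps)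
          then have "pm (endv v (fs @ [e])) [] * sm v (fs @ [e]) \<in> N k"
            using q isp_verts(2)[OF q] by (intro N_gens) auto
          moreover have "pm (endv v (fs @ [e])) [] * sm v (fs @ [e]) \<doteq> sm v (fs @ [e])"
            using sm_sm[OF q, of "endv v (fs @ [e])" "[]"] isp_verts(2)[OF q] by simp
          ultimately have "sm v (fs @ [e]) \<in> N k" using N_eqv by blast
          then show ?thesis using N_eqv[OF eq] True Ghost by simp
        next
          case False
          then show ?thesis using N_eqv[OF eq] N_closed(1)[of k] Ghost by auto
        qed
      next
        case (Cons f es')
        have "(gghost e * pm u es) * sm v fs \<doteq> (if e = f then pm (head G f) es' else 0) * sm v fs"
          unfolding Cons using p e Cons by (intro eqv_mult_right gghost_pm sm_FA) auto
        then have eq: "gghost e * (pm u es * sm v fs) \<doteq> (if e = f then pm (head G f) es' else 0) * sm v fs"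
          by (simp only: eq0)
        have "deep k es' fs"
          using sdl_append_ge[of es' "[f]"] d0(3) Cons
          by (intro deepI[of _ "sdl es" _ "sdl fs" "length es - length fs" "length fs - length es + 1"])
            (auto simp: t_def algebra_simps)
        then have "(if e = f then pm (head G f) es' else 0) * sm v fs \<in> N k"
          using N_gens[of "head G f" es' v fs k] p Cons N_closed(1) by auto
        then show ?thesis using N_eqv[OF eq] Ghost by simp
      qed
    qed
    then show "pm u es * sm v fs \<in> {x \<in> FA. monomial [g] * x \<in> N k}" using p by (simp add: FA.S_mult pm_FA sm_FA)
  qed auto
  then show ?thesis using x by blast
qed

lemma N_mult_left: assumes "a \<in> FA" shows "\<exists>l. \<forall>x\<in>N l. a * x \<in> N k"
proof -
  define K where "K = {a \<in> FA. \<forall>k. \<exists>l. \<forall>x\<in>N l. a * x \<in> N k}"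
  have Ksp: "poly.subsp K"
    unfolding poly.subsp_def
  proof (intro conjI ballI allI)
    show "0 \<in> K" by (simp add: K_def FA.S_closed N_closed)
    fix a assume a: "a \<in> K"
    then show "scal c a \<in> K" for c by (auto simp: K_def FA.S_closed) (meson N_closed(3))
    fix b assume b: "b \<in> K"
    have "\<exists>l. \<forall>x\<in>N l. (a + b) * x \<in> N k" for k
    proof -
      obtain l where l: "\<forall>x\<in>N l. a * x \<in> N k" using a by (auto simp: K_def)
      obtain l' where l': "\<forall>x\<in>N l'. b * x \<in> N k" using b by (auto simp: K_def)
      have "(a + b) * x \<in> N k" if "x \<in> N (max l l')" for x
        using that l l' N_antimono[of l "max l l'"] N_antimono[of l' "max l l'"]
        by (auto simp: distrib_right intro!: N_closed(2))
      then show ?thesis by blast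
    qed
    then show "a + b \<in> K" using a b by (simp add: K_def FA.S_closed)
  qed
  have mon: "monomial w \<in> K" if "w \<in> words" for w
  proof -
    have "set w \<subseteq> generators G \<Longrightarrow> w \<noteq> [] \<Longrightarrow> \<exists>l. \<forall>x\<in>N l. monomial w * x \<in> N k" for k
    proof (induction w arbitrary: k)
      case (Cons g w)
      have g: "g \<in> generators G" using Cons by simp
      \<comment> \<open>\<open>N_mult_generator\<close> requires a positive level, hence
        \<open>Suc k\<close>.\<close>
      have 1: "monomial [g] * x \<in> N k" if "x \<in> N (3 * Suc k)" for x
        using N_mult_generator[OF g _ that] N_antimono[of k "Suc k"] by auto
      show ?case
      proof (cases "w = []")
        case True
        then show ?thesis using 1 by blast
      next
        case False
        then obtain l where l: "\<forall>x\<in>N l. monomial w * x \<in> N (3 * Suc k)" using Cons by fastforce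
        have "monomial (g # w) * x = monomial [g] * (monomial w * x)" for x :: "('f, 'v, 'e) wpoly"
          by (simp add: monomial_mult flip: mult.assoc)
        then show ?thesis using l 1 by (intro exI[of _ l]) simp
      qed
    qed simp
    then show ?thesis using that by (auto simp: K_def words_def)
  qed
  have "a \<in> K"
  proof (rule subsp_monomials[OF Ksp])
    show "monomial w \<in> K" if "w \<in> Poly_Mapping.keys a" for w
      using assms that mon unfolding FA_iff by blast
  qed
  then show ?thesis by (simp add: K_def)
qed

lemma N_mult_elem: assumes "a \<in> FA" shows "\<exists>l. \<forall>x\<in>N l. a * x \<in> N k \<and> x * a \<in> N k"
proof -
  obtain l where l: "\<forall>x\<in>N l. a * x \<in> N k" using N_mult_left[OF assms] by blast
  obtain l' where l': "\<forall>x\<in>N l'. star a * x \<in> N k" using N_mult_left[OF star_FA[OF assms]] by blast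
  have "x * a \<in> N k" if "x \<in> N l'" for x
    using l' N_star[OF that] N_star_iff[of "x * a" k] by (simp add: star_mult)
  then show ?thesis using l N_antimono[of l "max l l'"] N_antimono[of l' "max l l'"]
    by (intro exI[of _ "max l l'"]) auto
qed

text \<open>Cancelling \<open>fs\<close> costs twice its length, but \<open>fs\<close> is at most as
  long as \<open>es\<close> plus the first length difference, and as \<open>hs\<close> plus the
  second. Adding the hypotheses therefore yields twice the required estimate up to d1 + d2: the 2 in
  the constant pays for the doubling and the 1 for the differences.\<close>

lemma deep_mult:
  assumes "deep (2 * k + 1) es fs" "deep (2 * k + 1) (fs @ gs) hs"
  shows "deep k (es @ gs) hs"
proof -
  define a b j e where ab: "a = length es" "b = length fs" "j = length gs" "e = length hs"
  define d1 d2 where "d1 = (a - b) + (b - a)" and "d2 = (b + j - e) + (e - (b + j))"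
  define t1 t2 where "t1 = sdl es + sdl fs + d1 + 1" and "t2 = sdl (fs @ gs) + sdl hs + d2 + 1"
  have 1: "(2 * k + 1) * t1 \<le> a + b" using assms(1) by (simp add: deep_def t1_def d1_def ab ac_simps)
  have 2: "(2 * k + 1) * t2 \<le> b + j + e" using assms(2) by (simp add: deep_def t2_def d2_def ab ac_simps)
  have s: "sdl (es @ gs) \<le> sdl es + sdl (fs @ gs)"
    using sdl_append_le[of es gs] sdl_append_ge[of gs fs] by linarith
  have "sdl (es @ gs) + sdl hs + (a + j - e) + (e - (a + j)) + 1 \<le> t1 + t2"
    using s by (simp add: t1_def t2_def d1_def d2_def)
  then have "k * (sdl (es @ gs) + sdl hs + (a + j - e) + (e - (a + j)) + 1) \<le> k * (t1 + t2)"
    by (rule mult_le_mono2)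
  moreover have "2 * (k * (t1 + t2)) + d1 + d2 \<le> (a + b) + (b + j + e)"
  proof -
    have "2 * (k * t1) + t1 \<le> a + b" "2 * (k * t2) + t2 \<le> b + j + e"
      using 1 2 by (simp_all add: algebra_simps)
    moreover have "d1 \<le> t1" "d2 \<le> t2" by (simp_all add: t1_def t2_def)
    ultimately show ?thesis by (simp add: algebra_simps)
  qed
  \<comment> \<open>Uses b \<le> a + d1 and b + j \<le> e + d2.\<close>
  moreover have "(a + b) + (b + j + e) \<le> 2 * (a + j + e) + d1 + d2" by (simp add: d1_def d2_def)
  moreover have "x \<le> z" if "x \<le> y" "2 * y + d1 + d2 \<le> w" "w \<le> 2 * z + d1 + d2" for x y z w :: nat
    using that by linarith
  ultimately have "k * (sdl (es @ gs) + sdl hs + (a + j - e) + (e - (a + j)) + 1) \<le> a + j + e" by blast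
  then show ?thesis by (simp add: deep_def ab)
qed

text \<open>The inner product \<open>sm v fs * pm u' es'\<close> survives only if one path extends
  the other. If \<open>fs\<close> is the longer one, the situation is the mirror image, and
  \<open>deep_mult\<close> is used with the roles of the factors exchanged.\<close>

lemma N_mult: assumes "x \<in> N (2 * k + 1)" "y \<in> N (2 * k + 1)" shows "x * y \<in> N k"
proof -
  let ?l = "2 * k + 1"
  have gens: "(pm u es * sm v fs) * (pm u' es' * sm v' fs') \<in> N k"
    if p: "isp u es" "isp v fs" "isp u' es'" "isp v' fs'" and d: "deep ?l es fs" "deep ?l es' fs'"
    for u es v fs u' es' v' fs'
  proof -
    have assoc: "(pm u es * sm v fs) * (pm u' es' * sm v' fs') = pm u es * (sm v fs * pm u' es') * sm v' fs'"
      by (simp only: mult.assoc)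
    consider gs where "v = u'" "es' = fs @ gs" | gs where "v = u'" "fs = es' @ gs"
      | "\<not> (v = u' \<and> ((\<exists>gs. es' = fs @ gs) \<or> (\<exists>gs. fs = es' @ gs)))" by blast
    then show ?thesis
    proof cases
      case (1 gs)
      have q: "isp v (fs @ gs)" "isp (endv v fs) gs" using p 1 by (auto simp: isp_append)
      have "pm u es * (sm v fs * pm u' es') * sm v' fs' \<doteq> pm u es * pm (endv v fs) gs * sm v' fs'"
        unfolding 1(2) 1(1)[symmetric] by (intro eqv_mult_left eqv_mult_right pm_FA sm_FA p sm_pm_prefix q)
      also have "\<dots> \<doteq> (if endv v fs = endv u es then pm u (es @ gs) else 0) * sm v' fs'"
        by (intro eqv_mult_right sm_FA p pm_pm q)
      finally have eq: "pm u es * (sm v fs * pm u' es') * sm v' fs' \<doteq>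
        (if endv v fs = endv u es then pm u (es @ gs) else 0) * sm v' fs'" .
      have "(if endv v fs = endv u es then pm u (es @ gs) else 0) * sm v' fs' \<in> N k"
        using deep_mult[OF d(1) d(2)[unfolded 1(2)]] p q N_closed(1) by (auto simp: isp_append intro!: N_gens)
      then show ?thesis unfolding assoc using N_eqv[OF eq] by blast
    next
      case (2 gs)
      have q: "isp v (es' @ gs)" "isp (endv v es') gs" using p 2 by (auto simp: isp_append)
      have "pm u es * (sm v fs * pm u' es') * sm v' fs' \<doteq> pm u es * sm (endv v es') gs * sm v' fs'"
        unfolding 2(2) 2(1)[symmetric] by (intro eqv_mult_left eqv_mult_right pm_FA sm_FA p sm_pm_prefix' q)
      also have "\<dots> = pm u es * (sm (endv v es') gs * sm v' fs')" by (simp only: mult.assoc)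
      also have "\<dots> \<doteq> pm u es * (if endv v es' = endv v' fs' then sm v' (fs' @ gs) else 0)"
        by (intro eqv_mult_left pm_FA p sm_sm q)
      finally have eq: "pm u es * (sm v fs * pm u' es') * sm v' fs' \<doteq>
        pm u es * (if endv v es' = endv v' fs' then sm v' (fs' @ gs) else 0)" .
      have "deep k (fs' @ gs) es" using d 2 deep_mult[of k fs' es' gs es] deep_commute by blast
      then have "pm u es * (if endv v es' = endv v' fs' then sm v' (fs' @ gs) else 0) \<in> N k"
        using p q N_closed(1) deep_commute by (auto simp: isp_append intro!: N_gens)
      then show ?thesis unfolding assoc using N_eqv[OF eq] by blast
    next
      case 3
      have "pm u es * (sm v fs * pm u' es') * sm v' fs' \<doteq> pm u es * 0 * sm v' fs'"
        by (intro eqv_mult_left eqv_mult_right pm_FA sm_FA p sm_pm_zero 3)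
      then show ?thesis unfolding assoc using N_eqv[of _ "pm u es * 0 * sm v' fs'" k] N_closed(1) by simp
    qed
  qed
  have pF: "pm u es * sm v fs \<in> FA" if "isp u es" "isp v fs" for u es v fs
    using that by (simp add: FA.S_mult pm_FA sm_FA)
  have 1: "(pm u es * sm v fs) * y \<in> N k" if "isp u es" "isp v fs" "deep ?l es fs" for u es v fs
  proof -
    have "N ?l \<subseteq> {y \<in> FA. (pm u es * sm v fs) * y \<in> N k}"
      by (rule N_induct[OF N_left_subsp(1)[OF pF] _ N_left_subsp(2)[OF pF]])
        (use that gens pF in auto)
    then show ?thesis using assms by blast
  qed
  have yF: "y \<in> FA" using assms N_sub by blast
  have "N ?l \<subseteq> {x \<in> FA. x * y \<in> N k}"
  proof (rule N_induct)
    show "poly.subsp {x \<in> FA. x * y \<in> N k}"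
      using N_closed by (auto simp: poly.subsp_def distrib_right FA.S_closed)
    show "rel_ideal \<subseteq> {x \<in> FA. x * y \<in> N k}" using rel_ideal_mult(2)[OF yF] rel_ideal_sub rel_ideal_N by blast
  qed (use 1 pF in auto)
  then show ?thesis using assms by blast
qed

section \<open>Compatibility of the grading with the neighbourhoods\<close>

lemma degree_part_FA: "x \<in> FA \<Longrightarrow> degree_part i x \<in> FA"
  by (auto simp: FA_iff keys_degree_part)

lemma degree_part_monomial: "degree_part i (monomial w) \<in> {monomial w, 0}" by simp

text \<open>Every relation is homogeneous, of degree 0, 1 or -1, and a product with an arbitrary
  polynomial can be split by the degrees of that polynomial.\<close>

lemma degree_part_rel_ideal: assumes "x \<in> rel_ideal" shows "degree_part i x \<in> rel_ideal"
proof -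
  define K where "K = {p \<in> FA. \<forall>i. degree_part i p \<in> rel_ideal}"
  have mult: "degree_part i (a * x) \<in> rel_ideal \<and> degree_part i (x * a) \<in> rel_ideal" if "a \<in> FA" "x \<in> K" for a x i
  proof -
    obtain D where D: "finite D" "a = (\<Sum>j\<in>D. degree_part j a)" using degree_part_sum_expand by blast
    have "(\<Sum>j\<in>D. degree_part i (degree_part j a * x)) \<in> rel_ideal" "(\<Sum>j\<in>D. degree_part i (x * degree_part j a)) \<in> rel_ideal"
      unfolding degree_part_mult_left degree_part_mult_right
      by (intro poly.subsp_sum[OF rel_ideal_subsp] rel_ideal_mult degree_part_FA that; use that in \<open>simp add: K_def\<close>)+
    moreover have "degree_part i (a * x) = (\<Sum>j\<in>D. degree_part i (degree_part j a * x))"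
      "degree_part i (x * a) = (\<Sum>j\<in>D. degree_part i (x * degree_part j a))"
      by (subst D(2), simp add: sum_distrib_left sum_distrib_right degree_part_sum)+
    ultimately show ?thesis by simp
  qed
  have KI: "poly.ideal_in FA K"
    unfolding poly.ideal_in_def poly.subsp_def
  proof (intro conjI ballI allI)
    show "a * x \<in> K" "x * a \<in> K" if "a \<in> FA" "x \<in> K" for a x
      using mult[OF that] that FA.S_mult by (auto simp: K_def)
  qed (auto simp: K_def degree_part_add degree_part_scal FA.S_closed rel_ideal_closed)
  have hom: "r \<in> K" if "r \<in> leavitt_relations G" "degree_part d r = r" for r d
  proof -
    have "degree_part i r = (if i = d then r else 0)" for i
      using degree_part_degree_part[of i d r] that(2) by auto
    then show ?thesis using that relations_FA relations_rel_ideal rel_ideal_closed(1) by (auto simp: K_def)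
  qed
  have "leavitt_relations G \<subseteq> K"
  proof
    fix r :: "('f, 'v, 'e) wpoly" assume r: "r \<in> leavitt_relations G"
    have "degree_part 0 r = r \<or> degree_part 1 r = r \<or> degree_part (- 1) r = r"
      using r unfolding leavitt_relations_def
      by (elim UnE UN_E insertE; auto simp: degree_part_diff degree_part_sum monomial_mult word_degree_def)
    then show "r \<in> K" using hom r by blast
  qed
  then show ?thesis using rel_ideal_min[OF KI] assms by (auto simp: K_def)
qed

lemma degree_part_N: assumes "x \<in> N k" shows "degree_part i x \<in> N k"
proof -
  have "N k \<subseteq> {x \<in> FA. degree_part i x \<in> N k}"
  proof (rule N_induct)
    show "poly.subsp {x \<in> FA. degree_part i x \<in> N k}"
      using N_closed by (auto simp: poly.subsp_def degree_part_add degree_part_scal FA.S_closed)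
    show "rel_ideal \<subseteq> {x \<in> FA. degree_part i x \<in> N k}" using degree_part_rel_ideal rel_ideal_sub rel_ideal_N by blast
    fix u es v fs assume p: "isp u es" "isp v fs" "deep k es fs"
    have "degree_part i (pm u es * sm v fs) \<in> {pm u es * sm v fs, 0}"
      unfolding pm_def sm_def monomial_mult by (rule degree_part_monomial)
    then show "pm u es * sm v fs \<in> {x \<in> FA. degree_part i x \<in> N k}"
      using p N_gens N_closed(1) by (auto simp: FA.S_mult pm_FA sm_FA)
  qed auto
  then show ?thesis using assms by blast
qed

sublocale LG: graded_presentation scal FA "leavitt G" lc "leavitt_nhd G \<gamma>" degree_part
proof
  show "lin_subspace (leavitt G) (leavitt_nhd G \<gamma> k :: ('f, 'v, 'e) wpoly set set)" for k by (rule nhd_subspace)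
  show "leavitt_nhd G \<gamma> l \<subseteq> (leavitt_nhd G \<gamma> k :: ('f, 'v, 'e) wpoly set set)" if "k \<le> l" for k l
  proof -
    have "leavitt_nhd G \<gamma> l \<subseteq> carrier (leavitt G :: ('f, ('f, 'v, 'e) wpoly set) module)"
      using nhd_subspace by (simp add: LP.lin_subspace_iff)
    then show ?thesis using N_antimono[OF that] by (simp add: N_def LP.pre_mono_iff)
  qed
  show "\<exists>l. \<forall>x\<in>LP.pre (leavitt_nhd G \<gamma> l). \<forall>y\<in>LP.pre (leavitt_nhd G \<gamma> l). x * y \<in> LP.pre (leavitt_nhd G \<gamma> k)" for k
    using N_mult[of _ k] unfolding N_def by blast
  show "\<exists>l. \<forall>x\<in>LP.pre (leavitt_nhd G \<gamma> l). a * x \<in> LP.pre (leavitt_nhd G \<gamma> k) \<and> x * a \<in> LP.pre (leavitt_nhd G \<gamma> k)"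
    if "a \<in> FA" for a k using N_mult_elem[OF that, of k] unfolding N_def .
  show "degree_part i x \<in> LP.pre (leavitt_nhd G \<gamma> k)" if "x \<in> LP.pre (leavitt_nhd G \<gamma> k)" for i k x
    using degree_part_N[of x k i] that unfolding N_def .
qed (simp_all add: degree_part_add degree_part_scal degree_part_FA degree_part_degree_part
    degree_part_sum_expand degree_part_mult_left degree_part_mult_right)

lemma nb_eq: "LG.nb k = N k" by (simp add: LG.nb_def N_def)

lemma base_eq: "LG.base = leavitt_nhds G \<gamma>" by (simp add: LG.base_def leavitt_nhds_def)

lemma component_eq: "LG.component i = leavitt_component G i"
proof -
  have "{x \<in> FA. degree_part i x = x} = {x \<in> carrier (free_algebra (generators G)).
      \<forall>w\<in>Poly_Mapping.keys x. sum_list (map generator_degree w) = i}"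
    by (auto simp: carrier_FA degree_part_eq_iff word_degree_def)
  then show ?thesis by (simp add: LG.component_def leavitt_component_def)
qed

lemma comp_eq: "LG.comp i = leavitt_hat_component G \<gamma> i"
  unfolding LG.comp_def leavitt_hat_component_def leavitt_embed_def base_eq component_eq by simp

lemma hat_eq: "LG.hat_algebra = leavitt_hat G \<gamma>"
  unfolding LG.hat_algebra_def leavitt_hat_def Let_def base_eq comp_eq by (simp add: comp_eq[abs_def])

lemma hat_topology_eq: "LG.hat_topology = leavitt_hat_topology G \<gamma>"
  unfolding LG.hat_topology_def leavitt_hat_topology_def base_eq hat_eq by simp

lemma hat_ideal_eq:
  assumes "W \<subseteq> verts G"
  shows "leavitt_hat_ideal G \<gamma> W = LG.\<Phi> ` LG.gen_ideal ((\<lambda>w n. gvert w) ` W)"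
proof -
  have "(\<lambda>w n. gvert w) ` W \<subseteq> LG.hats" using assms LG.const_hats by auto
  from LG.hull_eq_gen_ideal[OF this] show ?thesis
    unfolding leavitt_hat_ideal_def hat_eq hat_topology_eq leavitt_embed_def image_image
      completion_embed_def LG.\<Phi>_def base_eq by simp
qed

section \<open>Special tails\<close>


fun zs :: "'v \<Rightarrow> nat \<Rightarrow> 'e list" where
  "zs u 0 = []"
| "zs u (Suc n) = (if sink G u then [] else \<gamma> u # zs (head G (\<gamma> u)) n)"

text \<open>A sink is made a fixed point, so that \<open>(nx ^^ n) u\<close> is the end of
  \<open>zs u n\<close> for every n.\<close>

definition nx :: "'v \<Rightarrow> 'v" where "nx u = (if sink G u then u else head G (\<gamma> u))"

lemma nx_verts: "u \<in> verts G \<Longrightarrow> nx u \<in> verts G" by (simp add: nx_def \<gamma>_out)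

lemma isp_zs: "u \<in> verts G \<Longrightarrow> isp u (zs u n)"
  by (induction n arbitrary: u) (auto simp: \<gamma>_out)

lemma zs_special: "u \<in> verts G \<Longrightarrow> set (zs u n) \<subseteq> special"
  by (induction n arbitrary: u) (auto simp: \<gamma>_out)

lemma zs_sink: "sink G u \<Longrightarrow> zs u n = []" by (cases n) auto

lemma endv_zs: "endv u (zs u n) = (nx ^^ n) u"
proof (induction n arbitrary: u)
  case (Suc n)
  show ?case
  proof (cases "sink G u")
    case True
    then have "(nx ^^ m) u = u" for m by (induction m) (auto simp: nx_def)
    then show ?thesis using True by (metis endv.simps(1) zs_sink)
  next
    case False
    then have "nx u = head G (\<gamma> u)" by (simp add: nx_def)
    moreover have "(nx ^^ Suc n) u = (nx ^^ n) (nx u)" by (simp only: funpow_Suc_right o_apply)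
    ultimately show ?thesis using Suc False by simp
  qed
qed simp

lemma zs_add: "zs u (m + n) = zs u m @ zs (endv u (zs u m)) n"
proof (induction m arbitrary: u)
  case (Suc m)
  then show ?case by (cases "sink G u") (auto simp: zs_sink)
qed simp

lemma length_zs_le: "length (zs u n) \<le> n"
  by (induction n arbitrary: u) auto

lemma length_zs: "\<not> sink G (endv u (zs u n)) \<Longrightarrow> length (zs u n) = n"
proof (induction n arbitrary: u)
  case (Suc n)
  then show ?case by (cases "sink G u") auto
qed simp

lemma isp_sink: "sink G u \<Longrightarrow> isp u es \<Longrightarrow> es = []"
  by (cases es) (auto simp: sink_def out_arcs_def)

text \<open>The first n edges of the path described by the state, provided n is at least the length
  of \<open>p\<close>; fewer than n edges occur then only if the path ends at a sink.\<close>

fun tr :: "nat \<Rightarrow> 'v \<times> 'e list \<Rightarrow> 'e list" where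
  "tr n (u, p) = p @ zs (endv u p) (n - length p)"

definition trv :: "nat \<Rightarrow> 'v \<times> 'e list \<Rightarrow> 'v" where "trv n x = endv (fst x) (tr n x)"

definition tp :: "nat \<Rightarrow> 'v \<times> 'e list \<Rightarrow> ('f, 'v, 'e) wpoly" where "tp n x = pm (fst x) (tr n x)"
definition ts :: "nat \<Rightarrow> 'v \<times> 'e list \<Rightarrow> ('f, 'v, 'e) wpoly" where "ts n x = sm (fst x) (tr n x)"

lemma isp_tr: "x \<in> states \<Longrightarrow> isp (fst x) (tr n x)"
  by (cases x) (auto simp: states_def isp_append isp_zs isp_verts)

lemma trv_verts: "x \<in> states \<Longrightarrow> trv n x \<in> verts G"
  unfolding trv_def by (rule isp_verts(2)[OF isp_tr])

lemma tp_FA: "x \<in> states \<Longrightarrow> tp n x \<in> FA" and ts_FA: "x \<in> states \<Longrightarrow> ts n x \<in> FA"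
  by (simp_all add: tp_def ts_def pm_FA sm_FA isp_tr)

lemma star_tp [simp]: "star (tp n x) = ts n x" and star_ts [simp]: "star (ts n x) = tp n x"
  by (simp_all add: tp_def ts_def)

lemma tr_add: "length (snd x) \<le> n \<Longrightarrow> tr (n + m) x = tr n x @ zs (trv n x) m"
  by (cases x) (auto simp: trv_def zs_add[of _ "n - _" m, symmetric])

text \<open>Multiplying a truncated path by a generator imitates \<open>step\<close>: the cut moves
  by the degree of the generator, while its end vertex stays. The extra edge demanded of n ensures
  that a ghost edge cancels inside the truncation, unless the path is just a sink.\<close>

lemma step_tp:
  assumes g: "g \<in> generators G" and x: "x \<in> states" and n: "length (snd x) + 1 \<le> n"
  shows "case step g x of None \<Rightarrow> monomial [g] * tp n x \<doteq> 0
    | Some y \<Rightarrow> monomial [g] * tp n x \<doteq> tp (nat (int n + generator_degree g)) y \<and>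
        trv (nat (int n + generator_degree g)) y = trv n x"
proof -
  obtain u p where xp: "x = (u, p)" by (cases x)
  have px: "isp u (tr n x)" using isp_tr[OF x, of n] by (simp add: xp)
  show ?thesis
  proof (cases g)
    case (Vert v)
    then show ?thesis using gvert_pm[OF _ px, of v] g by (auto simp: tp_def xp)
  next
    case (Edge e)
    then have e: "e \<in> arcs G" using g by simp
    have pe: "isp (tail G e) [e]" using e by simp
    have pme: "pm (tail G e) [e] = gedge e" by (simp add: pm_def path_word_def)
    have n1: "nat (int n + 1) = Suc n" by simp
    show ?thesis
    proof (cases "u = head G e")
      case True
      define y where "y = (tail G e, if p = [] \<and> e \<in> special then [] else e # p)"
      have "tr (Suc n) y = e # tr n x"
      proof (cases "p = [] \<and> e \<in> special")
        case True
        then have "\<not> sink G (tail G e)" "\<gamma> (tail G e) = e" by (auto simp: special_iff sink_def out_arcs_def)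
        then show ?thesis using True \<open>u = head G e\<close> by (simp add: y_def xp)
      next
        case False
        then show ?thesis using \<open>u = head G e\<close> by (auto simp: y_def xp)
      qed
      moreover have "gedge e * tp n x \<doteq> pm (tail G e) (e # tr n x)"
        using pm_Cons[of e "tr n x"] px e True by (simp add: tp_def xp)
      ultimately show ?thesis using True Edge
        by (auto simp: xp tp_def trv_def n1 y_def simp del: tr.simps)
    next
      case False
      then have "gedge e * tp n x \<doteq> 0" using pm_pm[OF pe px] by (simp add: pme tp_def xp)
      then show ?thesis using False Edge by (simp add: xp)
    qed
  next
    case (Ghost e)
    then have e: "e \<in> arcs G" using g by simp
    have n1: "nat (int n + generator_degree g) = n - 1" using n by (simp add: Ghost nat_diff_distrib')
    show ?thesis
    proof (cases "tr n x")
      case Nil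
      then have p: "p = []" and "zs u n = []" by (auto simp: xp)
      \<comment> \<open>n is positive, so an empty truncation means that the path is a sink, from
        which no edge starts.\<close>
      then have "sink G u" using n by (cases n) (auto split: if_splits)
      then have ne: "u \<noteq> tail G e" using e by (auto simp: sink_def out_arcs_def)
      have pe: "isp (tail G e) [e]" using e by simp
      have "sm (tail G e) [e] * gvert u \<doteq> 0" using sm_gvert[OF pe, of u] ne px Nil by auto
      moreover have "tp n x = gvert u" unfolding tp_def Nil by (simp add: xp)
      ultimately have "gghost e * tp n x \<doteq> 0" by (simp add: sm_def path_star_word_def path_word_def)
      then show ?thesis using ne Ghost p by (simp add: xp)
    next
      case (Cons f fs)
      have gp: "gghost e * tp n x \<doteq> (if e = f then pm (head G f) fs else 0)"
      proof -
        have "tp n x = pm u (f # fs)" unfolding tp_def Cons by (simp add: xp)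
        then show ?thesis using gghost_pm[OF e px[unfolded Cons]] by (simp only:)
      qed
      have f: "f \<in> arcs G" "u = tail G f" using px Cons by auto
      show ?thesis
      proof (cases p)
        case Nil
        then have z: "zs u n = f # fs" using Cons by (simp add: xp)
        then have ns: "\<not> sink G u" "f = \<gamma> u" "fs = zs (head G (\<gamma> u)) (n - 1)"
          using n by (cases n; auto split: if_splits)+
        have sp: "f \<in> special" unfolding ns(2) by (rule \<gamma>_out(3)[OF isp_verts(1)[OF px] ns(1)])
        show ?thesis
        proof (cases "e = f")
          case True
          have st: "step g x = Some (head G f, [])" using True Ghost Nil f(2) sp by (simp add: xp)
          have tr': "tr (n - 1) (head G f, []) = fs" by (simp add: ns(2,3))
          have v: "trv (n - 1) (head G f, []) = trv n x"
            unfolding trv_def tr' \<open>tr n x = f # fs\<close> by simp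
          have "gghost e * tp n x \<doteq> tp (n - 1) (head G f, [])"
            using gp True unfolding tp_def tr' by simp
          then show ?thesis unfolding st option.case n1 using Ghost v by blast
        next
          case False
          have "\<not> (u = tail G e \<and> e \<in> special)"
          proof
            assume "u = tail G e \<and> e \<in> special"
            then have "e = \<gamma> u" using special_iff by metis
            then show False using False ns(2) by simp
          qed
          then have st: "step g x = None" unfolding Ghost xp Nil step.simps by (rule if_not_P)
          show ?thesis unfolding st option.case using gp False Ghost by simp
        qed
      next
        case (Cons f' p')
        then have ff: "f' = f" "fs = p' @ zs (endv u p) (n - length p)" using \<open>tr n x = f # fs\<close> by (auto simp: xp)
        then show ?thesis
        proof (cases "e = f")
          case True
          have st: "step g x = Some (head G f, p')" using True Ghost Cons ff by (simp add: xp)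
          have tr': "tr (n - 1) (head G f, p') = fs" using ff Cons by simp
          have v: "trv (n - 1) (head G f, p') = trv n x"
            unfolding trv_def tr' \<open>tr n x = f # fs\<close> by simp
          have "gghost e * tp n x \<doteq> tp (n - 1) (head G f, p')"
            using gp True unfolding tp_def tr' by simp
          then show ?thesis unfolding st option.case n1 using Ghost v by blast
        next
          case False
          then show ?thesis using Ghost gp Cons ff by (simp add: xp)
        qed
      qed
    qed
  qed
qed

text \<open>The added 1 pays for \<open>Ghost e\<close> on an empty list, where the degree drops but
  the list does not get shorter.\<close>

lemma step_length:
  "step g x = Some y \<Longrightarrow> int (length (snd y)) \<le> int (length (snd x)) + generator_degree g + 1"
  by (cases g; cases x; cases "snd x") (auto split: if_splits)

lemma act_length:
  "act w x = Some y \<Longrightarrow> int (length (snd y)) \<le> int (length (snd x)) + word_degree w + int (length w)"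
proof (induction w arbitrary: y)
  case (Cons g w)
  then obtain z where z: "act w x = Some z" "step g z = Some y" by (auto split: option.splits)
  show ?case using Cons.IH[OF z(1)] step_length[OF z(2)] by (simp add: word_degree_def)
qed (simp add: word_degree_def)

lemma act_tp:
  assumes "set w \<subseteq> generators G" "x \<in> states" "length (snd x) + length w \<le> n"
  shows "case act w x of None \<Rightarrow> monomial w * tp n x \<doteq> 0
    | Some y \<Rightarrow> monomial w * tp n x \<doteq> tp (nat (int n + word_degree w)) y \<and>
        trv (nat (int n + word_degree w)) y = trv n x"
  using assms
proof (induction w)
  case Nil
  have "(monomial [] :: ('f, 'v, 'e) wpoly) = 1" by (simp flip: single_one add: zero_list_def)
  then show ?case by (simp add: word_degree_def)
next
  case (Cons g w)
  have g: "g \<in> generators G" and w: "set w \<subseteq> generators G" using Cons by auto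
  have gF: "(monomial [g] :: ('f, 'v, 'e) wpoly) \<in> FA" using g by simp
  have gw: "monomial (g # w) * tp n x = monomial [g] * (monomial w * tp n x)"
    by (simp add: monomial_mult flip: mult.assoc)
  show ?case
  proof (cases "act w x")
    case None
    then have "monomial w * tp n x \<doteq> 0" using Cons by simp
    then have "monomial [g] * (monomial w * tp n x) \<doteq> monomial [g] * 0" by (rule eqv_mult_left[OF gF])
    then show ?thesis using None unfolding gw by simp
  next
    case (Some y)
    define m where "m = nat (int n + word_degree w)"
    have y: "monomial w * tp n x \<doteq> tp m y" "trv m y = trv n x" using Cons Some by (auto simp: m_def)
    have ys: "y \<in> states" by (rule act_states[OF w Cons.prems(2) Some])
    have len: "int (length (snd y)) + 1 \<le> int n + word_degree w"
      using act_length[OF Some] Cons.prems(3) by simp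
    then have m: "length (snd y) + 1 \<le> m" "int m = int n + word_degree w" unfolding m_def by linarith+
    have eq: "monomial [g] * (monomial w * tp n x) \<doteq> monomial [g] * tp m y"
      by (rule eqv_mult_left[OF gF y(1)])
    have deg: "nat (int m + generator_degree g) = nat (int n + word_degree (g # w))"
      using m(2) by (simp add: word_degree_def algebra_simps)
    show ?thesis
      using step_tp[OF g ys m(1)] eqv_trans[OF eq] y(2) unfolding gw deg
      by (cases "step g y") (auto simp: Some)
  qed
qed

section \<open>Matrix coefficients of homogeneous elements\<close>

definition delta :: "'v \<times> 'e list \<Rightarrow> 'v \<times> 'e list \<Rightarrow> 'f" where "delta y z = (if z = y then 1 else 0)"

text \<open>A finite set containing every state that occurs in \<open>a x\<close>; terms that cancel
  remain in it. The coefficient of y in \<open>a x\<close> is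
  \<open>rep a (delta y) x\<close>.\<close>

definition support :: "('f, 'v, 'e) wpoly \<Rightarrow> 'v \<times> 'e list \<Rightarrow> ('v \<times> 'e list) set" where
  "support a x = {y. \<exists>w\<in>Poly_Mapping.keys a. act w x = Some y}"

lemma finite_support: "finite (support a x)"
proof -
  have "support a x \<subseteq> (\<lambda>w. the (act w x)) ` Poly_Mapping.keys a" by (force simp: support_def)
  then show ?thesis by (rule finite_subset) simp
qed

lemma support_states: "a \<in> FA \<Longrightarrow> x \<in> states \<Longrightarrow> y \<in> support a x \<Longrightarrow> y \<in> states"
  unfolding support_def FA_def using act_states by blast

lemma rep_delta_support: "y \<notin> support a x \<Longrightarrow> rep a (delta y) x = 0"
  unfolding rep_def linext_def support_def
  by (rule sum.neutral) (auto simp: delta_def split: option.splits)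

lemma scal_sum_left: "scal (sum f D) p = (\<Sum>i\<in>D. scal (f i) (p :: ('f, 'v, 'e) wpoly))"
  by (induction D rule: infinite_finite_induct)
    (simp_all only: sum.infinite sum.empty sum.insert poly.sc_zero_left poly.sc_add_left not_False_eq_True)

lemma option_expand:
  assumes "finite Y" "\<And>y. o' = Some y \<Longrightarrow> y \<in> Y"
  shows "(case o' of None \<Rightarrow> 0 | Some y \<Rightarrow> h y) =
    (\<Sum>y\<in>Y. scal (case o' of None \<Rightarrow> 0 | Some z \<Rightarrow> delta y z) (h y) :: ('f, 'v, 'e) wpoly)"
proof (cases o')
  case (Some z)
  have "(\<Sum>y\<in>Y. scal (delta y z) (h y)) = (\<Sum>y\<in>Y. if y = z then h z else 0)"
    by (rule sum.cong) (auto simp: delta_def)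
  then show ?thesis using assms Some by simp
qed simp

lemma rep_expand: "rep a \<phi> x = (\<Sum>y\<in>support a x. \<phi> y * rep a (delta y) x)"
proof -
  have "(case act w x of None \<Rightarrow> 0 | Some y \<Rightarrow> \<phi> y) =
      (\<Sum>y\<in>support a x. \<phi> y * (case act w x of None \<Rightarrow> 0 | Some z \<Rightarrow> delta y z))"
    if "w \<in> Poly_Mapping.keys a" for w
  proof (cases "act w x")
    case (Some z)
    then have "z \<in> support a x" using that by (auto simp: support_def)
    have "(\<Sum>y\<in>support a x. \<phi> y * delta y z) = (\<Sum>y\<in>support a x. if y = z then \<phi> z else 0)"
      by (rule sum.cong) (auto simp: delta_def)
    then show ?thesis using Some \<open>z \<in> support a x\<close> finite_support by simp
  qed simp
  then have "rep a \<phi> x = linext (\<lambda>w. \<Sum>y\<in>support a x. \<phi> y * (case act w x of None \<Rightarrow> 0 | Some z \<Rightarrow> delta y z)) a"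
    unfolding rep_def linext_def by (intro sum.cong) auto
  then show ?thesis by (simp add: linext_lin rep_def)
qed

text \<open>All words of \<open>a\<close> have degree d and hence move the cut by the same amount,
  so the terms belonging to one state can be collected at a single truncation level. The bound on n
  comes from the finitely many words of \<open>a\<close>.\<close>

lemma mult_tp:
  assumes a: "a \<in> FA" "degree_part d a = a" and x: "x \<in> states"
  obtains n0 where "\<And>n. n \<ge> n0 \<Longrightarrow>
    a * tp n x \<doteq> (\<Sum>y\<in>support a x. scal (rep a (delta y) x) (tp (nat (int n + d)) y))"
    "\<And>n y. n \<ge> n0 \<Longrightarrow> y \<in> support a x \<Longrightarrow> trv (nat (int n + d)) y = trv n x"
proof
  let ?n0 = "length (snd x) + (\<Sum>w\<in>Poly_Mapping.keys a. length w)"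
  have len: "length (snd x) + length w \<le> n" if "n \<ge> ?n0" "w \<in> Poly_Mapping.keys a" for n w
    using that member_le_sum[of w "Poly_Mapping.keys a" length] by simp
  have gen: "set w \<subseteq> generators G" "word_degree w = d" if "w \<in> Poly_Mapping.keys a" for w
    using a that by (auto simp: FA_def degree_part_eq_iff)
  show "trv (nat (int n + d)) y = trv n x" if "n \<ge> ?n0" "y \<in> support a x" for n y
  proof -
    obtain w where w: "w \<in> Poly_Mapping.keys a" "act w x = Some y" using \<open>y \<in> support a x\<close> by (auto simp: support_def)
    show ?thesis using act_tp[OF gen(1)[OF w(1)] x len[OF that(1) w(1)]] gen(2)[OF w(1)] w(2) by simp
  qed
  show "a * tp n x \<doteq> (\<Sum>y\<in>support a x. scal (rep a (delta y) x) (tp (nat (int n + d)) y))" if n: "n \<ge> ?n0" for n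
  proof -
    let ?h = "\<lambda>y. tp (nat (int n + d)) y"
    let ?K = "Poly_Mapping.keys a" and ?c = "Poly_Mapping.lookup a"
    have "a * tp n x = (\<Sum>w\<in>?K. Poly_Mapping.single w (?c w)) * tp n x"
      by (rule arg_cong[OF poly_expand])
    also have "\<dots> = (\<Sum>w\<in>?K. scal (?c w) (monomial w * tp n x))"
      unfolding sum_distrib_right
      by (intro sum.cong refl) (simp add: single_eq_scal[symmetric] flip: poly.sc_mult_left)
    also have "\<dots> \<doteq> (\<Sum>w\<in>?K. scal (?c w) (case act w x of None \<Rightarrow> 0 | Some y \<Rightarrow> ?h y))"
    proof (intro eqv_sum eqv_scal)
      fix w assume w: "w \<in> ?K"
      show "monomial w * tp n x \<doteq> (case act w x of None \<Rightarrow> 0 | Some y \<Rightarrow> ?h y)"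
        using act_tp[OF gen(1)[OF w] x len[OF n w]] gen(2)[OF w] by (cases "act w x") auto
    qed
    also have "\<dots> = (\<Sum>w\<in>?K. \<Sum>y\<in>support a x. scal (?c w * (case act w x of None \<Rightarrow> 0 | Some z \<Rightarrow> delta y z)) (?h y))"
    proof (intro sum.cong refl)
      fix w assume w: "w \<in> ?K"
      have "(case act w x of None \<Rightarrow> 0 | Some y \<Rightarrow> ?h y) =
          (\<Sum>y\<in>support a x. scal (case act w x of None \<Rightarrow> 0 | Some z \<Rightarrow> delta y z) (?h y))"
        by (rule option_expand[OF finite_support]) (use w in \<open>auto simp: support_def\<close>)
      then show "scal (?c w) (case act w x of None \<Rightarrow> 0 | Some y \<Rightarrow> ?h y) =
          (\<Sum>y\<in>support a x. scal (?c w * (case act w x of None \<Rightarrow> 0 | Some z \<Rightarrow> delta y z)) (?h y))"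
        by (simp only: poly.sc_sum_right poly.sc_assoc)
    qed
    also have "\<dots> = (\<Sum>y\<in>support a x. \<Sum>w\<in>?K. scal (?c w * (case act w x of None \<Rightarrow> 0 | Some z \<Rightarrow> delta y z)) (?h y))"
      by (rule sum.swap)
    also have "\<dots> = (\<Sum>y\<in>support a x. scal (rep a (delta y) x) (?h y))"
      unfolding rep_def linext_def scal_sum_left ..
    finally show ?thesis .
  qed
qed

text \<open>If one of the two prefixes were longer, its last edge would belong to the special tail
  of the other decomposition, although it is not special.\<close>

lemma special_tail_unique:
  assumes "p @ z = p' @ z'" "set z \<subseteq> special" "set z' \<subseteq> special"
    "p = [] \<or> last p \<notin> special" "p' = [] \<or> last p' \<notin> special"
  shows "p = p'"
proof -
  have *: "q = q'" if "q = q' @ us" "us @ y = y'" "set y' \<subseteq> special" "q = [] \<or> last q \<notin> special" for q q' us y y'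
  proof (rule ccontr)
    assume "q \<noteq> q'"
    then have "us \<noteq> []" using that(1) by auto
    then have "last q \<in> set us" "q \<noteq> []" using that(1) by auto
    moreover have "set us \<subseteq> special" using that(2,3) by auto
    ultimately show False using that(4) by blast
  qed
  obtain us where "p = p' @ us \<and> us @ z = z' \<or> p @ us = p' \<and> z = us @ z'"
    using assms(1) by (auto simp: append_eq_append_conv2)
  then show ?thesis using *[of p p' us z z'] *[of p' p us z' z] assms by metis
qed

text \<open>At a common level n, one truncation extends another only if they coincide, because the
  shorter one would have full length n or end at a sink. Equal truncations force equal states by
  \<open>special_tail_unique\<close>.\<close>

lemma ts_tp_diff:
  assumes x: "x \<in> states" "length (snd x) \<le> n" and y: "y \<in> states" "length (snd y) \<le> n" and "x \<noteq> y"
  shows "ts n x * tp n y \<doteq> 0"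
  unfolding ts_def tp_def
proof (rule sm_pm_zero[OF isp_tr[OF x(1)] isp_tr[OF y(1)]], rule notI)
  have eq: "gs = []" if xy: "z \<in> states" "length (snd z) \<le> n" "z' \<in> states" "length (snd z') \<le> n"
    "fst z = fst z'" "tr n z' = tr n z @ gs" for z z' gs
  proof (cases "sink G (trv n z)")
    case True
    have "isp (fst z) (tr n z @ gs)" using isp_tr[OF xy(3), of n] xy by simp
    then show ?thesis using isp_sink[OF True] by (simp add: isp_append trv_def)
  next
    case False
    have "length (tr n z') \<le> n" using xy(4) length_zs_le[of "endv (fst z') (snd z')" "n - length (snd z')"] by (cases z') auto
    moreover have "length (tr n z) = n"
      using False xy(2) length_zs by (cases z) (auto simp: trv_def)
    ultimately show ?thesis using xy(6) by simp
  qed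
  assume "fst x = fst y \<and> ((\<exists>gs. tr n y = tr n x @ gs) \<or> (\<exists>gs. tr n x = tr n y @ gs))"
  then have f: "fst x = fst y" and "(\<exists>gs. tr n y = tr n x @ gs) \<or> (\<exists>gs. tr n x = tr n y @ gs)" by auto
  then obtain gs where "tr n y = tr n x @ gs \<or> tr n x = tr n y @ gs" by blast
  then have "tr n x = tr n y" using eq[OF x y f] eq[OF y x f[symmetric]] append_Nil2 by metis
  moreover obtain u p v q where xy: "x = (u, p)" "y = (v, q)" by (cases x; cases y)
  ultimately have "p = q"
    using x y special_tail_unique[of p "zs (endv u p) (n - length p)" q "zs (endv v q) (n - length q)"]
    by (simp add: states_def zs_special isp_verts)
  then show False using f \<open>x \<noteq> y\<close> \<open>x = (u, p)\<close> \<open>y = (v, q)\<close> by simp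
qed

lemma ts_tp_same: "x \<in> states \<Longrightarrow> ts n x * tp n x \<doteq> gvert (trv n x)"
  unfolding ts_def tp_def trv_def by (rule sm_pm_same[OF isp_tr])

lemma tp_gvert: "x \<in> states \<Longrightarrow> tp n x * gvert (trv n x) \<doteq> tp n x"
  using pm_gvert[OF isp_tr trv_verts, of x x n n] by (simp add: tp_def trv_def)

lemma gvert_ts: "x \<in> states \<Longrightarrow> gvert (trv n x) * ts n x \<doteq> ts n x"
  using eqv_star[OF tp_gvert, of x n] by (simp add: star_mult star_word_def)

text \<open>Matrix coefficients are read off by compression with the idempotents \<open>tp n x * ts n x\<close>.\<close>

lemma compress:
  assumes a: "a \<in> FA" "degree_part d a = a" and x: "x \<in> states" and y: "y \<in> states"
  obtains n0 where "\<And>n. n \<ge> n0 \<Longrightarrow>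
    (tp (nat (int n + d)) y * ts (nat (int n + d)) y) * a * (tp n x * ts n x)
      \<doteq> scal (rep a (delta y) x) (tp (nat (int n + d)) y * ts n x)"
proof -
  obtain n1 where n1: "\<And>n. n \<ge> n1 \<Longrightarrow>
    a * tp n x \<doteq> (\<Sum>y\<in>support a x. scal (rep a (delta y) x) (tp (nat (int n + d)) y))"
    by (rule mult_tp[OF a x]) blast
  define n0 where "n0 = n1 + nat (- d) + (\<Sum>z\<in>insert y (support a x). length (snd z))"
  show ?thesis
  proof
    fix n assume n: "n \<ge> n0"
    define m where "m = nat (int n + d)"
    have m: "length (snd z) \<le> m" if "z \<in> insert y (support a x)" for z
      using member_le_sum[of z "insert y (support a x)" "\<lambda>z. length (snd z)"] that n finite_support
      by (simp add: m_def n0_def)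
    note F = tp_FA[OF y] ts_FA[OF y] tp_FA[OF x] ts_FA[OF x]
    let ?Y = "support a x"
    have "(tp m y * ts m y) * a * (tp n x * ts n x) = tp m y * (ts m y * (a * tp n x)) * ts n x"
      by (simp only: mult.assoc)
    also have "\<dots> \<doteq> tp m y * (ts m y * (\<Sum>z\<in>?Y. scal (rep a (delta z) x) (tp m z))) * ts n x"
      unfolding m_def by (intro eqv_mult_right eqv_mult_left F n1) (use n n0_def in simp)
    also have "\<dots> = tp m y * (\<Sum>z\<in>?Y. scal (rep a (delta z) x) (ts m y * tp m z)) * ts n x"
      by (simp only: sum_distrib_left poly.sc_mult_right)
    also have "\<dots> \<doteq> tp m y * (\<Sum>z\<in>?Y. if z = y then scal (rep a (delta y) x) (gvert (trv m y)) else 0) * ts n x"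
    proof (intro eqv_mult_right eqv_mult_left F eqv_sum)
      fix z assume z: "z \<in> ?Y"
      have zs: "z \<in> states" by (rule support_states[OF a(1) x z])
      show "scal (rep a (delta z) x) (ts m y * tp m z) \<doteq> (if z = y then scal (rep a (delta y) x) (gvert (trv m y)) else 0)"
      proof (cases "z = y")
        case True
        then show ?thesis using eqv_scal[OF ts_tp_same[OF y]] by simp
      next
        case False
        have "ts m y * tp m z \<doteq> 0" by (rule ts_tp_diff) (use False m z zs y in auto)
        then show ?thesis using eqv_scal[of "ts m y * tp m z" 0] False by simp
      qed
    qed
    also have "\<dots> = tp m y * (scal (rep a (delta y) x) (gvert (trv m y))) * ts n x"
      using finite_support rep_delta_support[of y a x] by (cases "y \<in> ?Y") simp_all
    also have "\<dots> = scal (rep a (delta y) x) (tp m y * gvert (trv m y) * ts n x)"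
      by (simp only: poly.sc_mult_right poly.sc_mult_left)
    also have "\<dots> \<doteq> scal (rep a (delta y) x) (tp m y * ts n x)"
      by (intro eqv_scal eqv_mult_right F tp_gvert y)
    finally show "(tp (nat (int n + d)) y * ts (nat (int n + d)) y) * a * (tp n x * ts n x)
      \<doteq> scal (rep a (delta y) x) (tp (nat (int n + d)) y * ts n x)" by (simp only: m_def)
  qed
qed

text \<open>Let s be the special end of \<open>fs\<close> and D the length difference. Beyond its
  first l edges \<open>fs\<close> is special, so its length is at most l + s. The total length is
  then at most 2l + 2s + D, which is less than (2l + 2)(s + D + 1).\<close>

lemma not_deep:
  assumes "set (drop l fs) \<subseteq> special" "2 * l + 2 \<le> k"
  shows "\<not> deep k es fs"
proof
  assume d: "deep k es fs"
  define a b s D where "a = length es" and "b = length fs" and "s = sdl fs"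
    and "D = (a - b) + (b - a)"
  have "sdl fs = sdl (take l fs) + length (drop l fs)"
    using sdl_append_special[OF assms(1), of "take l fs"] by simp
  then have b: "b \<le> l + s" by (simp add: s_def b_def)
  have "k * (sdl es + s + D + 1) \<le> a + b" using d by (simp add: deep_def a_def b_def s_def D_def ac_simps)
  moreover have "k * (s + D + 1) \<le> k * (sdl es + s + D + 1)" by (intro mult_le_mono2) simp
  moreover have "(2 * l + 2) * (s + D + 1) \<le> k * (s + D + 1)" using assms(2) by (rule mult_le_mono1)
  moreover have "2 * s + D + 2 * l + 2 \<le> (2 * l + 2) * (s + D + 1)" by (simp add: algebra_simps)
  ultimately have "2 * s + D + 2 * l + 2 \<le> a + b" by linarith
  moreover have "a \<le> b + D" by (simp add: D_def)
  ultimately show False using b by linarith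
qed

text \<open>If \<open>fs\<close> extends the truncation, the idempotent acts as a unit; if it is an
  initial part of the truncation, depth is excluded by \<open>not_deep\<close>; otherwise the
  product vanishes. No bound involves n, so one neighbourhood works for all truncations.\<close>

lemma N_mult_proj:
  assumes v: "v \<in> N k" and x: "x \<in> states" and k: "2 * length (snd x) + 2 \<le> k"
  shows "v * (tp n x * ts n x) \<in> N k"
proof -
  note F = tp_FA[OF x] ts_FA[OF x]
  have QF: "tp n x * ts n x \<in> FA" using F by (simp add: FA.S_mult)
  have "N k \<subseteq> {v \<in> FA. v * (tp n x * ts n x) \<in> N k}"
  proof (rule N_induct)
    show "poly.subsp {v \<in> FA. v * (tp n x * ts n x) \<in> N k}"
      using N_closed by (auto simp: poly.subsp_def distrib_right FA.S_closed)
    show "rel_ideal \<subseteq> {v \<in> FA. v * (tp n x * ts n x) \<in> N k}"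
      using rel_ideal_mult(2)[OF QF] rel_ideal_sub rel_ideal_N by blast
    fix u es w fs assume p: "isp u es" "isp w fs" and d: "deep k es fs"
    obtain u' q where xq: "x = (u', q)" by (cases x)
    have pu: "isp u' (tr n x)" using isp_tr[OF x, of n] xq by simp
    have eqQ: "(pm u es * sm w fs) * (tp n x * ts n x) = pm u es * (sm w fs * pm u' (tr n x)) * sm u' (tr n x)"
      by (simp add: tp_def ts_def xq mult.assoc)
    consider gs where "w = u'" "fs = tr n x @ gs" | gs where "w = u'" "tr n x = fs @ gs"
      | "\<not> (w = u' \<and> ((\<exists>gs. tr n x = fs @ gs) \<or> (\<exists>gs. fs = tr n x @ gs)))" by blast
    then have "(pm u es * sm w fs) * (tp n x * ts n x) \<in> N k"
    proof cases
      case (1 gs)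
      have q: "isp u' (tr n x @ gs)" "isp (endv u' (tr n x)) gs" using p 1 by (auto simp: isp_append)
      have "pm u es * (sm w fs * pm u' (tr n x)) * sm u' (tr n x) \<doteq>
          pm u es * sm (endv u' (tr n x)) gs * sm u' (tr n x)"
        unfolding 1 by (intro eqv_mult_right eqv_mult_left pm_FA sm_FA p pu sm_pm_prefix' q)
      also have "\<dots> = pm u es * (sm (endv u' (tr n x)) gs * sm u' (tr n x))" by (simp only: mult.assoc)
      also have "\<dots> \<doteq> pm u es * sm u' (tr n x @ gs)"
        using sm_sm[OF pu q(2)] by (intro eqv_mult_left pm_FA p) simp
      finally show ?thesis unfolding eqQ using N_eqv N_gens[OF p d] 1 by blast
    next
      case (2 gs)
      have "set (drop (length q) (tr n x)) \<subseteq> special"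
        using zs_special x by (auto simp: states_def xq isp_verts)
      moreover have "set (drop (length q) fs) \<subseteq> set (drop (length q) (tr n x))" unfolding 2(2) by simp
      ultimately have "set (drop (length q) fs) \<subseteq> special" by blast
      then show ?thesis using not_deep[of "length q" fs k es] k d by (simp add: xq)
    next
      case 3
      have "pm u es * (sm w fs * pm u' (tr n x)) * sm u' (tr n x) \<doteq> pm u es * 0 * sm u' (tr n x)"
        by (intro eqv_mult_right eqv_mult_left pm_FA sm_FA p pu sm_pm_zero 3)
      then show ?thesis unfolding eqQ using N_eqv[of _ "pm u es * 0 * sm u' (tr n x)" k] N_closed(1) by simp
    qed
    then show "pm u es * sm w fs \<in> {v \<in> FA. v * (tp n x * ts n x) \<in> N k}"
      using p by (simp add: FA.S_mult pm_FA sm_FA)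
  qed auto
  then show ?thesis using v by blast
qed

lemma N_proj_mult:
  assumes "v \<in> N k" "x \<in> states" "2 * length (snd x) + 2 \<le> k"
  shows "(tp n x * ts n x) * v \<in> N k"
  using N_mult_proj[OF N_star[OF assms(1)] assms(2,3), of n] N_star_iff[of "(tp n x * ts n x) * v" k]
  by (simp add: star_mult)

text \<open>A ghost path that does not annihilate the state is an initial segment of its path, and
  that path is special beyond the edges listed in \<open>p\<close>.\<close>

lemma act_ghosts:
  "act (map Ghost (rev fs)) (u, p) \<noteq> None \<Longrightarrow> set fs \<subseteq> arcs G \<Longrightarrow> set (drop (length p) fs) \<subseteq> special"
proof (induction fs arbitrary: u p)
  case (Cons e fs)
  have eq: "act (map Ghost (rev (e # fs))) (u, p) = (case step (Ghost e) (u, p) of None \<Rightarrow> None | Some y \<Rightarrow> act (map Ghost (rev fs)) y)"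
    by (simp add: act_append)
  show ?case
  proof (cases p)
    case Nil
    then have "e \<in> special" "act (map Ghost (rev fs)) (head G e, []) \<noteq> None"
      using Cons.prems eq by (auto split: if_splits)
    then show ?thesis using Cons.IH[of "head G e" "[]"] Cons.prems(2) Nil by simp
  next
    case (Cons f q)
    then have "act (map Ghost (rev fs)) (head G e, q) \<noteq> None"
      using Cons.prems(1) eq by (auto split: if_splits)
    then show ?thesis using Cons.IH[of "head G e" q] Cons.prems(2) Cons by simp
  qed
qed simp

lemma rep_N:
  assumes v: "v \<in> N k" and x: "x \<in> states" and k: "2 * length (snd x) + 2 \<le> k"
  shows "rep v \<phi> x = 0"
proof -
  have "N k \<subseteq> {v \<in> FA. \<forall>\<phi>. rep v \<phi> x = 0}"
  proof (rule N_induct)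
    show "poly.subsp {v \<in> FA. \<forall>\<phi>. rep v \<phi> x = 0}"
      by (auto simp: poly.subsp_def rep_add rep_scal FA.S_closed)
    show "rel_ideal \<subseteq> {v \<in> FA. \<forall>\<phi>. rep v \<phi> x = 0}" using rel_ideal_sub rep_rel_ideal[OF _ x] by blast
    fix u es w fs assume p: "isp u es" "isp w fs" and d: "deep k es fs"
    obtain u' q where xq: "x = (u', q)" by (cases x)
    have "act (path_star_word (w, fs)) x = None"
    proof (cases "fs = []")
      case True
      then show ?thesis using not_deep[of 0 fs k es] d k by simp
    next
      case False
      have pw: "path_star_word (w, fs) = map Ghost (rev fs)"
        using False by (simp add: path_star_word_def path_word_def rev_map)
      have "set fs \<subseteq> arcs G" using isp_arcs[OF p(2)] by blast
      moreover have "\<not> set (drop (length q) fs) \<subseteq> special"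
        using not_deep[of "length q" fs k es] d k by (auto simp: xq)
      ultimately show ?thesis unfolding pw xq using act_ghosts[of fs u' q] by blast
    qed
    then have "rep (pm u es * sm w fs) \<phi> x = 0" for \<phi> by (simp add: rep_mult sm_def rep_monomial)
    then show "pm u es * sm w fs \<in> {v \<in> FA. \<forall>\<phi>. rep v \<phi> x = 0}"
      using p by (simp add: FA.S_mult pm_FA sm_FA)
  qed auto
  then show ?thesis using v by blast
qed

section \<open>Decomposing vertices into idempotents of paths\<close>

definition proj :: "'v \<Rightarrow> 'e list \<Rightarrow> ('f, 'v, 'e) wpoly" where "proj u p = pm u p * sm u p"

lemma proj_FA: "isp u p \<Longrightarrow> proj u p \<in> FA" by (simp add: proj_def FA.S_mult pm_FA sm_FA)

lemma proj_Nil: "u \<in> verts G \<Longrightarrow> proj u [] \<doteq> gvert u"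
  using gvert_pm[of u u "[]"] by (simp add: proj_def)

lemma proj_expand:
  assumes p: "isp u p" and ns: "\<not> sink G (endv u p)"
  shows "proj u p \<doteq> (\<Sum>f\<in>out_arcs G (endv u p). proj u (p @ [f]))"
proof -
  let ?v = "endv u p"
  have v: "?v \<in> verts G" by (rule isp_verts(2)[OF p])
  have pg: "pm u p \<doteq> pm u p * gvert ?v" using pm_gvert[OF p v] by (simp add: eqv_sym)
  have "proj u p \<doteq> (pm u p * gvert ?v) * sm u p" unfolding proj_def by (intro eqv_mult_right sm_FA p pg)
  also have "\<dots> \<doteq> (pm u p * (\<Sum>f\<in>out_arcs G ?v. gedge f * gghost f)) * sm u p"
    by (intro eqv_mult_right eqv_mult_left sm_FA pm_FA p eqv_relations(7) v ns)
  also have "\<dots> = (\<Sum>f\<in>out_arcs G ?v. (pm u p * gedge f) * (gghost f * sm u p))"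
    by (simp add: sum_distrib_left sum_distrib_right mult.assoc)
  also have "\<dots> \<doteq> (\<Sum>f\<in>out_arcs G ?v. proj u (p @ [f]))"
  proof (rule eqv_sum)
    fix f assume "f \<in> out_arcs G ?v"
    then have f: "isp ?v [f]" by (simp add: isp_append)
    have e: "gedge f = pm ?v [f]" "gghost f = sm ?v [f]"
      by (simp_all add: pm_def sm_def path_word_def path_star_word_def)
    have q: "isp u (p @ [f])" using p f by (simp add: isp_append)
    have "(pm u p * pm ?v [f]) * (sm ?v [f] * sm u p) \<doteq> pm u (p @ [f]) * (sm ?v [f] * sm u p)"
      using pm_pm[OF p f] by (intro eqv_mult_right FA.S_mult sm_FA f p) simp
    also have "\<dots> \<doteq> pm u (p @ [f]) * sm u (p @ [f])"
      using sm_sm[OF p f] by (intro eqv_mult_left pm_FA q) simp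
    finally show "(pm u p * gedge f) * (gghost f * sm u p) \<doteq> proj u (p @ [f])"
      unfolding e by (simp add: proj_def)
  qed
  finally show ?thesis .
qed

text \<open>Splitting the end vertex by its outgoing edges separates the special continuation from
  the nonspecial exits, which make up the difference; at a sink nothing changes.\<close>

lemma proj_step:
  fixes n :: nat
  assumes p: "isp u p"
  defines "q \<equiv> p @ zs (endv u p) n"
  shows "proj u q - proj u (p @ zs (endv u p) (Suc n)) \<doteq>
    (if sink G (endv u q) then 0 else \<Sum>f\<in>out_arcs G (endv u q) - {\<gamma> (endv u q)}. proj u (q @ [f]))"
proof -
  have v: "endv u p \<in> verts G" by (rule isp_verts(2)[OF p])
  have q: "isp u q" using p v isp_zs by (simp add: q_def isp_append)
  have "p @ zs (endv u p) (Suc n) = q @ zs (endv u q) 1"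
    using zs_add[of "endv u p" n 1] by (simp add: q_def)
  then have eq: "p @ zs (endv u p) (Suc n) = (if sink G (endv u q) then q else q @ [\<gamma> (endv u q)])" by simp
  show ?thesis
  proof (cases "sink G (endv u q)")
    case True
    then show ?thesis unfolding eq by simp
  next
    case False
    have g: "\<gamma> (endv u q) \<in> out_arcs G (endv u q)" using \<gamma>_out[OF isp_verts(2)[OF q] False] by simp
    have "(\<Sum>f\<in>out_arcs G (endv u q). proj u (q @ [f])) =
        proj u (q @ [\<gamma> (endv u q)]) + (\<Sum>f\<in>out_arcs G (endv u q) - {\<gamma> (endv u q)}. proj u (q @ [f]))"
      using g by (intro sum.remove) auto
    then show ?thesis
      using eqv_diff[OF proj_expand[OF q False] eqv_refl[of "proj u (q @ [\<gamma> (endv u q)])"]] False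
      unfolding eq by simp
  qed
qed

lemma nonspecial_snoc:
  assumes "isp u q" "f \<in> out_arcs G (endv u q) - {\<gamma> (endv u q)}"
  shows "isp u (q @ [f])" "sdl (q @ [f]) = 0" "f \<in> arcs G" "endv u (q @ [f]) = head G f" "tail G f = endv u q"
  using assms by (auto simp: isp_append sdl_snoc special_iff)

lemma proj_deep: "isp u p \<Longrightarrow> sdl p = 0 \<Longrightarrow> k \<le> 2 * length p \<Longrightarrow> proj u p \<in> N k"
  unfolding proj_def by (rule N_gens) (auto simp: deep_def)

text \<open>The exits between the levels m and m' end in nonspecial edges, so their special ends and
  length differences are 0 while their length exceeds k: they are deep.\<close>

lemma proj_tail_cauchy:
  assumes p: "isp u p" and m: "k \<le> m" "m \<le> m'"
  shows "proj u (p @ zs (endv u p) m) - proj u (p @ zs (endv u p) m') \<in> N k"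
  using m(2)
proof (induction rule: dec_induct)
  case base
  show ?case by (simp add: N_closed)
next
  case (step n)
  let ?q = "p @ zs (endv u p) n"
  have v: "endv u p \<in> verts G" by (rule isp_verts(2)[OF p])
  have q: "isp u ?q" using p v isp_zs by (simp add: isp_append)
  have "(if sink G (endv u ?q) then 0 else \<Sum>f\<in>out_arcs G (endv u ?q) - {\<gamma> (endv u ?q)}. proj u (?q @ [f])) \<in> N k"
  proof (cases "sink G (endv u ?q)")
    case False
    have "proj u (?q @ [f]) \<in> N k" if f: "f \<in> out_arcs G (endv u ?q) - {\<gamma> (endv u ?q)}" for f
    proof (rule proj_deep)
      show "isp u (?q @ [f])" "sdl (?q @ [f]) = 0" using nonspecial_snoc[OF q f] by auto
      have "length (zs (endv u p) n) = n" using False by (intro length_zs) simp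
      then show "k \<le> 2 * length (?q @ [f])" using m(1) step by simp
    qed
    then have "(\<Sum>f\<in>out_arcs G (endv u ?q) - {\<gamma> (endv u ?q)}. proj u (?q @ [f])) \<in> N k"
      by (rule poly.subsp_sum[OF N_subsp])
    then show ?thesis using False by simp
  qed (simp add: N_closed)
  then have "proj u ?q - proj u (p @ zs (endv u p) (Suc n)) \<in> N k" using N_eqv[OF proj_step[OF p, of n]] by blast
  then show ?case using N_closed(2)[OF step.IH] by fastforce
qed

text \<open>Every vertex is, modulo arbitrarily deep terms, a sum of idempotents attached to states.\<close>

lemma proj_induct:
  assumes K: "poly.subsp K" "rel_ideal \<subseteq> K" "N k \<subseteq> K"
    and U: "\<And>e. e \<in> arcs G \<Longrightarrow> tail G e \<in> U \<Longrightarrow> head G e \<in> U"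
    and lim: "\<And>u p. isp u p \<Longrightarrow> endv u p \<in> U \<Longrightarrow> sdl p = 0 \<Longrightarrow> \<exists>n. proj u (p @ zs (endv u p) n) \<in> K"
    and p: "isp u p" "endv u p \<in> U" "sdl p = 0"
  shows "proj u p \<in> K"
  using p
\<comment> \<open>A path of length at least k is already deep, and every nonspecial exit is strictly
  longer than \<open>p\<close>. The special continuation is handled by telescoping up to the level
  supplied by \<open>lim\<close>.\<close>
proof (induction "k - length p" arbitrary: p rule: less_induct)
  case less
  show ?case
  proof (cases "k \<le> length p")
    case True
    then show ?thesis using proj_deep[of u p k] less.prems K(3) by auto
  next
    case False
    have U_iter: "(nx ^^ n) (endv u p) \<in> U" for n
    proof (induction n)
      case (Suc n)
      have "(nx ^^ n) (endv u p) \<in> verts G" by (induction n) (auto simp: nx_verts isp_verts(2)[OF less.prems(1)])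
      then have "nx ((nx ^^ n) (endv u p)) \<in> U"
        using Suc U[of "\<gamma> ((nx ^^ n) (endv u p))"] \<gamma>_out[of "(nx ^^ n) (endv u p)"]
        unfolding nx_def[of "(nx ^^ n) (endv u p)"] by (simp del: funpow.simps split: if_splits)
      then show ?case by simp
    qed (simp add: less.prems)
    have v: "endv u p \<in> verts G" by (rule isp_verts(2)[OF less.prems(1)])
    have step: "proj u (p @ zs (endv u p) n) - proj u (p @ zs (endv u p) (Suc n)) \<in> K" for n
    proof -
      let ?q = "p @ zs (endv u p) n"
      have q: "isp u ?q" using less.prems v isp_zs by (simp add: isp_append)
      have "(if sink G (endv u ?q) then 0 else \<Sum>f\<in>out_arcs G (endv u ?q) - {\<gamma> (endv u ?q)}. proj u (?q @ [f])) \<in> K"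
      proof (cases "sink G (endv u ?q)")
        case False
        have "proj u (?q @ [f]) \<in> K" if f: "f \<in> out_arcs G (endv u ?q) - {\<gamma> (endv u ?q)}" for f
        proof (rule less.hyps)
          note nf = nonspecial_snoc[OF q f]
          show "k - length (?q @ [f]) < k - length p" using \<open>\<not> k \<le> length p\<close> by simp
          show "isp u (?q @ [f])" "sdl (?q @ [f]) = 0" by (rule nf)+
          have "endv u ?q \<in> U" using U_iter[of n] by (simp add: endv_zs)
          then show "endv u (?q @ [f]) \<in> U" using U[OF nf(3)] nf(4,5) by simp
        qed
        then have "(\<Sum>f\<in>out_arcs G (endv u ?q) - {\<gamma> (endv u ?q)}. proj u (?q @ [f])) \<in> K"
          by (rule poly.subsp_sum[OF K(1)])
        then show ?thesis using False by simp
      qed (simp add: poly.subspD(1)[OF K(1)])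
      moreover have "(proj u ?q - proj u (p @ zs (endv u p) (Suc n)))
        - (if sink G (endv u ?q) then 0 else \<Sum>f\<in>out_arcs G (endv u ?q) - {\<gamma> (endv u ?q)}. proj u (?q @ [f])) \<in> K"
        using proj_step[OF less.prems(1), of n] K(2) unfolding eqv_def by blast
      ultimately show ?thesis using poly.subsp_diff_iff[OF K(1)] by blast
    qed
    have tele: "proj u p - proj u (p @ zs (endv u p) n) \<in> K" for n
    proof (induction n)
      case 0
      show ?case by (simp add: poly.subspD(1)[OF K(1)])
    next
      case (Suc n)
      show ?case using poly.subspD(2)[OF K(1) Suc step[of n]] by fastforce
    qed
    obtain n where "proj u (p @ zs (endv u p) n) \<in> K" using lim less.prems by blast
    then show ?thesis using poly.subsp_diff_iff[OF K(1) tele[of n]] by blast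
  qed
qed

text \<open>Every generator, and so the last letter of every word, is fixed on the right by exactly
  one vertex and killed by the others. Smallness of \<open>a\<close> can thus be tested on finitely
  many products with vertices.\<close>

lemma sum_vertices:
  assumes "a \<in> FA"
  shows "a \<doteq> (\<Sum>v\<in>verts G. a * gvert v)"
proof -
  define K where "K = {a \<in> FA. a \<doteq> (\<Sum>v\<in>verts G. a * gvert v)}"
  have K: "poly.subsp K"
    unfolding poly.subsp_def
  proof (intro conjI ballI allI)
    show "0 \<in> K" by (simp add: K_def FA.S_closed)
    fix a assume a: "a \<in> K"
    show "scal c a \<in> K" for c
      using a eqv_scal[of a "\<Sum>v\<in>verts G. a * gvert v" c] by (simp add: K_def FA.S_closed poly.sc_sum_right)
    fix b assume "b \<in> K"
    then show "a + b \<in> K"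
      using a eqv_add[of a "\<Sum>v\<in>verts G. a * gvert v" b] by (simp add: K_def FA.S_closed distrib_right sum.distrib)
  qed
  have gen: "monomial [g] \<doteq> (\<Sum>v\<in>verts G. monomial [g] * gvert v)" if g: "g \<in> generators G" for g
  proof -
    obtain w where w: "w \<in> verts G"
      and eq: "\<And>v. v \<in> verts G \<Longrightarrow> monomial [g] * gvert v \<doteq> (if v = w then monomial [g] else (0 :: ('f, 'v, 'e) wpoly))"
    proof (cases g)
      case (Vert u)
      have "u \<in> verts G" using g Vert by simp
      show ?thesis
      proof (rule that[of u])
        show "monomial [g] * gvert v \<doteq> (if v = u then monomial [g] else (0 :: ('f, 'v, 'e) wpoly))"
          if "v \<in> verts G" for v
          using eqv_relations(1)[OF \<open>u \<in> verts G\<close> that] Vert by (cases "v = u") simp_all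
      qed (rule \<open>u \<in> verts G\<close>)
    next
      case (Edge e)
      then have e: "e \<in> arcs G" "isp (tail G e) [e]" using g by auto
      show ?thesis
      proof (rule that[of "head G e"])
        show "monomial [g] * gvert v \<doteq> (if v = head G e then monomial [g] else (0 :: ('f, 'v, 'e) wpoly))"
          if "v \<in> verts G" for v
          using pm_gvert[OF e(2) that] Edge by (cases "v = head G e") (simp_all add: pm_def path_word_def)
      qed (use e in simp)
    next
      case (Ghost e)
      then have e: "e \<in> arcs G" "isp (tail G e) [e]" using g by auto
      show ?thesis
      proof (rule that[of "tail G e"])
        show "monomial [g] * gvert v \<doteq> (if v = tail G e then monomial [g] else (0 :: ('f, 'v, 'e) wpoly))"
          if "v \<in> verts G" for v
          using sm_gvert[OF e(2) that] Ghost
          by (cases "v = tail G e") (simp_all add: sm_def path_star_word_def path_word_def)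
      qed (use e in simp)
    qed
    have "(\<Sum>v\<in>verts G. monomial [g] * gvert v) \<doteq> (\<Sum>v\<in>verts G. if v = w then monomial [g] else (0 :: ('f, 'v, 'e) wpoly))"
      by (rule eqv_sum) (rule eq)
    then show ?thesis using w by (simp add: eqv_sym)
  qed
  have "monomial w \<in> K" if "w \<in> words" for w
  proof (cases w rule: rev_cases)
    case (snoc w' g)
    then have g: "g \<in> generators G" using that by (auto simp: words_def)
    show ?thesis
    proof (cases "w' = []")
      case True
      then show ?thesis using gen[OF g] snoc g by (simp add: K_def)
    next
      case False
      then have w': "(monomial w' :: ('f, 'v, 'e) wpoly) \<in> FA" using that snoc by simp
      have e: "monomial w = (monomial w' * monomial [g] :: ('f, 'v, 'e) wpoly)" by (simp add: snoc monomial_mult)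
      have "monomial w' * monomial [g] \<doteq> monomial w' * (\<Sum>v\<in>verts G. monomial [g] * gvert v)"
        by (rule eqv_mult_left[OF w' gen[OF g]])
      then have "monomial w \<doteq> (\<Sum>v\<in>verts G. (monomial w :: ('f, 'v, 'e) wpoly) * gvert v)"
        unfolding e by (simp only: sum_distrib_left mult.assoc)
      then show ?thesis using that by (simp add: K_def)
    qed
  qed (use that in \<open>simp add: words_def\<close>)
  then have "a \<in> K" using subsp_monomials[OF K, of a] assms unfolding FA_iff by blast
  then show ?thesis by (simp add: K_def)
qed

section \<open>The ideal of a frame component\<close>


lemma small_iff: "LG.small k x \<longleftrightarrow> (\<forall>\<^sub>F m in sequentially. x m \<in> N k)"
  by (simp add: LG.small_def nb_eq)

text \<open>Differences of late terms are deep enough to annihilate \<open>x\<close>, so a Cauchy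
  sequence acts on each single state through one of its terms.\<close>

lemma cauchy_stable:
  assumes a: "a \<in> LG.cauchys" and x: "x \<in> states"
  obtains M where "\<And>m \<phi>. m \<ge> M \<Longrightarrow> rep (a m) \<phi> x = rep (a M) \<phi> x"
proof -
  obtain M where M: "\<forall>m\<ge>M. \<forall>n\<ge>M. a m - a n \<in> N (2 * length (snd x) + 2)"
    using LG.cauchysD[OF a] unfolding nb_eq by blast
  have "rep (a m) \<phi> x = rep (a M) \<phi> x" if "m \<ge> M" for m \<phi>
  proof -
    have "a m - a M \<in> N (2 * length (snd x) + 2)" using M that by simp
    then have "rep (a m - a M) \<phi> x = 0" using rep_N[OF _ x] by blast
    then show ?thesis by (simp add: rep_diff)
  qed
  then show ?thesis using that by blast
qed

definition kills :: "(nat \<Rightarrow> ('f, 'v, 'e) wpoly) \<Rightarrow> 'v \<times> 'e list \<Rightarrow> bool" where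
  "kills a x \<longleftrightarrow> (\<forall>\<^sub>F m in sequentially. \<forall>\<phi>. rep (a m) \<phi> x = 0)"

lemma homs_iff: "a \<in> LG.homs d \<longleftrightarrow> a \<in> LG.cauchys \<and> (\<forall>m. degree_part d (a m) = a m)"
  by (auto simp: LG.homs_def LG.hpart_def fun_eq_iff)

text \<open>For fixed k the polynomials y with \<open>a m * y\<close> eventually in
  \<open>N k\<close> form a subspace to which \<open>proj_induct\<close> applies, fed with the
  idempotents of truncated states. It therefore contains all vertices, and their sum is a right
  unit.\<close>

lemma homogeneous_faithful:
  assumes a: "a \<in> LG.homs d" and kills: "\<And>x. x \<in> states \<Longrightarrow> kills a x"
  shows "a \<in> LG.nulls"
proof -
  have ac: "a \<in> LG.cauchys" and deg: "\<And>m. degree_part d (a m) = a m" using a by (auto simp: homs_iff)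
  have aF: "\<And>m. a m \<in> FA" using LG.cauchys_in_S[OF ac] .
  have "LG.small k a" for k
  proof -
    define K where "K = {y \<in> FA. \<forall>\<^sub>F m in sequentially. a m * y \<in> N k}"
    have K: "poly.subsp K"
      unfolding poly.subsp_def
    proof (intro conjI ballI allI)
      show "0 \<in> K" by (simp add: K_def FA.S_closed N_closed)
      show "scal c y \<in> K" if "y \<in> K" for c y
        using that by (auto simp: K_def FA.S_closed intro: N_closed(3) elim: eventually_mono)
      show "y + z \<in> K" if "y \<in> K" "z \<in> K" for y z
      proof -
        have "\<forall>\<^sub>F m in sequentially. a m * y \<in> N k \<and> a m * z \<in> N k"
          using that by (simp add: K_def eventually_conj)
        then have "\<forall>\<^sub>F m in sequentially. a m * (y + z) \<in> N k"
          by (rule eventually_mono) (simp add: distrib_left N_closed(2))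
        then show ?thesis using that by (simp add: K_def FA.S_closed)
      qed
    qed
    have IdK: "rel_ideal \<subseteq> K" using rel_ideal_mult(1)[OF aF] rel_ideal_N[of k] rel_ideal_sub by (auto simp: K_def subset_iff)
    obtain l where l: "\<forall>z. LG.small l z \<longrightarrow> LG.small k (a * z) \<and> LG.small k (z * a)"
      using LG.cauchy_small_mult[OF ac, of k] by blast
    have NK: "N l \<subseteq> K"
    proof
      fix y assume y: "y \<in> N l"
      have "LG.small l (\<lambda>_. y)" using y by (simp add: small_iff)
      then have "LG.small k (a * (\<lambda>_. y))" using l by blast
      then show "y \<in> K" using y N_sub by (auto simp: K_def small_iff)
    qed
    have lim: "\<exists>n. proj u (p @ zs (endv u p) n) \<in> K"
      if p: "isp u p" "endv u p \<in> verts G" "sdl p = 0" for u p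
    proof -
      have x: "(u, p) \<in> states" using p by (auto simp: states_def sdl_eq_0_iff)
      \<comment> \<open>With this maximum \<open>N_mult_proj\<close> applies at every truncation
        level. The level n can therefore be chosen for the single entry \<open>a m0\<close> and
        still works for all later entries.\<close>
      define k' where "k' = max k (2 * length p + 2)"
      obtain M where M: "\<forall>m\<ge>M. \<forall>n\<ge>M. a m - a n \<in> N k'" using LG.cauchysD[OF ac] unfolding nb_eq by blast
      obtain M' where M': "\<forall>m\<ge>M'. \<forall>\<phi>. rep (a m) \<phi> (u, p) = 0"
        using kills[OF x] by (auto simp: kills_def eventually_sequentially)
      define m0 where "m0 = max M M'"
      obtain n0 where n0: "\<And>n. n \<ge> n0 \<Longrightarrow> a m0 * tp n (u, p) \<doteq>
          (\<Sum>y\<in>support (a m0) (u, p). scal (rep (a m0) (delta y) (u, p)) (tp (nat (int n + d)) y))"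
        by (rule mult_tp[OF aF deg x, of m0]) blast
      define n where "n = n0 + length p"
      have T0: "rep (a m0) \<phi> (u, p) = 0" for \<phi> using M' by (simp add: m0_def)
      have "a m0 * tp n (u, p) \<doteq> 0" using n0[of n] by (simp add: n_def T0)
      then have "a m0 * tp n (u, p) * ts n (u, p) \<doteq> 0 * ts n (u, p)"
        by (rule eqv_mult_right[OF ts_FA[OF x]])
      then have z: "a m0 * (tp n (u, p) * ts n (u, p)) \<in> N k"
        using rel_ideal_N by (auto simp: eqv_zero_iff mult.assoc)
      have "a m * (tp n (u, p) * ts n (u, p)) \<in> N k" if "m \<ge> m0" for m
      proof -
        have "a m - a m0 \<in> N k'" using M that by (simp add: m0_def)
        then have "(a m - a m0) * (tp n (u, p) * ts n (u, p)) \<in> N k'"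
          by (rule N_mult_proj[OF _ x]) (simp add: k'_def)
        then have "(a m - a m0) * (tp n (u, p) * ts n (u, p)) \<in> N k"
          using N_antimono[of k k'] by (auto simp: k'_def)
        from N_closed(2)[OF this z] show ?thesis by (simp add: left_diff_distrib)
      qed
      then have "\<forall>\<^sub>F m in sequentially. a m * (tp n (u, p) * ts n (u, p)) \<in> N k"
        unfolding eventually_sequentially by blast
      moreover have "tp n (u, p) * ts n (u, p) = proj u (p @ zs (endv u p) n0)"
        by (simp add: tp_def ts_def proj_def n_def)
      moreover have "proj u (p @ zs (endv u p) n0) \<in> FA"
        by (rule proj_FA) (simp add: isp_append p isp_zs)
      ultimately show ?thesis unfolding K_def by auto
    qed
    have vert: "\<forall>\<^sub>F m in sequentially. a m * gvert v \<in> N k" if v: "v \<in> verts G" for v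
    proof -
      have "proj v [] \<in> K"
        by (rule proj_induct[OF K IdK NK _ lim, where U = "verts G"]) (use v in auto)
      then have "gvert v \<in> K" using proj_Nil[OF v] IdK poly.subsp_diff_iff[OF K, of "proj v []" "gvert v"]
        unfolding eqv_def by blast
      then show ?thesis by (simp add: K_def)
    qed
    have "\<forall>\<^sub>F m in sequentially. \<forall>v\<in>verts G. a m * gvert v \<in> N k"
      using vert by (intro eventually_ball_finite) auto
    then show ?thesis unfolding small_iff
    proof (rule eventually_mono)
      fix m assume "\<forall>v\<in>verts G. a m * gvert v \<in> N k"
      then have "(\<Sum>v\<in>verts G. a m * gvert v) \<in> N k" by (intro poly.subsp_sum[OF N_subsp]) auto
      then show "a m \<in> N k" using N_eqv[OF sum_vertices[OF aF]] by blast
    qed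
  qed
  then show ?thesis using ac by (simp add: LG.nulls_def)
qed

text \<open>Represents the idempotent \<open>b(u)\<close> of the overview.\<close>

definition tail_limit :: "'v \<Rightarrow> nat \<Rightarrow> ('f, 'v, 'e) wpoly" where
  "tail_limit u = (\<lambda>n. proj u (zs u n))"

lemma tail_limit_small:
  assumes "u \<in> verts G" "k \<le> t"
  shows "LG.small k ((\<lambda>_. proj u (zs u t)) - tail_limit u)"
proof -
  have "proj u (zs u t) - proj u (zs u m) \<in> N k" if "m \<ge> t" for m
    using proj_tail_cauchy[of u "[]" k t m] assms that by simp
  then show ?thesis unfolding small_iff eventually_sequentially tail_limit_def by auto
qed

lemma tail_limit_homs: assumes "u \<in> verts G" shows "tail_limit u \<in> LG.homs 0"
proof -
  have F: "tail_limit u n \<in> FA" for n using assms by (simp add: tail_limit_def proj_FA isp_zs)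
  have "tail_limit u \<in> LG.cauchys"
  proof (rule LG.cauchyI[OF F])
    show "\<exists>M. LG.small k (tail_limit u - (\<lambda>n. tail_limit u M))" for k
      using LG.small_minus_commute[OF tail_limit_small[OF assms order_refl, of k]]
      by (auto simp: tail_limit_def)
  qed
  moreover have "degree_part 0 (proj u p) = proj u p" for p
  proof (cases "p = []")
    case True
    then show ?thesis by (simp add: proj_def monomial_mult word_degree_def)
  next
    case False
    have "word_degree (map Edge p :: ('v, 'e) generator list) = int (length p)"
      "word_degree (map Ghost q :: ('v, 'e) generator list) = - int (length q)" for q
      by (induction p, simp_all add: word_degree_def) (induction q, simp_all)
    moreover have "generator_star \<circ> Edge = (Ghost :: 'e \<Rightarrow> ('v, 'e) generator)" by (simp add: fun_eq_iff)
    ultimately show ?thesis using False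
      by (simp add: proj_def pm_def sm_def path_word_def path_star_word_def monomial_mult rev_map)
  qed
  ultimately show ?thesis by (simp add: homs_iff tail_limit_def)
qed

end

text \<open>\<open>W_meet\<close> expresses connectedness of the special edges in W: in the graph of
  a function, two vertices lie in one undirected component exactly if their forward orbits meet.
  \<open>W_head\<close> is heredity, one edge at a time.\<close>

locale frame_component = leavitt_graph G \<gamma> F
  for G :: "('v, 'e) pre_digraph" and \<gamma> and F :: "'f::field itself" +
  fixes W :: "'v set"
  assumes W_verts: "W \<subseteq> verts G" and W_nonempty: "W \<noteq> {}"
    and W_head: "e \<in> arcs G \<Longrightarrow> tail G e \<in> W \<Longrightarrow> head G e \<in> W"
    and W_meet: "u \<in> W \<Longrightarrow> v \<in> W \<Longrightarrow> \<exists>i j. (nx ^^ i) u = (nx ^^ j) v"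
begin

lemma W_nx: "u \<in> W \<Longrightarrow> nx u \<in> W"
  using W_head[of "\<gamma> u"] \<gamma>_out[of u] W_verts by (auto simp: nx_def)

lemma W_nx_pow: "u \<in> W \<Longrightarrow> (nx ^^ n) u \<in> W"
  by (induction n) (auto simp del: nx_def simp: W_nx)

lemma W_endv: "isp u p \<Longrightarrow> u \<in> W \<Longrightarrow> endv u p \<in> W"
  by (induction p arbitrary: u) (auto intro: W_head)

definition gens :: "(nat \<Rightarrow> ('f, 'v, 'e) wpoly) set" where "gens = (\<lambda>w n. gvert w) ` W"

abbreviation I :: "(nat \<Rightarrow> ('f, 'v, 'e) wpoly) set" where "I \<equiv> LG.gen_ideal gens"

lemma gens_homs: "gens \<subseteq> LG.homs 0"
  using W_verts by (auto simp: gens_def homs_iff LG.cauchy_const word_degree_def)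

lemma gens_hats: "gens \<subseteq> LG.hats" using gens_homs LG.homs_hats by blast

lemmas I_ideal = LG.closed_idealD[OF LG.closed_ideal_gen_ideal[OF gens_hats]]

text \<open>With a vertex of W as one-sided unit, c is congruent to a product that has a generator
  of the ideal as a factor.\<close>

lemma const_I:
  assumes v: "v \<in> W" and c: "c \<in> FA" and eq: "gvert v * c \<doteq> c \<or> c * gvert v \<doteq> c"
  shows "(\<lambda>_. c) \<in> I"
proof -
  have g: "(\<lambda>_. gvert v) \<in> I" using LG.gen_ideal_gens[of gens] v by (auto simp: gens_def)
  have ch: "(\<lambda>_. c) \<in> LG.hats" by (rule LG.const_hats[OF c])
  have null: "(\<lambda>_. z) \<in> LG.nulls" if "z \<in> rel_ideal" for z
    using that rel_ideal_sub rel_ideal_N by (auto simp: LG.nulls_def LG.cauchy_const small_iff subset_iff)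
  have prod: "(\<lambda>_. gvert v * c) \<in> I" "(\<lambda>_. c * gvert v) \<in> I"
    using I_ideal(5)[OF ch g] I_ideal(4)[OF ch g] by (simp_all add: times_fun_def)
  have "(\<lambda>_. c) \<in> I" if p: "(\<lambda>_. c') \<in> I" and e: "c' \<doteq> c" for c'
  proof -
    have "(\<lambda>_. c' - c) \<in> I" using null e I_ideal(3) by (auto simp: eqv_def)
    then have "(\<lambda>_. c') - (\<lambda>_. c' - c) \<in> I" using LG.seq.subspD(5)[OF I_ideal(1) p] by blast
    then show ?thesis by (simp add: fun_diff_def)
  qed
  then show ?thesis using prod eq by blast
qed

section \<open>Paths whose tail enters W\<close>

definition meets :: "'v \<times> 'e list \<Rightarrow> bool" where
  "meets x \<longleftrightarrow> (\<exists>j. (nx ^^ j) (endv (fst x) (snd x)) \<in> W)"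

text \<open>Generators alter only the beginning of a path, never its tail. Used contrapositively:
  the states whose tail never enters W are invariant under the action.\<close>

lemma step_meets:
  assumes "g \<in> generators G" "x \<in> states" "step g x = Some y" "meets y"
  shows "meets x"
proof -
  obtain u p where x: "x = (u, p)" by (cases x)
  obtain j where j: "(nx ^^ j) (endv (fst y) (snd y)) \<in> W" using assms(4) by (auto simp: meets_def)
  have nxj: "(nx ^^ Suc j) v = (nx ^^ j) (nx v)" for v by (simp only: funpow_Suc_right o_apply)
  have nx_tail: "nx (tail G e) = head G e" if "e \<in> special" for e
  proof -
    have "e \<in> arcs G" "\<gamma> (tail G e) = e" using that special_iff by auto
    then show ?thesis by (auto simp: nx_def sink_def out_arcs_def)
  qed
  show ?thesis
  proof (cases g)
    case (Vert v)
    then show ?thesis using assms x by (auto split: if_splits)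
  next
    case (Edge e)
    show ?thesis
    proof (cases "p = [] \<and> e \<in> special")
      case True
      then have y: "y = (tail G e, [])" "u = head G e" using assms(3) Edge x by (auto split: if_splits)
      \<comment> \<open>The special path of x starts one vertex later than that of y; closure of W
        under \<open>nx\<close> absorbs the shift.\<close>
      have "(nx ^^ j) (nx (tail G e)) \<in> W" using W_nx[OF j] y nxj[of "tail G e"] by simp
      then show ?thesis using nx_tail True x y by (auto simp: meets_def)
    next
      case False
      then have "y = (tail G e, e # p)" "u = head G e" using assms(3) Edge x by (auto split: if_splits)
      then show ?thesis using assms(4) x by (simp add: meets_def)
    qed
  next
    case (Ghost e)
    show ?thesis
    proof (cases p)
      case Nil
      then have y: "y = (head G e, [])" "u = tail G e" "e \<in> special" using assms(3) Ghost x by (auto split: if_splits)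
      have "(nx ^^ Suc j) u \<in> W" using j y nx_tail nxj by simp
      then show ?thesis unfolding meets_def
        by (intro exI[of _ "Suc j"]) (simp only: x Nil fst_conv snd_conv endv.simps)
    next
      case (Cons f q)
      then have "y = (head G f, q)" using assms(3) Ghost x by (auto split: if_splits)
      then show ?thesis using assms(4) x Cons by (simp add: meets_def)
    qed
  qed
qed

lemma act_meets:
  "set w \<subseteq> generators G \<Longrightarrow> x \<in> states \<Longrightarrow> act w x = Some y \<Longrightarrow> meets y \<Longrightarrow> meets x"
proof (induction w arbitrary: y)
  case (Cons g w)
  then obtain z where z: "act w x = Some z" "step g z = Some y" by (auto split: option.splits)
  have "z \<in> states" using act_states[OF _ _ z(1)] Cons.prems by auto
  then show ?case using step_meets[OF _ _ z(2)] Cons.IH[OF _ _ z(1)] Cons.prems by auto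
qed simp

text \<open>The elements that annihilate all states whose tail never enters W form a closed ideal.
  The generators belong to it because a path that starts in W never leaves it.\<close>

lemma I_kills:
  assumes "a \<in> I" "x \<in> states" "\<not> meets x" shows "kills a x"
proof -
  define B where "B = {a \<in> LG.hats. \<forall>x\<in>states. \<not> meets x \<longrightarrow> kills a x}"
  have "LG.closed_ideal B"
    unfolding LG.closed_ideal_def LG.seq.ideal_in_def LG.seq.subsp_def
  proof (intro conjI ballI allI impI subsetI)
    show "0 \<in> B" by (simp add: B_def kills_def LG.hats_closed)
    show "a + b \<in> B" if ab: "a \<in> B" "b \<in> B" for a b
    proof -
      have "kills (a + b) x" if "x \<in> states" "\<not> meets x" for x
      proof -
        have "kills a x" "kills b x" using ab that by (auto simp: B_def)
        then show ?thesis unfolding kills_def by eventually_elim (simp add: rep_add)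
      qed
      then show ?thesis using ab LG.hats_closed(2) by (simp add: B_def)
    qed
    show "LG.ssc c a \<in> B" if a: "a \<in> B" for c a
    proof -
      have "kills (LG.ssc c a) x" if "x \<in> states" "\<not> meets x" for x
      proof -
        have "kills a x" using a that by (auto simp: B_def)
        then show ?thesis unfolding kills_def by eventually_elim (simp add: rep_scal)
      qed
      moreover have "LG.ssc c a \<in> LG.hats" using a by (intro LG.hats_closed(3)) (simp add: B_def)
      ultimately show ?thesis unfolding B_def by blast
    qed
    show "a \<in> LG.hats" if "a \<in> B" for a using that by (simp add: B_def)
    show "a \<in> B" if a: "a \<in> LG.nulls" for a
    proof -
      have "kills a x" if x: "x \<in> states" for x
      proof -
        have "\<forall>\<^sub>F m in sequentially. a m \<in> N (2 * length (snd x) + 2)"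
          using LG.nulls_small[OF a] by (simp add: small_iff)
        then show ?thesis unfolding kills_def by (rule eventually_mono) (use rep_N[OF _ x] in blast)
      qed
      then show ?thesis using LG.nulls_hats[OF a] by (simp add: B_def)
    qed
    show "b * a \<in> B" "a * b \<in> B" if b: "b \<in> LG.hats" and a: "a \<in> B" for a b
    proof -
      have bF: "b m \<in> FA" for m using LG.cauchys_in_S[OF LG.hats_cauchys[OF b]] .
      have "kills (b * a) x \<and> kills (a * b) x" if x: "x \<in> states" "\<not> meets x" for x
      proof
        have "kills a x" using a x by (simp add: B_def)
        then show "kills (b * a) x" unfolding kills_def by (rule eventually_mono) (simp add: rep_mult)
        \<comment> \<open>\<open>b m\<close> changes with m, but its action on x is eventually that
          of \<open>b M\<close>; only the finitely many states in the support of \<open>b M\<close>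
          at x have to be annihilated by a.\<close>
        obtain M where M: "\<And>m \<phi>. m \<ge> M \<Longrightarrow> rep (b m) \<phi> x = rep (b M) \<phi> x"
          using cauchy_stable[OF LG.hats_cauchys[OF b] x(1)] by blast
        have "kills a y" if y: "y \<in> support (b M) x" for y
        proof -
          obtain w where w: "w \<in> Poly_Mapping.keys (b M)" "act w x = Some y" using y by (auto simp: support_def)
          have "set w \<subseteq> generators G" using bF[of M] w(1) by (auto simp: FA_def)
          then have "\<not> meets y" using act_meets[OF _ x(1) w(2)] x(2) by blast
          then show ?thesis using a support_states[OF bF x(1) y] by (simp add: B_def)
        qed
        then have "\<forall>\<^sub>F m in sequentially. \<forall>y\<in>support (b M) x. \<forall>\<phi>. rep (a m) \<phi> y = 0"
          unfolding kills_def by (intro eventually_ball_finite finite_support) blast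
        moreover have "\<forall>\<^sub>F m in sequentially. m \<ge> M" by (rule eventually_ge_at_top)
        ultimately show "kills (a * b) x" unfolding kills_def
        proof eventually_elim
          case (elim m)
          have "rep (a m * b m) \<phi> x = 0" for \<phi>
          proof -
            have "rep (a m * b m) \<phi> x = rep (b M) (rep (a m) \<phi>) x" using M[OF elim(2)] by (simp add: rep_mult)
            also have "\<dots> = 0" by (subst rep_expand) (use elim(1) in simp)
            finally show ?thesis .
          qed
          then show ?case by simp
        qed
      qed
      moreover have "a \<in> LG.hats" using a by (simp add: B_def)
      ultimately show "b * a \<in> B" "a * b \<in> B" using b LG.hats_mult by (auto simp: B_def)
    qed
    fix a assume a: "a \<in> LG.hats" "\<forall>k. \<exists>b\<in>B. LG.small k (a - b)"
    have "kills a x" if x: "x \<in> states" "\<not> meets x" for x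
    proof -
      obtain b where b: "b \<in> B" "LG.small (2 * length (snd x) + 2) (a - b)" using a(2) by blast
      have "kills b x" using b x by (simp add: B_def)
      moreover have "\<forall>\<^sub>F m in sequentially. a m - b m \<in> N (2 * length (snd x) + 2)"
        using b(2) by (simp add: small_iff)
      ultimately show ?thesis unfolding kills_def
      proof eventually_elim
        case (elim m)
        show ?case
        proof
          fix \<phi>
          have "rep (a m - b m) \<phi> x = 0" using rep_N[OF elim(2) x(1)] by simp
          then show "rep (a m) \<phi> x = 0" using elim(1) by (simp add: rep_diff)
        qed
      qed
    qed
    then show "a \<in> B" using a(1) by (simp add: B_def)
  qed
  moreover have "gens \<subseteq> B"
  proof
    fix g assume g: "g \<in> gens"
    then obtain w where w: "w \<in> W" "g = (\<lambda>_. gvert w)" by (auto simp: gens_def)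
    have "kills g x" if x: "x \<in> states" "\<not> meets x" for x
    proof -
      obtain u p where xp: "x = (u, p)" by (cases x)
      have "u \<noteq> w"
      proof
        assume "u = w"
        then have "endv u p \<in> W" using W_endv[of u p] x(1) w(1) by (auto simp: states_def xp)
        then have "meets x" unfolding meets_def xp by (intro exI[of _ 0]) simp
        then show False using x(2) by simp
      qed
      then show ?thesis by (simp add: kills_def w rep_monomial xp)
    qed
    then show "g \<in> B" using g gens_hats by (auto simp: B_def)
  qed
  ultimately have "I \<subseteq> B" by (rule LG.gen_ideal_min)
  then show ?thesis using assms by (auto simp: B_def)
qed

lemma trv_eventually:
  assumes "meets x"
  obtains n0 where "n0 \<ge> length (snd x)" "\<And>n. n \<ge> n0 \<Longrightarrow> trv n x \<in> W"
proof -
  obtain u p where x: "x = (u, p)" by (cases x)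
  obtain j where j: "(nx ^^ j) (endv u p) \<in> W" using assms by (auto simp: meets_def x)
  have "trv n x \<in> W" if "n \<ge> length p + j" for n
  proof -
    have "trv n x = (nx ^^ (n - length p)) (endv u p)" by (simp add: trv_def x endv_zs)
    also have "n - length p = (n - length p - j) + j" using that by simp
    finally have "trv n x = (nx ^^ (n - length p - j)) ((nx ^^ j) (endv u p))"
      by (simp only: funpow_add o_apply)
    then show ?thesis using W_nx_pow[OF j] by simp
  qed
  then show ?thesis using that[of "length p + j"] x by simp
qed

lemma ts_tp_add:
  assumes "x \<in> states" "length (snd x) \<le> n"
  shows "ts n x * tp (n + t) x \<doteq> pm (trv n x) (zs (trv n x) t)"
proof -
  have "isp (fst x) (tr n x @ zs (trv n x) t)" using isp_tr[OF assms(1), of "n + t"] tr_add[OF assms(2), of t] by simp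
  from sm_pm_prefix[OF this] show ?thesis
    unfolding ts_def tp_def tr_add[OF assms(2)] by (simp add: trv_def)
qed

text \<open>Compressing a nonzero homogeneous element by \<open>tp n x * ts n x\<close> on both sides and letting \<open>n\<close>
  tend to infinity produces a scalar multiple of the idempotent attached to a vertex of \<open>W\<close>.\<close>

lemma tail_limit_in_ideal:
  assumes J: "LG.seq.subsp J" "LG.nulls \<subseteq> J" "J \<subseteq> I"
    and mult: "\<And>a x. a \<in> I \<Longrightarrow> x \<in> J \<Longrightarrow> a * x \<in> J \<and> x * a \<in> J"
    and closed: "\<And>x. x \<in> LG.hats \<Longrightarrow> (\<And>k. \<exists>y\<in>J. LG.small k (x - y)) \<Longrightarrow> x \<in> J"
    and a: "a \<in> J" "a \<in> LG.homs d" "a \<notin> LG.nulls"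
  shows "\<exists>v\<in>W. tail_limit v \<in> J"
proof -
  have ac: "a \<in> LG.cauchys" and deg: "\<And>m. degree_part d (a m) = a m" using a(2) by (auto simp: homs_iff)
  have aF: "\<And>m. a m \<in> FA" using LG.cauchys_in_S[OF ac] .
  obtain x where x: "x \<in> states" "\<not> kills a x" using homogeneous_faithful[OF a(2)] a(3) by blast
  \<comment> \<open>This is what places the ends of late truncations of x in W.\<close>
  have mx: "meets x" using I_kills x a(1) J(3) by blast
  obtain M where M: "\<And>m \<phi>. m \<ge> M \<Longrightarrow> rep (a m) \<phi> x = rep (a M) \<phi> x" by (rule cauchy_stable[OF ac x(1)]) blast
  have "\<exists>\<phi>. rep (a M) \<phi> x \<noteq> 0"
  proof (rule ccontr)
    assume "\<not> (\<exists>\<phi>. rep (a M) \<phi> x \<noteq> 0)"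
    then have "rep (a m) \<phi> x = 0" if "m \<ge> M" for m \<phi> using M[OF that, of \<phi>] by metis
    then show False using x(2) unfolding kills_def eventually_sequentially by blast
  qed
  then obtain \<phi> where "rep (a M) \<phi> x \<noteq> 0" by blast
  then obtain y where y: "y \<in> support (a M) x" and c0: "rep (a M) (delta y) x \<noteq> 0"
    using rep_expand[of "a M" \<phi> x] by (metis (no_types, lifting) mult_zero_right sum.neutral)
  define c where "c = rep (a M) (delta y) x"
  have ys: "y \<in> states" by (rule support_states[OF aF x(1) y])
  obtain nM where nM: "\<And>n y. n \<ge> nM \<Longrightarrow> y \<in> support (a M) x \<Longrightarrow> trv (nat (int n + d)) y = trv n x"
    by (rule mult_tp[OF aF deg x(1), of M]) blast
  obtain nW where nW: "nW \<ge> length (snd x)" "\<And>n. n \<ge> nW \<Longrightarrow> trv n x \<in> W" using trv_eventually[OF mx] by blast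
  \<comment> \<open>The summand \<open>nat (- d)\<close> keeps the shifted level \<open>m1\<close>
    from being truncated at 0; the others make the cuts of x and y end at the same vertex of W and
    come after the listed edges of both states.\<close>
  define n1 where "n1 = nM + nW + nat (- d) + length (snd y)"
  define m1 where "m1 = nat (int n1 + d)"
  define v where "v = trv n1 x"
  have vW: "v \<in> W" using nW(2)[of n1] by (simp add: v_def n1_def)
  have vv: "trv m1 y = v" using nM[OF _ y, of n1] by (simp add: v_def m1_def n1_def)
  have lx: "length (snd x) \<le> n1" and ly: "length (snd y) \<le> m1" and mn: "nat (int (n1 + t) + d) = m1 + t" for t
    using nW(1) by (auto simp: n1_def m1_def)
  note Fx = tp_FA[OF x(1)] ts_FA[OF x(1)] and Fy = tp_FA[OF ys] ts_FA[OF ys]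
  \<comment> \<open>The inner idempotents compress \<open>a\<close>. The outer factors
    \<open>ts m1 y\<close> and \<open>tp n1 x\<close> remove the beginnings of the two paths, so
    that only the special path from v remains. They also make v a left unit of \<open>P t\<close>
    and a right unit of \<open>Q t\<close>, which puts both into I.\<close>
  define P where "P t = ts m1 y * (tp (m1 + t) y * ts (m1 + t) y)" for t
  define Q where "Q t = (tp (n1 + t) x * ts (n1 + t) x) * tp n1 x" for t
  have PF: "P t \<in> FA" and QF: "Q t \<in> FA" for t using Fx Fy by (simp_all add: P_def Q_def FA.S_mult)
  have PI: "(\<lambda>_. P t) \<in> I" for t
  proof (rule const_I[OF vW PF])
    have "gvert v * ts m1 y * (tp (m1 + t) y * ts (m1 + t) y) \<doteq> P t"
      unfolding P_def using gvert_ts[OF ys, of m1] Fy by (intro eqv_mult_right) (auto simp: vv FA.S_mult)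
    then show "gvert v * P t \<doteq> P t \<or> P t * gvert v \<doteq> P t" by (simp add: P_def mult.assoc)
  qed
  have QI: "(\<lambda>_. Q t) \<in> I" for t
  proof (rule const_I[OF vW QF])
    have "(tp (n1 + t) x * ts (n1 + t) x) * (tp n1 x * gvert v) \<doteq> Q t"
      unfolding Q_def v_def using tp_gvert[OF x(1), of n1] Fx by (intro eqv_mult_left) (auto simp: FA.S_mult)
    then show "gvert v * Q t \<doteq> Q t \<or> Q t * gvert v \<doteq> Q t" by (simp add: Q_def mult.assoc)
  qed
  have v_verts: "v \<in> verts G" using vW W_verts by blast
  have approx: "\<exists>z\<in>J. LG.small k (LG.ssc c (tail_limit v) - z)" for k
  proof -
    \<comment> \<open>\<open>k1\<close> and \<open>k2\<close> depend only on the fixed outer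
      factors, so the level t can be chosen afterwards.\<close>
    obtain k1 where k1: "\<forall>z\<in>N k1. ts m1 y * z \<in> N k" using N_mult_left[OF Fy(2)] by blast
    obtain k2 where k2: "\<forall>z\<in>N k2. z * tp n1 x \<in> N k1" using N_mult_elem[OF Fx(1)] by blast
    define k3 where "k3 = max k2 (2 * length (snd x) + 2 * length (snd y) + 2)"
    obtain M3 where M3: "\<forall>m\<ge>M3. \<forall>n\<ge>M3. a m - a n \<in> N k3" using LG.cauchysD[OF ac] unfolding nb_eq by blast
    define i0 where "i0 = max M M3"
    have ci: "rep (a i0) (delta y) x = c" using M[of i0] by (simp add: i0_def c_def)
    obtain n2 where n2: "\<And>n. n \<ge> n2 \<Longrightarrow>
        (tp (nat (int n + d)) y * ts (nat (int n + d)) y) * a i0 * (tp n x * ts n x)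
        \<doteq> scal c (tp (nat (int n + d)) y * ts n x)"
      using compress[OF aF deg x(1) ys, of i0] unfolding ci by blast
    define t where "t = n2 + k"
    let ?A = "tp (m1 + t) y * ts (m1 + t) y" and ?B = "tp (n1 + t) x * ts (n1 + t) x"
    let ?z = "(\<lambda>_. P t) * a * (\<lambda>_. Q t)"
    have zJ: "?z \<in> J" using mult PI QI a(1) by blast
    have z: "?z m = ts m1 y * (?A * a m * ?B) * tp n1 x" for m
      by (simp add: P_def Q_def mult.assoc)
    have main: "ts m1 y * (?A * a i0 * ?B) * tp n1 x \<doteq> scal c (proj v (zs v t))"
    proof -
      have "?A * a i0 * ?B \<doteq> scal c (tp (m1 + t) y * ts (n1 + t) x)"
        using n2[of "n1 + t"] unfolding mn by (simp add: t_def)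
      then have "ts m1 y * (?A * a i0 * ?B) * tp n1 x \<doteq> ts m1 y * scal c (tp (m1 + t) y * ts (n1 + t) x) * tp n1 x"
        by (intro eqv_mult_right eqv_mult_left Fx Fy)
      also have "\<dots> = scal c ((ts m1 y * tp (m1 + t) y) * (ts (n1 + t) x * tp n1 x))"
        by (simp only: poly.sc_mult_left poly.sc_mult_right mult.assoc)
      also have "\<dots> \<doteq> scal c (pm v (zs v t) * (ts (n1 + t) x * tp n1 x))"
        using ts_tp_add[OF ys ly, of t] Fx by (intro eqv_scal eqv_mult_right) (auto simp: vv FA.S_mult)
      also have "\<dots> \<doteq> scal c (pm v (zs v t) * sm v (zs v t))"
      proof (intro eqv_scal eqv_mult_left pm_FA isp_zs v_verts)
        have "star (ts n1 x * tp (n1 + t) x) \<doteq> star (pm v (zs v t))"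
          unfolding v_def by (rule eqv_star[OF ts_tp_add[OF x(1) lx]])
        then show "ts (n1 + t) x * tp n1 x \<doteq> sm v (zs v t)" by (simp add: star_mult)
      qed
      finally show ?thesis by (simp add: proj_def)
    qed
    have close: "?z m - scal c (proj v (zs v t)) \<in> N k" if m: "m \<ge> i0" for m
    proof -
      have "a m - a i0 \<in> N k3" using M3 m by (simp add: i0_def)
      then have "?A * (a m - a i0) \<in> N k3" by (rule N_proj_mult[OF _ ys]) (simp add: k3_def)
      then have "?A * (a m - a i0) * ?B \<in> N k3" by (rule N_mult_proj[OF _ x(1)]) (simp add: k3_def)
      then have "?A * (a m - a i0) * ?B \<in> N k2" using N_antimono[of k2 k3] by (auto simp: k3_def)
      then have "ts m1 y * (?A * (a m - a i0) * ?B * tp n1 x) \<in> N k" using k1 k2 by blast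
      then have "?z m - ts m1 y * (?A * a i0 * ?B) * tp n1 x \<in> N k"
        unfolding z by (simp add: left_diff_distrib right_diff_distrib mult.assoc)
      moreover have "ts m1 y * (?A * a i0 * ?B) * tp n1 x - scal c (proj v (zs v t)) \<in> N k"
        using main rel_ideal_N unfolding eqv_def by blast
      ultimately show ?thesis using N_closed(2) by fastforce
    qed
    have "LG.small k (?z - (\<lambda>_. scal c (proj v (zs v t))))"
      unfolding small_iff eventually_sequentially using close by auto
    moreover have "LG.small k ((\<lambda>_. scal c (proj v (zs v t))) - LG.ssc c (tail_limit v))"
    proof -
      have "LG.small k (LG.ssc c ((\<lambda>_. proj v (zs v t)) - tail_limit v))"
        by (intro LG.small_ssc tail_limit_small v_verts) (simp add: t_def)
      then show ?thesis by (simp add: poly.sc_diff_right fun_diff_def)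
    qed
    ultimately have "LG.small k (?z - LG.ssc c (tail_limit v))" by (rule LG.small_trans)
    then show ?thesis using zJ LG.small_minus_commute by blast
  qed
  have "tail_limit v \<in> LG.hats" using tail_limit_homs[OF v_verts] by (rule LG.homs_hats)
  then have "LG.ssc c (tail_limit v) \<in> LG.hats" by (rule LG.hats_closed(3))
  then have "LG.ssc c (tail_limit v) \<in> J" using closed approx by blast
  then have "LG.ssc (inverse c) (LG.ssc c (tail_limit v)) \<in> J" by (rule LG.seq.subspD(3)[OF J(1)])
  moreover have "LG.ssc (inverse c) (LG.ssc c (tail_limit v)) = tail_limit v"
    using c0 by (simp add: c_def flip: poly.sc_assoc)
  ultimately show ?thesis using vW by auto
qed

text \<open>The special paths from u and v merge at r. Conjugation by \<open>E\<close>, which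
  exchanges the beginning of the path from v for that of the path from u, carries one idempotent to
  the other modulo null sequences. As u is a left unit of \<open>E\<close>, this element lies in
  I.\<close>

lemma tail_limit_shift:
  assumes J: "LG.seq.subsp J" "LG.nulls \<subseteq> J"
    and mult: "\<And>a x. a \<in> I \<Longrightarrow> x \<in> J \<Longrightarrow> a * x \<in> J \<and> x * a \<in> J"
    and v: "v \<in> W" "tail_limit v \<in> J" and u: "u \<in> W"
  shows "tail_limit u \<in> J"
proof -
  obtain i j where ij: "(nx ^^ i) v = (nx ^^ j) u" using W_meet[OF v(1) u] by blast
  define r where "r = (nx ^^ j) u"
  have r: "endv u (zs u j) = r" "endv v (zs v i) = r" using ij by (simp_all add: r_def endv_zs)
  have uv: "u \<in> verts G" "v \<in> verts G" using u v W_verts by auto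
  have rW: "r \<in> W" unfolding r_def by (rule W_nx_pow[OF u])
  have rv: "r \<in> verts G" using rW W_verts by blast
  define E where "E = pm u (zs u j) * sm v (zs v i)"
  have EF: "E \<in> FA" using uv by (simp add: E_def FA.S_mult pm_FA sm_FA isp_zs)
  have vE: "gvert u * E \<doteq> E"
  proof -
    have "gvert u * pm u (zs u j) * sm v (zs v i) \<doteq> E"
      unfolding E_def using gvert_pm[OF uv(1) isp_zs[OF uv(1)], of j] by (intro eqv_mult_right sm_FA isp_zs uv) simp
    then show ?thesis by (simp add: E_def mult.assoc)
  qed
  have EI: "(\<lambda>_. E) \<in> I" by (rule const_I[OF u EF]) (use vE in blast)
  have EI': "(\<lambda>_. star E) \<in> I"
    by (rule const_I[OF u star_FA[OF EF]]) (use eqv_star[OF vE] in \<open>simp add: star_mult star_word_def\<close>)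
  let ?z = "(\<lambda>_. E) * tail_limit v * (\<lambda>_. star E)"
  have zJ: "?z \<in> J" using mult EI EI' v(2) by blast
  have ev: "E * proj v (zs v (i + t)) * star E \<doteq> proj u (zs u (j + t))" for t
  proof -
    have zv: "zs v (i + t) = zs v i @ zs r t" and zu: "zs u (j + t) = zs u j @ zs r t"
      by (simp_all add: zs_add r)
    have pv: "isp v (zs v i @ zs r t)" and pu: "isp u (zs u j @ zs r t)" using uv rv by (simp_all add: isp_append isp_zs r)
    have half: "E * pm v (zs v (i + t)) \<doteq> pm u (zs u (j + t))"
    proof -
      have "E * pm v (zs v (i + t)) = pm u (zs u j) * (sm v (zs v i) * pm v (zs v i @ zs r t))"
        by (simp add: E_def mult.assoc zv)
      also have "\<dots> \<doteq> pm u (zs u j) * pm r (zs r t)"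
        using sm_pm_prefix[OF pv] by (intro eqv_mult_left pm_FA isp_zs uv) (simp add: r)
      also have "\<dots> \<doteq> pm u (zs u (j + t))"
        using pm_pm[OF isp_zs[OF uv(1)] isp_zs[OF rv], of j t] by (simp add: r zu)
      finally show ?thesis .
    qed
    have half': "sm v (zs v (i + t)) * star E \<doteq> sm u (zs u (j + t))"
      using eqv_star[OF half] by (simp add: star_mult)
    have "E * proj v (zs v (i + t)) * star E = (E * pm v (zs v (i + t))) * (sm v (zs v (i + t)) * star E)"
      by (simp add: proj_def mult.assoc)
    also have "\<dots> \<doteq> pm u (zs u (j + t)) * (sm v (zs v (i + t)) * star E)"
      using uv by (intro eqv_mult_right half FA.S_mult sm_FA isp_zs star_FA EF)
    also have "\<dots> \<doteq> proj u (zs u (j + t))"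
      unfolding proj_def using uv by (intro eqv_mult_left half' pm_FA isp_zs)
    finally show ?thesis .
  qed
  have "?z - tail_limit u \<in> LG.nulls"
  proof -
    have "LG.small k (?z - tail_limit u)" for k
      unfolding small_iff eventually_sequentially
    proof (intro exI allI impI)
      \<comment> \<open>Conjugation turns the cut at i + t into the cut at j + t, which may differ
        from m = i + t; both levels are at least k, so the difference lies in
        \<open>N k\<close>.\<close>
      fix m assume m: "m \<ge> i + k"
      define t where "t = m - i"
      have mt: "m = i + t" "k \<le> t" using m by (auto simp: t_def)
      have "?z m - proj u (zs u (j + t)) \<in> N k"
        using ev[of t] rel_ideal_N unfolding eqv_def by (auto simp: tail_limit_def mt)
      moreover have "proj u (zs u (j + t)) - proj u (zs u m) \<in> N k"
      proof (cases "j + t \<le> m")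
        case True
        then show ?thesis using proj_tail_cauchy[of u "[]" k "j + t" m] uv mt by simp
      next
        case False
        then have "proj u (zs u m) - proj u (zs u (j + t)) \<in> N k"
          using proj_tail_cauchy[of u "[]" k m "j + t"] uv mt by simp
        then show ?thesis using N_closed(4) by fastforce
      qed
      ultimately have "(?z m - proj u (zs u (j + t))) + (proj u (zs u (j + t)) - proj u (zs u m)) \<in> N k"
        by (rule N_closed(2))
      then show "(?z - tail_limit u) m \<in> N k" by (simp add: tail_limit_def)
    qed
    moreover have "?z \<in> LG.cauchys"
      using LG.homs_cauchys[OF tail_limit_homs[OF uv(2)]] EF star_FA[OF EF]
      by (intro LG.cauchy_mult LG.cauchy_const)
    ultimately show ?thesis
      using LG.homs_cauchys[OF tail_limit_homs[OF uv(1)]] LG.cauchys_closed(5) by (simp add: LG.nulls_def)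
  qed
  then have "?z - (?z - tail_limit u) \<in> J" using J(2) LG.seq.subspD(5)[OF J(1) zJ] by blast
  then show ?thesis by simp
qed

theorem component_simple:
  "topologically_graded_simple (LG.hat_algebra\<lparr>carrier := LG.\<Phi> ` I\<rparr>)
     (subtopology LG.hat_topology (LG.\<Phi> ` I)) (\<lambda>i. LG.\<Phi> ` I \<inter> LG.comp i)"
proof (rule LG.topologically_graded_simple_gen_ideal[OF gens_homs])
  fix w assume "w \<in> gens"
  then obtain v where v: "v \<in> W" "w = (\<lambda>_. gvert v)" by (auto simp: gens_def)
  have vv: "v \<in> verts G" using v W_verts by blast
  have "gvert v * gvert v - gvert v \<in> rel_ideal" using eqv_relations(1)[OF vv vv] by (simp add: eqv_def)
  moreover have "w * w - w = (\<lambda>_. gvert v * gvert v - gvert v)" by (simp add: v fun_eq_iff)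
  ultimately show "w * w - w \<in> LG.nulls"
    using rel_ideal_sub rel_ideal_N by (auto simp: LG.nulls_def LG.cauchy_const small_iff subset_iff)
next
  obtain w where w: "w \<in> W" using W_nonempty by blast
  \<comment> \<open>The vertex fixes the state \<open>(w, [])\<close>, whereas elements of
    \<open>N 2\<close> annihilate it; 2 is the bound in \<open>rep_N\<close> for an empty
    list.\<close>
  have "(\<lambda>_. gvert w) \<notin> LG.nulls"
  proof
    assume "(\<lambda>_. gvert w) \<in> LG.nulls"
    then have "gvert w \<in> N 2" using LG.nulls_small[of "\<lambda>_. gvert w" 2] by (simp add: small_iff)
    moreover have "(w, []) \<in> states" using w W_verts by (auto simp: states_def)
    ultimately have "rep (gvert w) (\<lambda>_. 1) (w, []) = 0" using rep_N[of "gvert w" 2 "(w, [])" "\<lambda>_. 1"] by simp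
    then show False by (simp add: rep_monomial)
  qed
  then show "\<exists>w\<in>gens. w \<notin> LG.nulls" using w by (auto simp: gens_def)
next
  fix J a d
  assume J: "LG.seq.subsp J" "LG.nulls \<subseteq> J" "J \<subseteq> I"
    and mult: "\<And>a x. a \<in> I \<Longrightarrow> x \<in> J \<Longrightarrow> a * x \<in> J \<and> x * a \<in> J"
    and closed: "\<And>x. x \<in> LG.hats \<Longrightarrow> (\<And>k. \<exists>y\<in>J. LG.small k (x - y)) \<Longrightarrow> x \<in> J"
    and a: "a \<in> J" "a \<in> LG.homs d" "a \<notin> LG.nulls"
  obtain v where v: "v \<in> W" "tail_limit v \<in> J" using tail_limit_in_ideal[OF J mult closed a] by blast
  have lim: "tail_limit u \<in> J" if "u \<in> W" for u by (rule tail_limit_shift[OF J(1,2) mult v that])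
  show "gens \<subseteq> J"
  proof
    fix g assume "g \<in> gens"
    then obtain w where w: "w \<in> W" "g = (\<lambda>_. gvert w)" by (auto simp: gens_def)
    have wv: "w \<in> verts G" using w W_verts by blast
    have "\<exists>b\<in>J. LG.small k (g - b)" for k
    proof -
      \<comment> \<open>\<open>K\<close> collects the polynomials that J approximates to order k. By
        \<open>proj_induct\<close> with W as the set of admissible ends it contains the vertices of
        W; this holds for every k, and J is closed.\<close>
      define K where "K = {y \<in> FA. \<exists>b\<in>J. LG.small k ((\<lambda>_. y) - b)}"
      have NK: "N k \<subseteq> K"
      proof
        fix y assume "y \<in> N k"
        then have "LG.small k ((\<lambda>_. y) - 0)" by (simp add: small_iff)
        then show "y \<in> K" using LG.seq.subspD(1)[OF J(1)] \<open>y \<in> N k\<close> N_sub unfolding K_def by blast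
      qed
      have K: "poly.subsp K"
        unfolding poly.subsp_def
      proof (intro conjI ballI allI)
        show "0 \<in> K" using NK N_closed(1) by blast
        show "scal c y \<in> K" if y: "y \<in> K" for c y
        proof -
          obtain b where b: "b \<in> J" "LG.small k ((\<lambda>_. y) - b)" using y by (auto simp: K_def)
          have "LG.small k (LG.ssc c ((\<lambda>_. y) - b))" by (rule LG.small_ssc[OF b(2)])
          then have "LG.small k ((\<lambda>_. scal c y) - LG.ssc c b)" by (simp add: poly.sc_diff_right fun_diff_def)
          moreover have "LG.ssc c b \<in> J" by (rule LG.seq.subspD(3)[OF J(1) b(1)])
          moreover have "scal c y \<in> FA" using y by (simp add: K_def FA.S_closed)
          ultimately show ?thesis unfolding K_def by blast
        qed
        show "y + z \<in> K" if y: "y \<in> K" and z: "z \<in> K" for y z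
        proof -
          obtain b where b: "b \<in> J" "LG.small k ((\<lambda>_. y) - b)" using y by (auto simp: K_def)
          obtain b' where b': "b' \<in> J" "LG.small k ((\<lambda>_. z) - b')" using z by (auto simp: K_def)
          have "LG.small k (((\<lambda>_. y) - b) + ((\<lambda>_. z) - b'))" by (rule LG.small_add[OF b(2) b'(2)])
          moreover have "((\<lambda>_. y) - b) + ((\<lambda>_. z) - b') = (\<lambda>_. y + z) - (b + b')" by (simp add: fun_eq_iff)
          ultimately have "LG.small k ((\<lambda>_. y + z) - (b + b'))" by simp
          moreover have "b + b' \<in> J" by (rule LG.seq.subspD(2)[OF J(1) b(1) b'(1)])
          moreover have "y + z \<in> FA" using y z by (simp add: K_def FA.S_closed)
          ultimately show ?thesis unfolding K_def by blast
        qed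
      qed
      have "rel_ideal \<subseteq> K" using NK rel_ideal_N by blast
      have "proj w [] \<in> K"
      proof (rule proj_induct[OF K \<open>rel_ideal \<subseteq> K\<close> NK W_head])
        fix u p assume p: "isp u p" "endv u p \<in> W" "sdl p = 0"
        let ?e = "endv u p"
        have ev: "?e \<in> verts G" by (rule isp_verts(2)[OF p(1)])
        have cI: "(\<lambda>_. pm u p) \<in> I" "(\<lambda>_. sm u p) \<in> I"
          using const_I[OF p(2) pm_FA[OF p(1)]] const_I[OF p(2) sm_FA[OF p(1)]] pm_gvert[OF p(1) ev]
            eqv_star[OF pm_gvert[OF p(1) ev]] by (auto simp: star_mult star_word_def)
        \<comment> \<open>Conjugating the idempotent at the end of p by p gives the limit of the
          idempotents \<open>proj u (p @ zs ?e m)\<close>. Both outer factors lie in I because p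
          ends in W.\<close>
        let ?b = "(\<lambda>_. pm u p) * tail_limit ?e * (\<lambda>_. sm u p)"
        have bJ: "?b \<in> J" using mult cI lim[OF p(2)] by blast
        have bm: "?b m \<doteq> proj u (p @ zs ?e m)" for m
        proof -
          have z: "isp ?e (zs ?e m)" by (rule isp_zs[OF ev])
          have q: "isp u (p @ zs ?e m)" using p z by (simp add: isp_append)
          have "?b m = (pm u p * pm ?e (zs ?e m)) * (sm ?e (zs ?e m) * sm u p)"
            by (simp add: tail_limit_def proj_def mult.assoc)
          also have "\<dots> \<doteq> pm u (p @ zs ?e m) * (sm ?e (zs ?e m) * sm u p)"
            using pm_pm[OF p(1) z] by (intro eqv_mult_right FA.S_mult sm_FA z p) simp
          also have "\<dots> \<doteq> proj u (p @ zs ?e m)"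
            unfolding proj_def using sm_sm[OF p(1) z] by (intro eqv_mult_left pm_FA q) simp
          finally show ?thesis .
        qed
        have "LG.small k ((\<lambda>_. proj u (p @ zs ?e k)) - ?b)"
          unfolding small_iff eventually_sequentially
        proof (intro exI allI impI)
          fix m assume "m \<ge> k"
          then have "proj u (p @ zs ?e k) - proj u (p @ zs ?e m) \<in> N k"
            by (rule proj_tail_cauchy[OF p(1) order_refl])
          moreover have "?b m - proj u (p @ zs ?e m) \<in> N k" using bm[of m] rel_ideal_N unfolding eqv_def by blast
          ultimately have "(proj u (p @ zs ?e k) - proj u (p @ zs ?e m)) - (?b m - proj u (p @ zs ?e m)) \<in> N k"
            by (rule N_closed(5))
          then show "((\<lambda>_. proj u (p @ zs ?e k)) - ?b) m \<in> N k" by simp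
        qed
        moreover have "proj u (p @ zs ?e k) \<in> FA" by (rule proj_FA) (simp add: isp_append p isp_zs ev)
        ultimately show "\<exists>n. proj u (p @ zs ?e n) \<in> K" using bJ unfolding K_def by blast
      qed (use w wv in auto)
      then have "gvert w \<in> K"
        using poly.subsp_diff_iff[OF K, of "proj w []" "gvert w"] proj_Nil[OF wv] \<open>rel_ideal \<subseteq> K\<close>
        unfolding eqv_def by blast
      then show ?thesis by (auto simp: K_def w)
    qed
    moreover have "g \<in> LG.hats" using \<open>g \<in> gens\<close> gens_hats by blast
    ultimately show "g \<in> J" using closed by blast
  qed
qed

end

text \<open>Meeting of forward orbits is transitive because \<open>nx\<close> is a function, and it
  relates the two ends of every special edge in either order. It therefore propagates along any
  undirected path of special edges.\<close>

lemma special_subgraph_meet: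
  assumes fin: "fin_digraph G" and sp: "specialization G \<gamma>"
    and con: "Digraph_Component.connected (special_subgraph G \<gamma> W)" and uv: "u \<in> W" "v \<in> W"
  shows "\<exists>i j. (leavitt_graph.nx G \<gamma> ^^ i) u = (leavitt_graph.nx G \<gamma> ^^ j) v"
proof -
  interpret leavitt_graph G \<gamma> "TYPE('f::field)"
    using fin sp by (simp add: leavitt_graph_def leavitt_graph_axioms_def)
  let ?H = "special_subgraph G \<gamma> W"
  define R where "R a b \<longleftrightarrow> (\<exists>i j. (nx ^^ i) a = (nx ^^ j) b)" for a b
  have trans: "R a c" if ab: "R a b" and bc: "R b c" for a b c
  proof -
    obtain i j k l where ijkl: "(nx ^^ i) a = (nx ^^ j) b" "(nx ^^ k) b = (nx ^^ l) c"
      using ab bc unfolding R_def by blast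
    have "(nx ^^ (k + i)) a = (nx ^^ (k + j)) b" by (simp only: funpow_add o_apply ijkl(1))
    also have "\<dots> = (nx ^^ (j + k)) b" by (simp only: add.commute)
    also have "\<dots> = (nx ^^ (j + l)) c" by (simp only: funpow_add o_apply ijkl(2))
    finally have "(nx ^^ (k + i)) a = (nx ^^ (j + l)) c" .
    then show ?thesis unfolding R_def by blast
  qed
  have arc: "R (tail G e) (head G e) \<and> R (head G e) (tail G e)" if "e \<in> special" for e
  proof -
    have "e \<in> arcs G" "\<gamma> (tail G e) = e" using that special_iff by auto
    then have "nx (tail G e) = head G e" by (auto simp: nx_def sink_def out_arcs_def)
    then have "(nx ^^ 1) (tail G e) = (nx ^^ 0) (head G e)" by simp
    then show ?thesis unfolding R_def by metis
  qed
  have "(u, v) \<in> rtrancl_on (verts ?H) (\<Union>e\<in>arcs ?H. {(tail ?H e, head ?H e), (head ?H e, tail ?H e)})"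
    using con uv unfolding connected_def strongly_connected_def reachable_def
    by (simp add: parcs_mk_symmetric special_subgraph_def)
  then have "R u v"
  proof (induction rule: rtrancl_on_induct)
    case base
    then show ?case unfolding R_def by blast
  next
    case (step b c)
    then obtain e where "e \<in> special" "(b, c) = (tail G e, head G e) \<or> (b, c) = (head G e, tail G e)"
      by (auto simp: special_subgraph_def)
    then have "R b c" using arc by auto
    then show ?case using trans step by blast
  qed
  then show ?thesis by (simp add: R_def)
qed

theorem proposition2:
  fixes G :: "('v, 'e) pre_digraph"
    and Ws :: "'v set list"
    and \<gamma> :: "'v \<Rightarrow> 'e"
    and i :: nat
    and I :: "('f::field, 'v, 'e) leavitt_completion set"
  assumes "fin_digraph G" and "verts G \<noteq> {}"
    and "frame G Ws"
    and "regular_specialization G Ws \<gamma>"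
    and "i < length Ws"
    and "I = leavitt_hat_ideal G \<gamma> (Ws ! i)"
  shows "topologically_graded_simple
           ((leavitt_hat G \<gamma>)\<lparr>carrier := I\<rparr>)
           (subtopology (leavitt_hat_topology G \<gamma>) I)
           (\<lambda>j. I \<inter> leavitt_hat_component G \<gamma> j)"
proof -
  let ?W = "Ws ! i"
  have W: "?W \<in> set Ws" using assms(5) by simp
  then have her: "hereditary G ?W" using assms(3) by (auto simp: frame_def)
  have sp: "specialization G \<gamma>" and con: "Digraph_Component.connected (special_subgraph G \<gamma> ?W)"
    using assms(4) W by (auto simp: regular_specialization_def)
  interpret leavitt_graph G \<gamma> "TYPE('f)"
    using assms(1) sp by (simp add: leavitt_graph_def leavitt_graph_axioms_def)
  interpret frame_component G \<gamma> "TYPE('f)" ?W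
  proof
    show "?W \<subseteq> verts G" "?W \<noteq> {}" using her by (auto simp: hereditary_def)
    show "head G e \<in> ?W" if "e \<in> arcs G" "tail G e \<in> ?W" for e
    proof -
      have "tail G e \<rightarrow>\<^sup>*\<^bsub>G\<^esub> head G e" using that(1) by (intro reachable_adjI) (auto simp: arcs_ends_def arc_to_ends_def)
      then show ?thesis using her that(2) unfolding hereditary_def by blast
    qed
    show "\<exists>i j. (nx ^^ i) u = (nx ^^ j) v" if "u \<in> ?W" "v \<in> ?W" for u v
      by (rule special_subgraph_meet[OF assms(1) sp con that])
  qed
  have I: "I = LG.\<Phi> ` LG.gen_ideal gens"
    unfolding assms(6) gens_def by (rule hat_ideal_eq[OF W_verts])
  show ?thesis using component_simple unfolding I hat_eq hat_topology_eq comp_eq .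
qed

end
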